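(* Let $p$ be a prime number, let $M$ be the maximal abelian extension of $\mathbf{Q}_p$ of exponent $2$, and let $G=\operatorname{Gal}(M|\mathbf{Q}_p)$. There is a unique isomorphism of groups $\rho_M:\mathbf{Q}_p^\times/\mathbf{Q}_p^{\times 2}\to G$ such that for every quadratic extension $E$ of $\mathbf{Q}_p$, the kernel of the composite map $\rho_E:\mathbf{Q}_p^\times\to\operatorname{Gal}(E|\mathbf{Q}_p)$ is $N_{E|\mathbf{Q}_p}(E^\times)$.
   Context: All extensions are taken inside a fixed algebraic closure of $\mathbf{Q}_p$. The field $M$ is equivalently the compositum of all quadratic extensions of $\mathbf{Q}_p$, i.e. $M=\mathbf{Q}_p\big(\sqrt{\mathbf{Q}_p^\times}\big)$. For a quadratic extension $E\subset M$ of $\mathbf{Q}_p$, $\rho_E$ is the composite of the projection $\mathbf{Q}_p^\times\to\mathbf{Q}_p^\times/\mathbf{Q}_p^{\times2}$, the map $\rho_M$, and the restriction map $G\to\operatorname{Gal}(E|\mathbf{Q}_p)$. $N_{E|\mathbf{Q}_p}:E^\times\to\mathbf{Q}_p^\times$ is the norm map. *)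

theory Defs
  imports
    "HOL-Algebra.Algebra"
    "HOL-Algebra.Algebraic_Closure_Type"
    "Berlekamp_Zassenhaus.Finite_Field"
begin

section \<open>The field of p-adic numbers\<close>

text \<open>
  The prime is \<open>p = CARD('p)\<close> for a type \<open>'p\<close> of class \<^class>\<open>prime_card\<close>.
  The ring of p-adic integers is the inverse limit of the rings of integers modulo \<open>p ^ n\<close>,
  residue classes being represented by their least non-negative representatives, and
  the field of p-adic numbers is its field of fractions.
\<close>

typedef (overloaded) ('p :: prime_card) padic_int =
  "{f :: nat \<Rightarrow> int. \<forall>n. f n \<in> {0..<int CARD('p) ^ n} \<and> f (Suc n) mod int CARD('p) ^ n = f n}"
  morphisms padic_residue Abs_padic_int
  by (rule exI[of _ "\<lambda>_. 0"]) (use prime_card[where 'a = 'p] prime_gt_0_nat in auto)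

setup_lifting type_definition_padic_int

lemma padic_card_pos: "int CARD('p :: prime_card) ^ n > 0"
  using prime_gt_0_nat[OF prime_card[where 'a = 'p]] by simp

lemma padic_int_closed:
  fixes g :: "nat \<Rightarrow> int"
  assumes "\<And>n. g (Suc n) mod int CARD('p :: prime_card) ^ n = g n mod int CARD('p) ^ n"
  shows "g n mod int CARD('p) ^ n \<in> {0..<int CARD('p) ^ n} \<and>
    (g (Suc n) mod int CARD('p) ^ Suc n) mod int CARD('p) ^ n = g n mod int CARD('p) ^ n"
proof -
  have "int CARD('p) ^ n dvd int CARD('p) ^ Suc n" by simp
  then show ?thesis
    using padic_card_pos[where 'p = 'p, of n] assms[of n] by (simp add: mod_mod_cancel del: power_Suc)
qed

instantiation padic_int :: (prime_card) comm_ring_1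
begin

lift_definition zero_padic_int :: "'a padic_int" is "\<lambda>n. 0 mod int CARD('a) ^ n"
  by (rule padic_int_closed) simp

lift_definition one_padic_int :: "'a padic_int" is "\<lambda>n. 1 mod int CARD('a) ^ n"
  by (rule padic_int_closed) simp

lift_definition plus_padic_int :: "'a padic_int \<Rightarrow> 'a padic_int \<Rightarrow> 'a padic_int"
  is "\<lambda>f g n. (f n + g n) mod int CARD('a) ^ n"
  by (rule padic_int_closed) (metis mod_add_eq)

lift_definition minus_padic_int :: "'a padic_int \<Rightarrow> 'a padic_int \<Rightarrow> 'a padic_int"
  is "\<lambda>f g n. (f n - g n) mod int CARD('a) ^ n"
  by (rule padic_int_closed) (metis mod_diff_eq)

lift_definition uminus_padic_int :: "'a padic_int \<Rightarrow> 'a padic_int"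
  is "\<lambda>f n. (- f n) mod int CARD('a) ^ n"
  by (rule padic_int_closed) (metis mod_minus_eq)

lift_definition times_padic_int :: "'a padic_int \<Rightarrow> 'a padic_int \<Rightarrow> 'a padic_int"
  is "\<lambda>f g n. (f n * g n) mod int CARD('a) ^ n"
  by (rule padic_int_closed) (metis mod_mult_eq)

instance
proof
  fix a b c :: "'a padic_int"
  show "a + b + c = a + (b + c)"
    by transfer (simp add: mod_simps add_ac)
  show "a + b = b + a"
    by transfer (simp add: add_ac)
  show "0 + a = a"
    by transfer auto
  show "- a + a = 0"
    by transfer (simp add: mod_simps)
  show "a - b = a + - b"
    by transfer (simp add: mod_simps)
  show "a * b * c = a * (b * c)"
    by transfer (simp add: mod_simps mult_ac)
  show "a * b = b * a"
    by transfer (simp add: mult_ac)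
  show "1 * a = a"
    by transfer (auto simp: mod_simps)
  show "(a + b) * c = a * c + b * c"
    by transfer (simp add: mod_simps distrib_right)
  have "1 mod int CARD('a) ^ 1 \<noteq> 0 mod int CARD('a) ^ 1"
    using prime_gt_1_nat[OF prime_card[where 'a = 'a]] by simp
  then show "(0 :: 'a padic_int) \<noteq> 1"
    by transfer (metis)
qed

end

lemma padic_residue_dvd:
  fixes a :: "'p :: prime_card padic_int"
  assumes "int CARD('p) ^ m dvd padic_residue a (m + n)"
  shows "padic_residue a m = 0"
proof -
  have "padic_residue a (m + n) mod int CARD('p) ^ m = padic_residue a m" for n
  proof (induction n)
    case 0
    show ?case using padic_residue[of a] by auto
  next
    case (Suc n)
    have "padic_residue a (m + Suc n) mod int CARD('p) ^ m =
        padic_residue a (Suc (m + n)) mod int CARD('p) ^ (m + n) mod int CARD('p) ^ m"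
      by (simp add: mod_mod_cancel le_imp_power_dvd)
    also have "\<dots> = padic_residue a (m + n) mod int CARD('p) ^ m"
      using padic_residue[of a] by auto
    finally show ?case using Suc.IH by simp
  qed
  then show ?thesis using assms by (metis dvd_imp_mod_0)
qed

instance padic_int :: (prime_card) idom
proof
  fix a b :: "'a padic_int"
  assume "a \<noteq> 0" "b \<noteq> 0"
  then obtain m n where mn: "padic_residue a m \<noteq> 0" "padic_residue b n \<noteq> 0"
    by (metis (no_types, lifting) ext mod_0 padic_residue_inject zero_padic_int.rep_eq)
  let ?p = "int CARD('a)"
  have nd: "\<not> ?p ^ m dvd padic_residue a (m + n)" "\<not> ?p ^ n dvd padic_residue b (m + n)"
    using padic_residue_dvd[of m a n] padic_residue_dvd[of n b m] mn by (auto simp: add.commute)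
  have p: "Factorial_Ring.prime ?p" using prime_card[where 'a = 'a] by simp
  have nz: "padic_residue a (m + n) \<noteq> 0" "padic_residue b (m + n) \<noteq> 0"
    using nd by auto
  have lt: "multiplicity ?p (padic_residue a (m + n)) < m"
    "multiplicity ?p (padic_residue b (m + n)) < n"
    using nd by (meson multiplicity_dvd' not_le)+
  have "\<not> ?p ^ (m + n) dvd padic_residue a (m + n) * padic_residue b (m + n)"
  proof
    assume "?p ^ (m + n) dvd padic_residue a (m + n) * padic_residue b (m + n)"
    then have "m + n \<le> multiplicity ?p (padic_residue a (m + n) * padic_residue b (m + n))"
      using p nz by (intro multiplicity_geI) (auto simp: not_prime_unit)
    then show False
      using lt p nz by (simp add: prime_elem_multiplicity_mult_distrib)
  qed
  then have "padic_residue (a * b) (m + n) \<noteq> 0"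
    by (simp add: times_padic_int.rep_eq dvd_eq_mod_eq_0)
  then show "a * b \<noteq> 0"
    by (auto simp: zero_padic_int.rep_eq)
qed

type_synonym 'p padic = "'p padic_int fract"

section \<open>Extensions of the p-adic numbers inside a fixed algebraic closure\<close>

text \<open>The base field, as a subfield of its algebraic closure \<^typ>\<open>'p padic alg_closure\<close>.\<close>

definition padic_base :: "'p :: prime_card padic alg_closure set" where
  "padic_base = range to_ac"

definition padic_extension :: "'p :: prime_card padic alg_closure set \<Rightarrow> bool" where
  "padic_extension F \<longleftrightarrow> subfield F ring_of_type_algebra \<and> padic_base \<subseteq> F"

definition quadratic_extension :: "'p :: prime_card padic alg_closure set \<Rightarrow> bool" where
  "quadratic_extension E \<longleftrightarrow>
     padic_extension E \<and> ring.dimension ring_of_type_algebra 2 padic_base E"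

text \<open>The multiplication of \<^const>\<open>BijGroup\<close> is composition; automorphisms of \<open>F\<close>
  are represented by functions that are \<^const>\<open>undefined\<close> outside \<open>F\<close>.\<close>

definition Gal :: "'p :: prime_card padic alg_closure set
    \<Rightarrow> ('p padic alg_closure \<Rightarrow> 'p padic alg_closure) monoid" where
  "Gal F = (BijGroup F)
     \<lparr>carrier := {\<sigma> \<in> Bij F.
        \<sigma> \<in> Ring.ring_hom (ring_of_type_algebra\<lparr>carrier := F\<rparr>) (ring_of_type_algebra\<lparr>carrier := F\<rparr>) \<and>
        (\<forall>x\<in>padic_base. \<sigma> x = x)}\<rparr>"

text \<open>Extensions are algebraic here, so being Galois amounts to the base field being the
  fixed field.\<close>

definition galois_extension :: "'p :: prime_card padic alg_closure set \<Rightarrow> bool" where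
  "galois_extension F \<longleftrightarrow>
     padic_extension F \<and> {x \<in> F. \<forall>\<sigma>\<in>carrier (Gal F). \<sigma> x = x} = padic_base"

definition abelian_extension_exp2 :: "'p :: prime_card padic alg_closure set \<Rightarrow> bool" where
  "abelian_extension_exp2 F \<longleftrightarrow>
     galois_extension F \<and> comm_group (Gal F) \<and>
     (\<forall>\<sigma>\<in>carrier (Gal F). \<sigma> [^]\<^bsub>Gal F\<^esub> (2 :: nat) = \<one>\<^bsub>Gal F\<^esub>)"

text \<open>The order on sets is inclusion.\<close>

definition max_abelian_exp2 :: "'p :: prime_card padic alg_closure set" where
  "max_abelian_exp2 = (GREATEST F. abelian_extension_exp2 F)"

text \<open>In characteristic zero every finite extension is separable, so that the norm of \<open>x\<close> is the
  product of the \<open>\<sigma> x\<close>, where \<open>\<sigma>\<close> runs over the embeddings of \<open>E\<close> over the base field into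
  the algebraic closure.\<close>

definition padic_embeddings :: "'p :: prime_card padic alg_closure set
    \<Rightarrow> ('p padic alg_closure \<Rightarrow> 'p padic alg_closure) set" where
  "padic_embeddings E =
     {\<sigma> \<in> extensional E.
        \<sigma> \<in> Ring.ring_hom (ring_of_type_algebra\<lparr>carrier := E\<rparr>) ring_of_type_algebra \<and>
        (\<forall>x\<in>padic_base. \<sigma> x = x)}"

definition padic_norm :: "'p :: prime_card padic alg_closure set
    \<Rightarrow> 'p padic alg_closure \<Rightarrow> 'p padic" where
  "padic_norm E x = of_ac (\<Prod>\<sigma>\<in>padic_embeddings E. \<sigma> x)"

section \<open>The multiplicative group\<close>

definition padic_mult_group :: "'p :: prime_card padic monoid" where
  "padic_mult_group = mult_of ring_of_type_algebra"

definition padic_squares :: "'p :: prime_card padic set" where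
  "padic_squares = {x [^]\<^bsub>padic_mult_group\<^esub> (2 :: nat) | x. x \<in> carrier padic_mult_group}"

definition padic_square_classes :: "'p :: prime_card padic set monoid" where
  "padic_square_classes = padic_mult_group Mod padic_squares"

text \<open>Given a map \<open>\<rho>\<close> from the square classes to the Galois group of a field containing \<open>E\<close>:
  the composite of the projection to the square classes, \<open>\<rho>\<close> and the restriction to \<open>E\<close>.\<close>

definition restricted_map :: "('p :: prime_card padic set
      \<Rightarrow> 'p padic alg_closure \<Rightarrow> 'p padic alg_closure)
    \<Rightarrow> 'p padic alg_closure set \<Rightarrow> 'p padic \<Rightarrow> 'p padic alg_closure \<Rightarrow> 'p padic alg_closure" where
  "restricted_map \<rho> E a = restrict (\<rho> (padic_squares #>\<^bsub>padic_mult_group\<^esub> a)) E"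

end

(*
  Kummer theory turns rho_M into a pairing on K = Q_p^* modulo squares: rho_M(a) must send sqrt c to
  +- sqrt c, with sign + exactly when a is a norm from K(sqrt c), i.e. when a = x^2 - c y^2 is solvable
  (the predicate norm_rep a c). An automorphism of M is determined by these signs, which gives
  uniqueness. Existence amounts to the Hilbert symbol being bilinear and non-degenerate on the finite
  group of square classes. The symbol is symmetric, so it is enough that each norm group has index at
  most 2; this and non-degeneracy follow from representatives of the square classes (Hensel), a few
  explicit norms, and one (p odd) or two (p = 2) equations without solutions, by descent.
  M is the additive span of the square roots of elements of Q_p, and an element of an abelian
  extension of exponent 2 is such a sum: write x as half of (x + s x) + (x - s x) and descend on the
  number of conjugates of the square.
*)
theory Submission
  imports Defs "HOL-Number_Theory.Euler_Criterion"
begin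

section \<open>The Hilbert symbol over a field\<close>

text \<open>If \<open>c\<close> is a non-zero square, x^2 - c y^2 represents every element, so
  \<open>norm_rep\<close> covers the split case and the quadratic fields uniformly. Norms are closed
  under multiplication for free; what has to be proved is that two non-norms multiply to a norm, and
  this is what index at most 2 provides. Symmetry then carries linearity from \<open>a\<close> over
  to \<open>c\<close>. No group orders are compared. Surjectivity of rho_M comes from writing down,
  for every character, an element that induces it, by means of a basis dual to the generators under
  the symbol: the generators are p and a non-residue for odd p, and -1, 2, 5 for p = 2. Signs cannot
  be prescribed independently on all square roots, since the roots satisfy relations. Adjoining one
  root t at a time settles this: the square roots in F(t) lie in F or in F t, so that
  multiplicativity of the prescribed signs is the only compatibility condition. Finiteness of the
  group of square classes makes the tower end at M.\<close>

definition norm_rep :: "'a :: field \<Rightarrow> 'a \<Rightarrow> bool" where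
  "norm_rep a c \<longleftrightarrow> (\<exists>x y. a = x\<^sup>2 - c * y\<^sup>2)"

lemma norm_repI: "a = x\<^sup>2 - c * y\<^sup>2 \<Longrightarrow> norm_rep a c"
  unfolding norm_rep_def by blast

lemma norm_rep_square_left: "norm_rep (s\<^sup>2) c"
  by (rule norm_repI[of _ s _ 0]) simp

lemma norm_rep_uminus_self: "norm_rep (- c) c"
  by (rule norm_repI[of _ 0 _ 1]) simp

text \<open>The form factors as (x - s y)(x + s y), and the witness makes the two factors 1 and
  \<open>a\<close>.\<close>

lemma norm_rep_square_right:
  fixes s :: "'a :: field_char_0"
  assumes "s \<noteq> 0"
  shows "norm_rep a (s\<^sup>2)"
  by (rule norm_repI[of _ "(a + 1) / 2" _ "(a - 1) / (2 * s)"])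
    (use assms in \<open>simp add: power2_eq_square field_simps\<close>)

lemma norm_rep_mult:
  assumes "norm_rep a c" "norm_rep b c"
  shows "norm_rep (a * b) c"
proof -
  from assms obtain x y z w where ab: "a = x\<^sup>2 - c * y\<^sup>2" "b = z\<^sup>2 - c * w\<^sup>2"
    unfolding norm_rep_def by blast
  \<comment> \<open>This is the norm of (x + y sqrt c)(z + w sqrt c).\<close>
  have "a * b = (x * z + c * y * w)\<^sup>2 - c * (x * w + y * z)\<^sup>2"
    unfolding ab by (simp add: power2_eq_square algebra_simps)
  then show ?thesis by (rule norm_repI)
qed

lemma norm_rep_mult_square_left:
  assumes "s \<noteq> 0"
  shows "norm_rep (a * s\<^sup>2) c \<longleftrightarrow> norm_rep a c"
proof
  assume "norm_rep (a * s\<^sup>2) c"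
  then have "norm_rep (a * s\<^sup>2 * (1 / s)\<^sup>2) c"
    using norm_rep_mult norm_rep_square_left by blast
  then show "norm_rep a c" using assms by (simp add: power2_eq_square)
qed (simp add: norm_rep_mult norm_rep_square_left)

text \<open>Dividing by the norm \<open>a\<close> is the same as multiplying by it, up to the square
  of \<open>a\<close>.\<close>

lemma norm_rep_mult_cancel:
  assumes "norm_rep a c" "a \<noteq> 0"
  shows "norm_rep (a * b) c \<longleftrightarrow> norm_rep b c"
proof
  assume "norm_rep (a * b) c"
  then have "norm_rep (a * (a * b)) c"
    using assms(1) norm_rep_mult by blast
  then have "norm_rep (b * a\<^sup>2) c" by (simp add: power2_eq_square mult_ac)
  then show "norm_rep b c" using norm_rep_mult_square_left[OF assms(2)] by simp
qed (simp add: assms(1) norm_rep_mult)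

text \<open>Solve a = x^2 - c y^2 for \<open>c\<close>. If y = 0 this is impossible, but then
  \<open>a\<close> is a square and everything is a norm for it.\<close>

lemma norm_rep_commute:
  fixes a c :: "'a :: field_char_0"
  assumes "a \<noteq> 0" "c \<noteq> 0"
  shows "norm_rep a c \<longleftrightarrow> norm_rep c a"
proof -
  have *: "norm_rep c a" if "norm_rep a c" "a \<noteq> 0" for a c :: 'a
  proof -
    from that obtain x y where xy: "a = x\<^sup>2 - c * y\<^sup>2"
      unfolding norm_rep_def by blast
    show ?thesis
    proof (cases "y = 0")
      case True
      then show ?thesis using xy that norm_rep_square_right by auto
    next
      case False
      have "c = (x / y)\<^sup>2 - a * (1 / y)\<^sup>2"
        using False unfolding xy by (simp add: field_simps power2_eq_square)
      then show ?thesis by (rule norm_repI)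
    qed
  qed
  show ?thesis using *[of a c] *[of c a] assms by blast
qed

lemma norm_rep_mult_square_right:
  fixes a c :: "'a :: field_char_0"
  assumes "s \<noteq> 0"
  shows "norm_rep a (c * s\<^sup>2) \<longleftrightarrow> norm_rep a c"
proof
  assume "norm_rep a (c * s\<^sup>2)"
  then obtain x y where "a = x\<^sup>2 - c * s\<^sup>2 * y\<^sup>2" unfolding norm_rep_def by blast
  then show "norm_rep a c" by (intro norm_repI[of _ x _ "s * y"]) (simp add: power_mult_distrib)
next
  assume "norm_rep a c"
  then obtain x y where "a = x\<^sup>2 - c * y\<^sup>2" unfolding norm_rep_def by blast
  then show "norm_rep a (c * s\<^sup>2)" using assms
    by (intro norm_repI[of _ x _ "y / s"]) (simp add: power_divide)
qed

section \<open>The p-adic integers\<close>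

lemma padic_residue_0 [simp]: "padic_residue (0 :: 'p :: prime_card padic_int) n = 0"
  by (simp add: zero_padic_int.rep_eq)

lemma padic_residue_add:
  "padic_residue (a + b :: 'p :: prime_card padic_int) n =
     (padic_residue a n + padic_residue b n) mod int CARD('p) ^ n"
  by (simp add: plus_padic_int.rep_eq)

lemma padic_residue_diff:
  "padic_residue (a - b :: 'p :: prime_card padic_int) n =
     (padic_residue a n - padic_residue b n) mod int CARD('p) ^ n"
  by (simp add: minus_padic_int.rep_eq)

lemma padic_residue_mult:
  "padic_residue (a * b :: 'p :: prime_card padic_int) n =
     (padic_residue a n * padic_residue b n) mod int CARD('p) ^ n"
  by (simp add: times_padic_int.rep_eq)

lemma padic_residue_of_nat:
  "padic_residue (of_nat k :: 'p :: prime_card padic_int) n = int k mod int CARD('p) ^ n"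
  by (induction k) (simp_all add: padic_residue_add one_padic_int.rep_eq mod_simps)

lemma padic_residue_of_int:
  "padic_residue (of_int k :: 'p :: prime_card padic_int) n = k mod int CARD('p) ^ n"
proof (cases "k \<ge> 0")
  case True
  then show ?thesis using padic_residue_of_nat[of "nat k" n, where 'p = 'p] by simp
next
  case False
  then have "(of_int k :: 'p padic_int) = - of_nat (nat (- k))" by simp
  then show ?thesis using False
    by (simp only: uminus_padic_int.rep_eq padic_residue_of_nat mod_minus_eq) simp
qed

lemma padic_residue_range:
  "0 \<le> padic_residue (a :: 'p :: prime_card padic_int) n"
  "padic_residue (a :: 'p :: prime_card padic_int) n < int CARD('p) ^ n"
  using padic_residue[of a] by auto

lemma padic_residue_mod_self:
  "padic_residue (a :: 'p :: prime_card padic_int) n mod int CARD('p) ^ n = padic_residue a n"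
  using padic_residue[of a] by auto

lemma padic_residue_mod:
  assumes "m \<le> n"
  shows "padic_residue (a :: 'p :: prime_card padic_int) n mod int CARD('p) ^ m = padic_residue a m"
  using assms
proof (induction n rule: dec_induct)
  case (step n)
  have "padic_residue a (Suc n) mod int CARD('p) ^ m =
      padic_residue a (Suc n) mod int CARD('p) ^ n mod int CARD('p) ^ m"
    using step by (simp add: mod_mod_cancel le_imp_power_dvd)
  also have "\<dots> = padic_residue a m"
    using padic_residue[of a] step by auto
  finally show ?case .
qed (rule padic_residue_mod_self)

lemma padic_int_eqI: "(\<And>n. padic_residue a n = padic_residue b n) \<Longrightarrow> a = b"
  by (metis ext padic_residue_inject)

text \<open>Two naturals i < j are already told apart modulo p^j, because j < p^j.\<close>

instance padic_int :: (prime_card) ring_char_0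
proof
  have neq: "(of_nat i :: 'a padic_int) \<noteq> of_nat j" if "i < j" for i j
  proof
    assume eq: "(of_nat i :: 'a padic_int) = of_nat j"
    have "j < CARD('a) ^ j"
      using prime_gt_1_nat[OF prime_card[where 'a = 'a]] power_gt_expt[of "CARD('a)" j] by simp
    then have "int j < int CARD('a) ^ j"
      by (metis of_nat_less_iff of_nat_power)
    then have "padic_residue (of_nat i :: 'a padic_int) j = int i"
      "padic_residue (of_nat j :: 'a padic_int) j = int j"
      using that by (simp_all add: padic_residue_of_nat)
    with eq that show False by simp
  qed
  show "inj (of_nat :: nat \<Rightarrow> 'a padic_int)"
    by (rule injI) (metis neq linorder_neqE_nat)
qed

text \<open>Dividing by p costs one level: the residue of the quotient modulo p^n is read off from
  \<open>a\<close> modulo p^(n+1). The formula belongs to the conclusion because later inductions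
  follow the level of a residue.\<close>

lemma padic_dvd_of_residue_eq_0:
  fixes a :: "'p :: prime_card padic_int"
  assumes "padic_residue a 1 = 0"
  obtains b where "a = of_nat CARD('p) * b"
    "\<And>n. padic_residue b n = padic_residue a (Suc n) div int CARD('p)"
proof -
  let ?p = "int CARD('p)"
  have p: "?p > 0" using padic_card_pos[where 'p = 'p, of 1] by simp
  let ?f = "\<lambda>n. padic_residue a (Suc n) div ?p"
  have dvd: "?p dvd padic_residue a (Suc n)" for n
    using padic_residue_mod[of 1 "Suc n" a] assms by auto
  have f: "\<forall>n. ?f n \<in> {0..<?p ^ n} \<and> ?f (Suc n) mod ?p ^ n = ?f n"
  proof
    fix n
    have "padic_residue a (Suc n) \<in> {0..<?p * ?p ^ n}"
      using padic_residue_range[of a "Suc n"] by simp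
    then have "?f n \<in> {0..<?p ^ n}"
      using p dvd[of n] by (auto simp: pos_imp_zdiv_nonneg_iff elim!: dvdE)
    moreover have "?f (Suc n) mod ?p ^ n = (padic_residue a (Suc (Suc n)) mod (?p * ?p ^ n)) div ?p"
      using p dvd[of "Suc n"] by (auto simp: mult_mod_right[symmetric] elim!: dvdE)
    moreover have "padic_residue a (Suc (Suc n)) mod (?p * ?p ^ n) = padic_residue a (Suc n)"
      using padic_residue_mod[of "Suc n" "Suc (Suc n)" a] by simp
    ultimately show "?f n \<in> {0..<?p ^ n} \<and> ?f (Suc n) mod ?p ^ n = ?f n" by simp
  qed
  define b :: "'p padic_int" where "b = Abs_padic_int ?f"
  have b: "padic_residue b n = ?f n" for n
    unfolding b_def using f by (subst Abs_padic_int_inverse) auto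
  have "a = of_nat CARD('p) * b"
  proof (rule padic_int_eqI)
    fix n
    have "padic_residue (of_nat CARD('p) * b) n = ?p * ?f n mod ?p ^ n"
      by (simp add: padic_residue_mult padic_residue_of_nat b mod_simps)
    also have "?p * ?f n = padic_residue a (Suc n)"
      using dvd[of n] by simp
    finally show "padic_residue a n = padic_residue (of_nat CARD('p) * b) n"
      using padic_residue_mod[of n "Suc n" a] by simp
  qed
  then show ?thesis using that b by blast
qed

lemma padic_int_decompose:
  fixes a :: "'p :: prime_card padic_int"
  assumes "a \<noteq> 0"
  obtains n b where "a = of_nat CARD('p) ^ n * b" "padic_residue b 1 \<noteq> 0"
proof -
  let ?P = "of_nat CARD('p) :: 'p padic_int"
  \<comment> \<open>Induction on a level \<open>m\<close> with non-zero residue. Division by p moves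
    such a level down by one, and level 0 is impossible because residues modulo 1 vanish.\<close>
  have "\<exists>n b. a = ?P ^ n * b \<and> padic_residue b 1 \<noteq> 0"
    if "padic_residue a m \<noteq> 0" for m and a :: "'p padic_int"
    using that
  proof (induction m arbitrary: a)
    case 0
    then show ?case using padic_residue_range[of a 0] by simp
  next
    case (Suc m)
    show ?case
    proof (cases "padic_residue a 1 = 0")
      case True
      then obtain b where b: "a = ?P * b"
        "\<And>n. padic_residue b n = padic_residue a (Suc n) div int CARD('p)"
        using padic_dvd_of_residue_eq_0 by blast
      have "int CARD('p) dvd padic_residue a (Suc m)"
        using padic_residue_mod[of 1 "Suc m" a] True by auto
      with Suc.prems have "padic_residue b m \<noteq> 0" by (auto simp: b(2))
      then obtain n c where "b = ?P ^ n * c \<and> padic_residue c 1 \<noteq> 0" using Suc.IH by blast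
      then show ?thesis using b(1) by (intro exI[of _ "Suc n"] exI[of _ c]) (simp add: mult_ac)
    next
      case False
      then show ?thesis by (intro exI[of _ 0] exI[of _ a]) simp
    qed
  qed
  moreover have "\<exists>m. padic_residue a m \<noteq> 0"
    using assms padic_int_eqI[of a 0] by auto
  ultimately show ?thesis using that by blast
qed

lemma padic_int_eq_0_of_dvd:
  fixes a :: "'p :: prime_card padic_int"
  assumes "\<And>n. of_nat CARD('p) ^ n dvd a"
  shows "a = 0"
proof (rule padic_int_eqI)
  fix n
  obtain b where "a = of_nat (CARD('p) ^ n) * b" using assms[of n] by (auto simp: dvd_def)
  then show "padic_residue a n = padic_residue 0 n"
    by (simp only: padic_residue_mult padic_residue_of_nat) simp
qed

text \<open>Successive approximation: the map \<open>v \<mapsto> a + p (b v + c v\<^sup>2)\<close> is a contraction.\<close>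

lemma padic_int_fixed_point:
  fixes a b c :: "'p :: prime_card padic_int"
  obtains v where "v = a + of_nat CARD('p) * (b * v + c * v\<^sup>2)"
proof -
  let ?p = "int CARD('p)"
  define F where "F = (\<lambda>v. a + of_nat CARD('p) * (b * v + c * v\<^sup>2))"
  have contract: "padic_residue (F v) (Suc n) = padic_residue (F w) (Suc n)"
    if "padic_residue v n = padic_residue w n" for v w n
  proof -
    have "padic_residue (b * v + c * v\<^sup>2) n = padic_residue (b * w + c * w\<^sup>2) n"
      using that by (simp add: padic_residue_add padic_residue_mult power2_eq_square)
    then have "padic_residue (b * v + c * v\<^sup>2) (Suc n) mod ?p ^ n =
        padic_residue (b * w + c * w\<^sup>2) (Suc n) mod ?p ^ n"
      using padic_residue_mod[of n "Suc n" "b * v + c * v\<^sup>2"]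
        padic_residue_mod[of n "Suc n" "b * w + c * w\<^sup>2"] by simp
    then have "?p * padic_residue (b * v + c * v\<^sup>2) (Suc n) mod ?p ^ Suc n =
        ?p * padic_residue (b * w + c * w\<^sup>2) (Suc n) mod ?p ^ Suc n"
      by (metis mult_mod_right power_Suc)
    then have "padic_residue (of_nat CARD('p) * (b * v + c * v\<^sup>2)) (Suc n) =
        padic_residue (of_nat CARD('p) * (b * w + c * w\<^sup>2)) (Suc n)"
      by (simp only: padic_residue_mult padic_residue_of_nat mod_mult_left_eq)
    then show ?thesis by (simp only: F_def padic_residue_add)
  qed
  define s where "s = (\<lambda>n. (F ^^ n) 0)"
  have s: "padic_residue (s (Suc n)) n = padic_residue (s n) n" for n
  proof (induction n)
    case 0
    then show ?case
      using padic_residue_range[of "s 0" 0] padic_residue_range[of "s 1" 0] by simp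
  next
    case (Suc n)
    then show ?case using contract[of "s (Suc n)" n "s n"] by (simp add: s_def)
  qed
  \<comment> \<open>Consecutive iterates \<open>s n\<close> and \<open>s (Suc n)\<close> agree
    modulo p^n, so the limit is read off the diagonal.\<close>
  define v :: "'p padic_int" where "v = Abs_padic_int (\<lambda>n. padic_residue (s n) n)"
  have "\<forall>n. padic_residue (s n) n \<in> {0..<?p ^ n} \<and>
      padic_residue (s (Suc n)) (Suc n) mod ?p ^ n = padic_residue (s n) n"
    using s padic_residue padic_residue_mod[of n "Suc n" for n] by auto
  then have v: "padic_residue v n = padic_residue (s n) n" for n
    unfolding v_def by (subst Abs_padic_int_inverse) auto
  have "v = F v"
  proof (rule padic_int_eqI)
    fix n
    have "padic_residue (F v) (Suc n) = padic_residue (F (s n)) (Suc n)"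
      by (rule contract) (rule v)
    then have "padic_residue (F v) n = padic_residue (s (Suc n)) n"
      using padic_residue_mod[of n "Suc n"] by (metis s_def funpow.simps(2) comp_apply le_add2 plus_1_eq_Suc)
    then show "padic_residue v n = padic_residue (F v) n" by (simp add: v s)
  qed
  then show ?thesis using that unfolding F_def by blast
qed

section \<open>Hensel's lemma for squares, and descent\<close>

lemma padic_dvd_of_residue_eq_0':
  fixes a :: "'p :: prime_card padic_int"
  assumes "padic_residue a n = 0"
  shows "of_nat CARD('p) ^ n dvd a"
  using assms
proof (induction n arbitrary: a)
  case (Suc n)
  have "padic_residue a 1 = 0" using padic_residue_mod[of 1 "Suc n" a] Suc.prems by simp
  then obtain b where b: "a = of_nat CARD('p) * b"
    "\<And>n. padic_residue b n = padic_residue a (Suc n) div int CARD('p)"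
    using padic_dvd_of_residue_eq_0 by blast
  then have "of_nat CARD('p) ^ n dvd b" using Suc by simp
  then show ?case using b(1) by simp
qed simp

text \<open>Write w = r^2 + p x. A root r + p v requires x = 2 r v + p v^2. Multiplying by an
  inverse \<open>i\<close> of 2 r modulo p, with 2 r i = 1 + p j, turns this into v = i x - p (j v +
  i v^2), which \<open>padic_int_fixed_point\<close> solves.\<close>

lemma padic_int_square_of_quadratic_residue:
  fixes w :: "'p :: prime_card padic_int"
  assumes "CARD('p) > 2" "padic_residue w 1 \<noteq> 0" "QuadRes (int CARD('p)) (padic_residue w 1)"
  obtains t where "w = t\<^sup>2"
proof -
  let ?p = "int CARD('p)" and ?P = "of_nat CARD('p) :: 'p padic_int"
  have p: "Factorial_Ring.prime ?p" using prime_card[where 'a = 'p] by simp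
  obtain r where r: "[r\<^sup>2 = padic_residue w 1] (mod ?p)"
    using assms(3) unfolding QuadRes_def by blast
  have "padic_residue (w - of_int (r\<^sup>2)) 1 = 0"
    using r by (simp only: padic_residue_diff padic_residue_of_int) (simp add: cong_def mod_simps)
  then obtain x where x: "w - of_int (r\<^sup>2) = ?P * x"
    using padic_dvd_of_residue_eq_0 by blast
  have "\<not> ?p dvd r"
  proof
    assume "?p dvd r"
    then have "[r\<^sup>2 = 0] (mod ?p)" by (simp add: cong_0_iff power2_eq_square)
    then show False using r assms(2) padic_residue_mod_self[of w 1] by (simp add: cong_def)
  qed
  moreover have "\<not> ?p dvd 2" using assms(1) by (auto dest: zdvd_imp_le)
  ultimately have "coprime (2 * r) ?p"
    using p by (meson prime_dvd_multD prime_imp_coprime coprime_commute)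
  then obtain i where "[2 * r * i = 1] (mod ?p)" using cong_solve_coprime_int by blast
  then obtain j where "2 * r * i - 1 = ?p * j" by (auto simp: cong_iff_dvd_diff)
  then have j: "2 * r * i = 1 + ?p * j" by simp
  \<comment> \<open>The integer \<open>i\<close> inverts 2 r only modulo p; the equation for x is
    recovered by cancelling it in the domain.\<close>
  have i: "i \<noteq> 0"
  proof
    assume "i = 0"
    then have "1 = ?p * - j" using j by simp
    then have "?p dvd 1" by (rule dvdI)
    then show False using p not_prime_unit by blast
  qed
  have j': "2 * of_int r * of_int i = (1 + ?P * of_int j :: 'p padic_int)"
    using arg_cong[OF j, of "of_int :: int \<Rightarrow> 'p padic_int"] by simp
  obtain v where v: "v = of_int i * x + ?P * (- of_int j * v + - of_int i * v\<^sup>2)"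
    using padic_int_fixed_point by blast
  have "of_int i * (2 * of_int r * v + ?P * v\<^sup>2 - x) =
      (2 * of_int r * of_int i) * v + ?P * of_int i * v\<^sup>2 - of_int i * x"
    by (simp add: algebra_simps)
  also have "\<dots> = v - (of_int i * x + ?P * (- of_int j * v + - of_int i * v\<^sup>2))"
    unfolding j' by (simp add: algebra_simps)
  also have "\<dots> = 0" using v by simp
  finally have "x = 2 * of_int r * v + ?P * v\<^sup>2" using i by simp
  then have "w = (of_int r + ?P * v)\<^sup>2"
    using x by (simp add: power2_eq_square algebra_simps)
  then show ?thesis using that by blast
qed

text \<open>For w = 1 + 8 x a root of the form 1 + 4 v amounts to x = v + 2 v^2, since a factor 8
  cancels. As p = 2, this is a fixed-point equation with b = 0 and c = -1.\<close>

lemma padic_int_square_of_mod_8: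
  fixes w :: "'p :: prime_card padic_int"
  assumes "CARD('p) = 2" "padic_residue w 3 = 1"
  obtains t where "w = t\<^sup>2"
proof -
  have "padic_residue (w - 1) 3 = 0"
    using assms by (simp add: padic_residue_diff one_padic_int.rep_eq)
  then have "of_nat CARD('p) ^ 3 dvd w - 1" by (rule padic_dvd_of_residue_eq_0')
  then obtain x where x: "w - 1 = 8 * x" using assms(1) by (auto simp: dvd_def)
  obtain v where v: "v = x + of_nat CARD('p) * (0 * v + (- 1) * v\<^sup>2)"
    using padic_int_fixed_point by blast
  then have "x = v + 2 * v\<^sup>2" using assms(1) by (simp add: algebra_simps)
  then have "w = (1 + 4 * v)\<^sup>2" using x by (simp add: power2_eq_square algebra_simps)
  then show ?thesis using that by blast
qed

text \<open>Every step extracts one more factor p from \<open>z\<close>, so \<open>z\<close> is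
  divisible by all powers of p. Only \<open>z\<close> is followed: in the application to norms it is
  the common denominator.\<close>

lemma padic_int_descent:
  fixes z :: "'p :: prime_card padic_int"
  assumes step: "\<And>x y z. Q x y z \<Longrightarrow> \<exists>a b c. z = of_nat CARD('p) * c \<and> Q a b c"
    and "Q x y z"
  shows "z = 0"
proof (rule padic_int_eq_0_of_dvd)
  fix n
  show "of_nat CARD('p) ^ n dvd z"
    using assms(2)
  proof (induction n arbitrary: x y z)
    case (Suc n)
    obtain a b c where abc: "z = of_nat CARD('p) * c" "Q a b c"
      using step[OF Suc.prems] by blast
    show ?case using Suc.IH[OF abc(2)] by (simp add: abc(1))
  qed simp
qed

section \<open>Quadratic residues modulo p\<close>

lemma QuadRes_0: "QuadRes p 0"
  unfolding QuadRes_def by (rule exI[of _ 0]) simp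

lemma QuadRes_cong: "[a = b] (mod p) \<Longrightarrow> QuadRes p a \<longleftrightarrow> QuadRes p b"
  unfolding QuadRes_def using cong_trans cong_sym by blast

text \<open>Otherwise all naturals are residues by induction: n is some y^2 modulo p, hence n + 1 is
  y^2 + 1. Then squaring is surjective on the residues, so it is injective, although 1 and p - 1
  have the same square.\<close>

lemma exists_not_QuadRes_Suc_square:
  assumes "2 < (p :: nat)"
  obtains x where "\<not> QuadRes (int p) (x\<^sup>2 + 1)"
proof (rule ccontr)
  assume "\<not> thesis"
  with that have *: "QuadRes (int p) (x\<^sup>2 + 1)" for x by blast
  have all: "QuadRes (int p) (int n)" for n
  proof (induction n)
    case (Suc n)
    then obtain y where "[y\<^sup>2 = int n] (mod int p)" unfolding QuadRes_def by blast
    then have "[y\<^sup>2 + 1 = int (Suc n)] (mod int p)"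
      using cong_add[of "y\<^sup>2" "int n" "int p" 1 1] by (simp add: add.commute)
    then show ?case using * QuadRes_cong by blast
  qed (simp add: QuadRes_0)
  let ?f = "\<lambda>y. y\<^sup>2 mod int p"
  have "{0..<int p} \<subseteq> ?f ` {0..<int p}"
  proof
    fix n assume n: "n \<in> {0..<int p}"
    then obtain y where "[y\<^sup>2 = n] (mod int p)" using all[of "nat n"] unfolding QuadRes_def by auto
    then have "n = ?f (y mod int p)" using n by (simp add: cong_def power_mod)
    then show "n \<in> ?f ` {0..<int p}" using assms by (intro image_eqI[of _ _ "y mod int p"]) auto
  qed
  then have "card {0..<int p} \<le> card (?f ` {0..<int p})"
    by (intro card_mono) simp_all
  then have "inj_on ?f {0..<int p}"
    by (intro eq_card_imp_inj_on antisym card_image_le) simp_all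
  moreover have "(int p - 1)\<^sup>2 mod int p = 1\<^sup>2 mod int p"
  proof -
    have "(int p - 1)\<^sup>2 = 1\<^sup>2 + int p * (int p - 2)" by (simp add: power2_eq_square algebra_simps)
    then show ?thesis by (metis mod_mult_self2)
  qed
  ultimately have "int p - 1 = 1" using assms by (auto dest!: inj_onD[where x = "int p - 1" and y = 1])
  then show False using assms by simp
qed

text \<open>By Euler's criterion the power with exponent (p - 1) / 2 is -1 for each non-residue; if
  the product were one as well, 1 and -1 would agree modulo p.\<close>

lemma QuadRes_mult_of_not_QuadRes:
  assumes p: "Factorial_Ring.prime p" "2 < p" and a: "\<not> QuadRes (int p) a" and b: "\<not> QuadRes (int p) b"
  shows "QuadRes (int p) (a * b)"
proof (rule ccontr)
  assume ab: "\<not> QuadRes (int p) (a * b)"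
  have *: "[c ^ ((p - 1) div 2) = - 1] (mod int p)" if "\<not> QuadRes (int p) c" for c
  proof -
    have "\<not> [c = 0] (mod int p)" using that QuadRes_0 QuadRes_cong by blast
    then show ?thesis
      using euler_criterion[OF p, of c] that by (simp add: Legendre_def cong_sym)
  qed
  have "[(- 1) * (- 1) = (a * b) ^ ((p - 1) div 2)] (mod int p)"
    unfolding power_mult_distrib by (rule cong_mult[OF *[OF a, THEN cong_sym] *[OF b, THEN cong_sym]])
  from cong_trans[OF this *[OF ab]] have "[1 = - 1] (mod int p)" by simp
  then have "int p dvd 2" by (simp add: cong_iff_dvd_diff)
  then show False using p(2) by (auto dest: zdvd_imp_le)
qed

section \<open>The field of p-adic numbers\<close>

instance fract :: ("{idom, ring_char_0}") field_char_0
proof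
  show "inj (of_nat :: nat \<Rightarrow> 'a fract)"
    by (rule injI) (simp add: of_nat_fract eq_fract)
qed

definition of_padic_int :: "'p :: prime_card padic_int \<Rightarrow> 'p padic" where
  "of_padic_int x = Fract x 1"

lemma of_padic_int_hom [simp]:
  "of_padic_int (x + y) = of_padic_int x + of_padic_int y"
  "of_padic_int (x - y) = of_padic_int x - of_padic_int y"
  "of_padic_int (x * y) = of_padic_int x * of_padic_int y"
  "of_padic_int 0 = 0" "of_padic_int 1 = 1"
  by (simp_all add: of_padic_int_def fract_collapse)

lemma of_padic_int_power [simp]: "of_padic_int (x ^ n) = of_padic_int x ^ n"
  by (induction n) simp_all

lemma of_padic_int_uminus [simp]: "of_padic_int (- x) = - of_padic_int x"
  using of_padic_int_hom(2)[of 0 x] by simp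

lemma of_padic_int_of_nat [simp]: "of_padic_int (of_nat n) = of_nat n"
  by (simp add: of_padic_int_def Fract_of_nat_eq)

lemma of_padic_int_of_int [simp]: "of_padic_int (of_int n) = of_int n"
  by (cases n) (simp_all del: of_nat_Suc)

lemma of_padic_int_eq_iff [simp]: "of_padic_int x = of_padic_int y \<longleftrightarrow> x = y"
  by (simp add: of_padic_int_def eq_fract)

lemma of_padic_int_eq_0_iff [simp]: "of_padic_int x = 0 \<longleftrightarrow> x = 0"
  using of_padic_int_eq_iff[of x 0] by simp

lemma padic_common_denominator:
  fixes x y :: "'p :: prime_card padic"
  obtains a b d where "d \<noteq> 0" "x = of_padic_int a / of_padic_int d" "y = of_padic_int b / of_padic_int d"
proof -
  obtain a c where a: "x = Fract a c" "c \<noteq> 0" by (cases x) auto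
  obtain b d where b: "y = Fract b d" "d \<noteq> 0" by (cases y) auto
  show ?thesis
    by (rule that[of "c * d" "a * d" "b * c"]) (use a b in \<open>simp_all add: of_padic_int_def eq_fract\<close>)
qed

text \<open>Since x / y = x y / y^2, the class of a fraction is that of the integer x y. The even
  part of its power of p goes into the square.\<close>

lemma padic_square_class_decompose:
  fixes a :: "'p :: prime_card padic"
  assumes "a \<noteq> 0"
  obtains e w s where "e < 2" "s \<noteq> 0" "padic_residue w 1 \<noteq> 0"
    "a = of_nat CARD('p) ^ e * of_padic_int w * s\<^sup>2"
proof -
  let ?P = "of_nat CARD('p) :: 'p padic"
  obtain x y where xy: "a = Fract x y" "y \<noteq> 0" by (cases a) auto
  with assms have "x \<noteq> 0" by (auto simp: fract_collapse)
  with xy obtain n w where nw: "x * y = of_nat CARD('p) ^ n * w" "padic_residue w 1 \<noteq> 0"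
    using padic_int_decompose[of "x * y"] by auto
  have "a = of_padic_int (x * y) / (of_padic_int y)\<^sup>2"
    using xy by (simp add: of_padic_int_def power2_eq_square eq_fract)
  also have "of_padic_int (x * y) = ?P ^ (n mod 2 + 2 * (n div 2)) * of_padic_int w"
    unfolding nw(1) by simp
  also have "\<dots> = ?P ^ (n mod 2) * of_padic_int w * (?P ^ (n div 2))\<^sup>2"
    by (simp only: power_add mult_ac power_mult[symmetric])
  finally have a: "a = ?P ^ (n mod 2) * of_padic_int w * (?P ^ (n div 2) / of_padic_int y)\<^sup>2"
    by (simp add: power_divide)
  have "?P ^ (n div 2) / of_padic_int y \<noteq> 0"
    using xy(2) by simp
  from that[OF _ this nw(2) a] show ?thesis by simp
qed

section \<open>Square classes and Hilbert symbol of the p-adic numbers\<close>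

text \<open>A character of exponent 2 is encoded as the predicate ``takes the value 1''.\<close>

definition sign_character :: "('a :: field \<Rightarrow> bool) \<Rightarrow> bool" where
  "sign_character \<chi> \<longleftrightarrow> (\<forall>a b. a \<noteq> 0 \<longrightarrow> b \<noteq> 0 \<longrightarrow> \<chi> (a * b) \<longleftrightarrow> (\<chi> a \<longleftrightarrow> \<chi> b))"

lemma sign_character_mult:
  "sign_character \<chi> \<Longrightarrow> a \<noteq> 0 \<Longrightarrow> b \<noteq> 0 \<Longrightarrow> \<chi> (a * b) \<longleftrightarrow> (\<chi> a \<longleftrightarrow> \<chi> b)"
  unfolding sign_character_def by blast

lemma sign_character_square: "sign_character \<chi> \<Longrightarrow> s \<noteq> 0 \<Longrightarrow> \<chi> (s\<^sup>2)"
  by (simp add: power2_eq_square sign_character_mult)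

lemma sign_character_1: "sign_character \<chi> \<Longrightarrow> \<chi> 1"
  using sign_character_square[of \<chi> 1] by simp

text \<open>The norms form a subgroup of index at most 2: \<open>d\<close> represents the other coset, if there is one.\<close>

definition hilbert_index :: "'a :: field \<Rightarrow> bool" where
  "hilbert_index c \<longleftrightarrow> (\<exists>d. d \<noteq> 0 \<and> (\<forall>a. a \<noteq> 0 \<longrightarrow> norm_rep a c \<or> norm_rep (a * d) c))"

text \<open>The only case left open by multiplicativity of norms is that of two non-norms a and b.
  Then a d and b d are norms, and their product is a b up to the square d^2.\<close>

lemma sign_character_norm_rep:
  assumes "hilbert_index c"
  shows "sign_character (\<lambda>a. norm_rep a c)"
  unfolding sign_character_def
proof (intro allI impI)
  fix a b :: 'a assume ab: "a \<noteq> 0" "b \<noteq> 0"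
  obtain d where d: "d \<noteq> 0" "\<And>a. a \<noteq> 0 \<Longrightarrow> norm_rep a c \<or> norm_rep (a * d) c"
    using assms unfolding hilbert_index_def by blast
  have "norm_rep (a * b) c" if "\<not> norm_rep a c" "\<not> norm_rep b c"
  proof -
    have "norm_rep ((a * d) * (b * d)) c" using that ab d norm_rep_mult by blast
    then have "norm_rep (a * b * d\<^sup>2) c" by (simp add: power2_eq_square mult_ac)
    then show ?thesis using d(1) norm_rep_mult_square_left by blast
  qed
  then show "norm_rep (a * b) c \<longleftrightarrow> (norm_rep a c \<longleftrightarrow> norm_rep b c)"
    using norm_rep_mult_cancel[of a c b] norm_rep_mult_cancel[of b c a] ab by (auto simp: mult.commute)
qed

text \<open>A covering condition: several elements of \<open>T\<close> may lie in one class.\<close>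

definition square_class_reps :: "'a :: field set \<Rightarrow> bool" where
  "square_class_reps T \<longleftrightarrow> 0 \<notin> T \<and> (\<forall>a. a \<noteq> 0 \<longrightarrow> (\<exists>t\<in>T. \<exists>s. s \<noteq> 0 \<and> a = t * s\<^sup>2))"

lemma square_class_repsE:
  fixes a :: "'a :: field"
  assumes "square_class_reps T" "a \<noteq> 0"
  obtains t s where "t \<in> T" "s \<noteq> 0" "a = t * s\<^sup>2" "t \<noteq> 0"
  using assms unfolding square_class_reps_def by metis

text \<open>\<open>norm_rep\<close> sees both arguments only modulo squares, which reduces the claim
  to a finite table; the second coset may be represented by a different \<open>d c\<close> for each
  \<open>c\<close>.\<close>

lemma hilbert_index_of_reps:
  fixes c :: "'a :: field_char_0" and d :: "'a \<Rightarrow> 'a"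
  assumes T: "square_class_reps T"
    and "\<And>c. c \<in> T \<Longrightarrow> d c \<noteq> 0"
    and "\<And>c a. c \<in> T \<Longrightarrow> a \<in> T \<Longrightarrow> norm_rep a c \<or> norm_rep (a * d c) c"
    and "c \<noteq> 0"
  shows "hilbert_index c"
proof -
  obtain t s where ts: "t \<in> T" "s \<noteq> 0" "c = t * s\<^sup>2" using square_class_repsE[OF T \<open>c \<noteq> 0\<close>] by blast
  have "norm_rep a c \<or> norm_rep (a * d t) c" if "a \<noteq> 0" for a
  proof -
    obtain r w where "r \<in> T" "w \<noteq> 0" "a = r * w\<^sup>2" using square_class_repsE[OF T \<open>a \<noteq> 0\<close>] by blast
    then show ?thesis
      using assms(3)[of t r] ts norm_rep_mult_square_left[of w r t]
        norm_rep_mult_square_left[of w "r * d t" t]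
      by (simp add: norm_rep_mult_square_right mult_ac)
  qed
  then show ?thesis using assms(2) ts(1) unfolding hilbert_index_def by blast
qed

text \<open>Clearing denominators in a solution over the field gives an integral solution of the
  homogeneous equation in which \<open>z\<close> is the common denominator, hence not 0.\<close>

lemma not_norm_rep_padic:
  fixes a c :: int
  assumes "\<And>x y z :: 'p :: prime_card padic_int. x\<^sup>2 - of_int c * y\<^sup>2 = of_int a * z\<^sup>2 \<Longrightarrow> z = 0"
  shows "\<not> norm_rep (of_int a :: 'p padic) (of_int c)"
proof
  assume "norm_rep (of_int a :: 'p padic) (of_int c)"
  then obtain x y :: "'p padic" where xy: "of_int a = x\<^sup>2 - of_int c * y\<^sup>2"
    unfolding norm_rep_def by blast
  obtain u v w where uvw: "w \<noteq> 0" "x = of_padic_int u / of_padic_int w" "y = of_padic_int v / of_padic_int w"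
    using padic_common_denominator by blast
  have "of_padic_int (of_int a * w\<^sup>2) = of_padic_int (u\<^sup>2 - of_int c * v\<^sup>2)"
    using xy uvw by (simp add: field_simps power_divide)
  then show False using assms uvw(1) by (metis of_padic_int_eq_iff)
qed

subsection \<open>Odd residue characteristic\<close>

text \<open>The special form of the non-residue \<open>u\<close> makes it a norm for \<open>- 1\<close> by inspection.\<close>

context
  fixes p :: nat and u x\<^sub>0 :: int and t :: "'p :: prime_card itself"
  assumes p_def: "p = CARD('p)" and p_gt_2: "2 < p"
    and u_def: "u = x\<^sub>0\<^sup>2 + 1" and u: "\<not> QuadRes (int p) u"
begin

lemma odd_p_prime: "Factorial_Ring.prime p" "Factorial_Ring.prime (int p)"
  using prime_card[where 'a = 'p] by (simp_all add: p_def)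

lemma odd_not_dvd_u: "\<not> int p dvd u"
  using u QuadRes_0 QuadRes_cong by (metis cong_0_iff)

text \<open>If w is a non-residue, then u w is a residue, so u w = t^2 for some t and w = u (t /
  u)^2.\<close>

lemma odd_unit_square_class:
  fixes w :: "'p padic_int"
  assumes w: "padic_residue w 1 \<noteq> 0"
  shows "\<exists>g\<in>{1, of_int u}. \<exists>s. s \<noteq> 0 \<and> of_padic_int w = g * s\<^sup>2"
proof (cases "QuadRes (int p) (padic_residue w 1)")
  case True
  then obtain t where "w = t\<^sup>2"
    using padic_int_square_of_quadratic_residue[of w] w p_gt_2 p_def by auto
  then show ?thesis using w by (intro bexI[of _ 1] exI[of _ "of_padic_int t"]) auto
next
  case False
  have res: "padic_residue (of_int u * w) 1 = u * padic_residue w 1 mod int p"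
    by (simp add: padic_residue_mult padic_residue_of_int mod_simps p_def)
  have "\<not> int p dvd padic_residue w 1"
    using False QuadRes_0 QuadRes_cong by (metis cong_0_iff)
  then have "padic_residue (of_int u * w) 1 \<noteq> 0"
    unfolding res using odd_p_prime(2) odd_not_dvd_u prime_dvd_multD by blast
  moreover have "QuadRes (int p) (padic_residue (of_int u * w) 1)"
    unfolding res using QuadRes_mult_of_not_QuadRes[OF odd_p_prime(1) p_gt_2 u False]
    by (subst QuadRes_cong[of _ "u * padic_residue w 1"]) (auto simp: cong_def)
  ultimately obtain t where t: "of_int u * w = t\<^sup>2"
    using padic_int_square_of_quadratic_residue[of "of_int u * w"] p_gt_2 p_def by auto
  have u0: "u \<noteq> 0" using odd_not_dvd_u by auto
  then have "t \<noteq> 0" using t w by auto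
  have "of_padic_int w = of_int u * (of_padic_int t / of_int u)\<^sup>2"
    using u0 arg_cong[OF t, of of_padic_int] by (simp add: field_simps power2_eq_square)
  then show ?thesis using u0 \<open>t \<noteq> 0\<close>
    by (intro bexI[of _ "of_int u"] exI[of _ "of_padic_int t / of_int u"]) auto
qed

lemma odd_square_class_reps:
  "square_class_reps {1, of_int u, of_nat p, of_nat p * of_int u :: 'p padic}"
  unfolding square_class_reps_def
proof (intro conjI allI impI)
  show "0 \<notin> {1, of_int u, of_nat p, of_nat p * of_int u :: 'p padic}"
    using odd_not_dvd_u p_gt_2 by auto
next
  fix a :: "'p padic" assume "a \<noteq> 0"
  then obtain e w s where ews: "e < 2" "s \<noteq> 0" "padic_residue w 1 \<noteq> 0"
    "a = of_nat p ^ e * of_padic_int w * s\<^sup>2"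
    using padic_square_class_decompose p_def by metis
  obtain g r where g: "g \<in> {1, of_int u}" "r \<noteq> 0" "of_padic_int w = g * r\<^sup>2"
    using odd_unit_square_class[OF ews(3)] by blast
  have "a = (of_nat p ^ e * g) * (r * s)\<^sup>2"
    using ews(4) g(3) by (simp add: power_mult_distrib)
  moreover have "of_nat p ^ e * g \<in> {1, of_int u, of_nat p, of_nat p * of_int u}"
    using ews(1) g(1) by (cases e) auto
  ultimately show "\<exists>t\<in>{1, of_int u, of_nat p, of_nat p * of_int u}. \<exists>s. s \<noteq> 0 \<and> a = t * s\<^sup>2"
    using g(2) ews(2) by (metis no_zero_divisors)
qed

text \<open>Modulo p the equation reads x^2 = u y^2, which forces p to divide y because u is a
  non-residue. Then p divides x and, after one cancellation, z; dividing by p^2 gives the same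
  equation again.\<close>

lemma odd_not_norm_rep_p_u: "\<not> norm_rep (of_nat p :: 'p padic) (of_int u)"
proof -
  have "z = 0" if "x\<^sup>2 - of_int u * y\<^sup>2 = of_int (int p) * z\<^sup>2" for x y z :: "'p padic_int"
  proof (rule padic_int_descent[of "\<lambda>x y z. x\<^sup>2 - of_int u * y\<^sup>2 = of_int (int p) * z\<^sup>2"])
    fix x y z :: "'p padic_int"
    assume eq: "x\<^sup>2 - of_int u * y\<^sup>2 = of_int (int p) * z\<^sup>2"
    let ?X = "padic_residue x 1" and ?Y = "padic_residue y 1"
    have dvd: "int p dvd ?X\<^sup>2 - u * ?Y\<^sup>2"
    proof -
      have "(?X\<^sup>2 - u * ?Y\<^sup>2) mod int p = padic_residue (x\<^sup>2 - of_int u * y\<^sup>2) 1"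
        by (simp add: padic_residue_diff padic_residue_mult padic_residue_of_int power2_eq_square
            mod_simps p_def)
      also have "\<dots> = 0"
        unfolding eq by (simp add: padic_residue_mult padic_residue_of_nat p_def)
      finally show ?thesis by presburger
    qed
    have Y: "int p dvd ?Y"
    proof (rule ccontr)
      assume "\<not> int p dvd ?Y"
      then have "coprime ?Y (int p)"
        using odd_p_prime(2) prime_imp_coprime coprime_commute by blast
      then obtain i where i: "[?Y * i = 1] (mod int p)" using cong_solve_coprime_int by blast
      have "[?X\<^sup>2 = u * ?Y\<^sup>2] (mod int p)" using dvd by (simp add: cong_iff_dvd_diff)
      then have "[?X\<^sup>2 * i\<^sup>2 = u * ?Y\<^sup>2 * i\<^sup>2] (mod int p)" by (rule cong_mult) simp
      moreover have "[u * (?Y * i)\<^sup>2 = u * 1\<^sup>2] (mod int p)"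
        using i by (intro cong_mult cong_pow) auto
      ultimately have "[(?X * i)\<^sup>2 = u] (mod int p)"
        by (metis (no_types, lifting) cong_trans mult.assoc mult.right_neutral one_power2 power_mult_distrib)
      then show False using u unfolding QuadRes_def by blast
    qed
    then have "int p dvd u * ?Y\<^sup>2" by (simp add: power2_eq_square)
    then have "int p dvd ?X\<^sup>2" using dvd by (metis diff_add_cancel dvd_add)
    then have X: "int p dvd ?X" using odd_p_prime(2) prime_dvd_power by blast
    have "?X = 0" "?Y = 0"
      using X Y padic_residue_mod_self[of x 1] padic_residue_mod_self[of y 1] by (simp_all add: p_def)
    then obtain a b where ab: "x = of_nat p * a" "y = of_nat p * b"
      using padic_dvd_of_residue_eq_0 p_def by metis
    have "of_nat p * (of_nat p * (a\<^sup>2 - of_int u * b\<^sup>2)) = of_nat p * z\<^sup>2"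
      using eq unfolding ab by (simp add: power2_eq_square algebra_simps)
    then have z: "of_nat p * (a\<^sup>2 - of_int u * b\<^sup>2) = z\<^sup>2"
      using p_gt_2 by simp
    then have "padic_residue (z\<^sup>2) 1 = 0"
      by (metis (no_types, lifting) mod_mult_self1_is_0 mod_mult_left_eq mod_self mult_zero_left
          mod_0 of_nat_1 p_def padic_residue_mult padic_residue_of_nat power_one_right)
    then have "int p dvd (padic_residue z 1)\<^sup>2"
      by (simp add: padic_residue_mult power2_eq_square p_def dvd_eq_mod_eq_0)
    then have "int p dvd padic_residue z 1" using odd_p_prime(2) prime_dvd_power by blast
    then have "padic_residue z 1 = 0" using padic_residue_mod_self[of z 1] by (simp add: p_def)
    then obtain c where c: "z = of_nat p * c"
      using padic_dvd_of_residue_eq_0 p_def by metis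
    have "of_nat p * (a\<^sup>2 - of_int u * b\<^sup>2) = of_nat p * (of_nat p * c\<^sup>2)"
      using z unfolding c by (simp add: power2_eq_square algebra_simps)
    then have "a\<^sup>2 - of_int u * b\<^sup>2 = of_int (int p) * c\<^sup>2" using p_gt_2 by simp
    then show "\<exists>a b c. z = of_nat CARD('p) * c \<and> a\<^sup>2 - of_int u * b\<^sup>2 = of_int (int p) * c\<^sup>2"
      using c p_def by blast
  qed (rule that)
  then have "\<not> norm_rep (of_int (int p) :: 'p padic) (of_int u)" by (rule not_norm_rep_padic)
  then show ?thesis by simp
qed


text \<open>As a sum of two squares, u is a norm for -1; by symmetry -1 is a norm for u. Since -u
  always is one, so is u = (-1)(-u).\<close>

lemma odd_norm_rep_u_u: "norm_rep (of_int u :: 'p padic) (of_int u)" "norm_rep (- 1 :: 'p padic) (of_int u)"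
proof -
  have u0: "(of_int u :: 'p padic) \<noteq> 0" using odd_not_dvd_u by auto
  have "norm_rep (of_int u :: 'p padic) (- 1)"
    by (rule norm_repI[of _ "of_int x\<^sub>0" _ 1]) (simp add: u_def)
  then show "norm_rep (- 1 :: 'p padic) (of_int u)" using norm_rep_commute[of "of_int u :: 'p padic" "- 1"] u0 by simp
  then show "norm_rep (of_int u :: 'p padic) (of_int u)"
    using norm_rep_mult[OF _ norm_rep_uminus_self, of "- 1"] by simp
qed

text \<open>For c = u the units 1 and u are norms, so p is taken for the other coset. For c = p or c
  = p u the norms contain 1 and one of c, c u, so u is taken.\<close>

lemma odd_hilbert_index:
  assumes "c \<noteq> (0 :: 'p padic)"
  shows "hilbert_index c"
proof (rule hilbert_index_of_reps[OF odd_square_class_reps, where c = c and d =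
      "\<lambda>c. if c = of_int u then of_nat p else of_int u"])
  have nz: "(of_int u :: 'p padic) \<noteq> 0" "(of_nat p :: 'p padic) \<noteq> 0"
    using odd_not_dvd_u p_gt_2 by auto
  then show "(if c = of_int u then of_nat p else of_int u) \<noteq> (0 :: 'p padic)" for c :: "'p padic"
    by simp
  fix c a :: "'p padic"
  assume ca: "c \<in> {1, of_int u, of_nat p, of_nat p * of_int u}"
    "a \<in> {1, of_int u, of_nat p, of_nat p * of_int u}"
  define d :: "'p padic" where "d = (if c = of_int u then of_nat p else of_int u)"
  have one: "norm_rep 1 c" using norm_rep_square_left[of 1] by simp
  have sq: "norm_rep (of_int u * of_int u) c" "norm_rep (of_nat p * of_nat p) c"
    using norm_rep_square_left by (simp_all flip: power2_eq_square)
  \<comment> \<open>Whether -1 is a square depends on p modulo 4; in either case its class is that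
    of 1 or of u.\<close>
  have "padic_residue (- 1 :: 'p padic_int) 1 \<noteq> 0"
    using p_gt_2
    by (simp add: uminus_padic_int.rep_eq one_padic_int.rep_eq p_def zmod_zminus1_eq_if)
  from odd_unit_square_class[OF this]
  obtain g s where g: "g \<in> {1, of_int u}" "s \<noteq> 0" "(- 1 :: 'p padic) = g * s\<^sup>2"
    unfolding of_padic_int_uminus of_padic_int_hom by blast
  consider "c = 1" | "c = of_int u" | "c \<noteq> of_int u" "c \<in> {of_nat p, of_nat p * of_int u}"
    using ca(1) by blast
  then have "norm_rep a c \<or> norm_rep (a * d) c"
  proof cases
    case 1
    then show ?thesis using norm_rep_square_right[of "1 :: 'p padic"] by simp
  next
    case 2
    have "norm_rep (of_nat p * of_int u * of_nat p) c"
      using norm_rep_mult[OF odd_norm_rep_u_u(1) sq(2)[unfolded 2]] by (simp add: 2 mult_ac)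
    then show ?thesis using 2 ca(2) one sq(2) odd_norm_rep_u_u(1) by (auto simp: d_def)
  next
    case 3
    then have d: "d = of_int u" by (simp add: d_def)
    \<comment> \<open>The trivial norm -c, with -1 replaced by its representative
      \<open>g\<close>.\<close>
    have "norm_rep (c * g * s\<^sup>2) c" using norm_rep_uminus_self[of c] g(3)
      by (metis mult.assoc mult_minus1_right)
    then have "norm_rep (c * g) c" using norm_rep_mult_square_left[OF g(2)] by blast
    then have *: "norm_rep c c \<or> norm_rep (c * of_int u) c" using g(1) by auto
    have usq: "norm_rep (y * of_int u * of_int u) c \<longleftrightarrow> norm_rep y c" for y
      using norm_rep_mult_square_left[OF nz(1), of y c] by (simp add: power2_eq_square mult_ac)
    show ?thesis using ca(2) 3(2) * one sq usq unfolding d by auto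
  qed
  then show "norm_rep a c \<or> norm_rep (a * (if c = of_int u then of_nat p else of_int u)) c"
    by (simp add: d_def)
qed (use assms in \<open>simp_all add: hilbert_index_def\<close>)

end

text \<open>The interface between the arithmetic of p-adic numbers and the Galois theory. In this
  order the conjuncts serve to make the tower of square roots finite, the reciprocity map a
  homomorphism, and this map injective and surjective.\<close>

definition perfect_norm_pairing :: "'a :: field itself \<Rightarrow> bool" where
  "perfect_norm_pairing _ \<longleftrightarrow>
     (\<exists>T :: 'a set. finite T \<and> square_class_reps T) \<and>
     (\<forall>c :: 'a. c \<noteq> 0 \<longrightarrow> hilbert_index c) \<and>
     (\<forall>a :: 'a. a \<noteq> 0 \<longrightarrow> (\<forall>c. c \<noteq> 0 \<longrightarrow> norm_rep a c) \<longrightarrow> (\<exists>s. a = s\<^sup>2)) \<and>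
     (\<forall>\<chi> :: 'a \<Rightarrow> bool. sign_character \<chi> \<longrightarrow>
        (\<exists>a. a \<noteq> 0 \<and> (\<forall>c. c \<noteq> 0 \<longrightarrow> (norm_rep a c \<longleftrightarrow> \<chi> c))))"

lemma sign_character_eqI:
  assumes "sign_character \<chi>" "sign_character \<psi>" "square_class_reps T"
    "\<And>t. t \<in> T \<Longrightarrow> \<chi> t \<longleftrightarrow> \<psi> t" "c \<noteq> 0"
  shows "\<chi> c \<longleftrightarrow> \<psi> c"
proof -
  obtain t s where "t \<in> T" "s \<noteq> 0" "c = t * s\<^sup>2" "t \<noteq> 0"
    using square_class_repsE[OF assms(3,5)] by blast
  then show ?thesis
    using assms(1,2,4) by (simp add: sign_character_mult sign_character_square)
qed

lemma sign_character_norm_rep_right: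
  fixes a :: "'a :: field_char_0"
  assumes "hilbert_index a" "a \<noteq> 0"
  shows "sign_character (norm_rep a)"
  using sign_character_norm_rep[OF assms(1)] norm_rep_commute[OF assms(2)]
  unfolding sign_character_def by (metis no_zero_divisors)

text \<open>A character is determined by its values on representatives, so an element that induces
  \<chi> on \<open>T\<close> induces it everywhere.\<close>

lemma perfect_norm_pairingI:
  fixes T :: "'a :: field_char_0 set"
  assumes T: "finite T" "square_class_reps T"
    and index: "\<And>c :: 'a. c \<noteq> 0 \<Longrightarrow> hilbert_index c"
    and nondegenerate: "\<And>t. t \<in> T \<Longrightarrow> t = 1 \<or> (\<exists>c. c \<noteq> 0 \<and> \<not> norm_rep t c)"
    and characters: "\<And>\<chi>. sign_character \<chi> \<Longrightarrow> \<exists>a. a \<noteq> 0 \<and> (\<forall>t\<in>T. norm_rep a t \<longleftrightarrow> \<chi> t)"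
  shows "perfect_norm_pairing TYPE('a)"
  unfolding perfect_norm_pairing_def
proof (intro conjI allI impI)
  fix a :: 'a assume a: "a \<noteq> 0" "\<forall>c. c \<noteq> 0 \<longrightarrow> norm_rep a c"
  obtain t s where ts: "t \<in> T" "s \<noteq> 0" "a = t * s\<^sup>2" using square_class_repsE[OF T(2) a(1)] by blast
  have "norm_rep t c" if "c \<noteq> 0" for c
    using a(2) ts norm_rep_mult_square_left that by blast
  then show "\<exists>s. a = s\<^sup>2" using nondegenerate[OF ts(1)] ts(3) by auto
next
  fix \<chi> :: "'a \<Rightarrow> bool" assume chi: "sign_character \<chi>"
  then obtain a where a: "a \<noteq> 0" "\<forall>t\<in>T. norm_rep a t \<longleftrightarrow> \<chi> t" using characters by blast
  have "norm_rep a c \<longleftrightarrow> \<chi> c" if "c \<noteq> 0" for c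
    by (rule sign_character_eqI[OF sign_character_norm_rep_right[OF index a(1)] chi T(2) _ that])
      (use a in auto)
  with a(1) show "\<exists>a. a \<noteq> 0 \<and> (\<forall>c. c \<noteq> 0 \<longrightarrow> (norm_rep a c \<longleftrightarrow> \<chi> c))" by blast
qed (use T index in auto)

lemma perfect_norm_pairing_padic_odd:
  assumes "2 < CARD('p :: prime_card)"
  shows "perfect_norm_pairing TYPE('p padic)"
proof -
  define p where "p = CARD('p)"
  have p2: "2 < p" using assms p_def by simp
  then obtain x where x: "\<not> QuadRes (int p) (x\<^sup>2 + 1)" using exists_not_QuadRes_Suc_square by blast
  define u where "u = x\<^sup>2 + 1"
  note o = p_def p2 u_def x[folded u_def]
  let ?u = "of_int u :: 'p padic" and ?p = "of_nat p :: 'p padic"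
  note index = odd_hilbert_index[OF o]
  have nz: "?u \<noteq> 0" "?p \<noteq> 0" using odd_not_dvd_u[OF o] p2 by auto
  have chi: "sign_character (\<lambda>a. norm_rep a c)" if "c \<noteq> 0" for c :: "'p padic"
    using index[OF that] by (rule sign_character_norm_rep)
  have uu: "norm_rep ?u ?u" "norm_rep (- 1) ?u" using odd_norm_rep_u_u[OF o] by auto
  have pu: "\<not> norm_rep ?p ?u" using odd_not_norm_rep_p_u[OF o] by auto
  have up: "\<not> norm_rep ?u ?p" using pu norm_rep_commute nz by blast
  have ppu: "\<not> norm_rep (- ?p) ?u"
    using sign_character_mult[OF chi[OF nz(1)], of "- 1" ?p] uu pu nz by simp
  have pup: "\<not> norm_rep (- (?p * ?u)) ?p"
    using sign_character_mult[OF chi[OF nz(2)], of "- ?p" ?u] norm_rep_uminus_self[of ?p] up nz by simp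
  have puu: "\<not> norm_rep (- (?p * ?u)) ?u" "\<not> norm_rep (?p * ?u) ?u"
    using sign_character_mult[OF chi[OF nz(1)], of "- ?p" ?u]
      sign_character_mult[OF chi[OF nz(1)], of "?p" ?u] uu ppu pu nz by simp_all
  show ?thesis
  proof (rule perfect_norm_pairingI[OF _ odd_square_class_reps[OF o] index])
    fix t :: "'p padic" assume "t \<in> {1, ?u, ?p, ?p * ?u}"
    then show "t = 1 \<or> (\<exists>c. c \<noteq> 0 \<and> \<not> norm_rep t c)"
      using nz pu up puu by blast
  next
    fix \<chi> :: "'p padic \<Rightarrow> bool" assume X: "sign_character \<chi>"
    \<comment> \<open>Dual basis: -p has symbol 1 with p and -1 with u, while u has symbol 1 with u
      and -1 with p.\<close>
    define a where "a = (if \<chi> ?u then 1 else - ?p) * (if \<chi> ?p then 1 else ?u)"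
    have a: "a \<noteq> 0" using nz by (simp add: a_def)
    have "norm_rep a ?u \<longleftrightarrow> \<chi> ?u" "norm_rep a ?p \<longleftrightarrow> \<chi> ?p"
      using uu ppu puu pup up norm_rep_uminus_self[of ?p] norm_rep_square_left[of 1 ?u]
        norm_rep_square_left[of 1 ?p] unfolding a_def by auto
    then have "\<forall>t\<in>{1, ?u, ?p, ?p * ?u}. norm_rep a t \<longleftrightarrow> \<chi> t"
      using sign_character_norm_rep_right[OF index[OF a] a] X nz
      by (auto simp: sign_character_mult sign_character_1)
    with a show "\<exists>a. a \<noteq> 0 \<and> (\<forall>t\<in>{1, ?u, ?p, ?p * ?u}. norm_rep a t \<longleftrightarrow> \<chi> t)" by blast
  qed simp_all
qed

subsection \<open>The dyadic numbers\<close>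

lemma even_square_mod_8: "even (x :: int) \<Longrightarrow> x\<^sup>2 mod 8 \<in> {0, 4}"
proof -
  assume "even x"
  then obtain k where k: "x = 2 * k" by blast
  have "x\<^sup>2 mod (4 * 2) = 4 * (k\<^sup>2 mod 2)" unfolding k power_mult_distrib
    by (simp only: mult_mod_right) simp
  then show ?thesis by (cases "even k") (auto simp: mod_2_eq_odd)
qed

lemma odd_square_mod_8: "odd (x :: int) \<Longrightarrow> x\<^sup>2 mod 8 = 1"
proof -
  assume "odd x"
  then obtain k where k: "x = 2 * k + 1" by (elim oddE)
  have "even (k * (k + 1))" by simp
  then obtain l where l: "k * (k + 1) = 2 * l" by blast
  have "x\<^sup>2 = 1 + 4 * (k * (k + 1))" unfolding k by (simp add: power2_eq_square algebra_simps)
  also have "\<dots> = 1 + l * 8" unfolding l by simp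
  finally show ?thesis by (simp only: mod_mult_self1) simp
qed

text \<open>The parity of a number confines its square modulo 8 to {0, 4} or {1}; what remains is a
  finite check on the residues \<open>A\<close>, \<open>B\<close>, \<open>C\<close> of the three
  squares.\<close>

lemma even_of_square_minus_5_square:
  fixes x y z :: int
  assumes "(x\<^sup>2 - 5 * y\<^sup>2) mod 8 = 2 * z\<^sup>2 mod 8"
  shows "even x \<and> even y \<and> even z"
proof -
  have "[x\<^sup>2 mod 8 - 5 * (y\<^sup>2 mod 8) = x\<^sup>2 - 5 * y\<^sup>2] (mod 8)"
    "[2 * (z\<^sup>2 mod 8) = 2 * z\<^sup>2] (mod 8)"
    by (intro cong_diff cong_mult; simp)+
  with assms have *: "(x\<^sup>2 mod 8 - 5 * (y\<^sup>2 mod 8)) mod 8 = 2 * (z\<^sup>2 mod 8) mod 8"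
    unfolding cong_def by metis
  have mod8: "w\<^sup>2 mod 8 \<in> (if even w then {0, 4} else {1})" for w :: int
    using even_square_mod_8 odd_square_mod_8 by auto
  have "even x \<and> even y \<and> even z"
    if "A \<in> (if even x then {0, 4} else {1})" "B \<in> (if even y then {0, 4} else {1})"
      "C \<in> (if even z then {0, 4} else {1})" "(A - 5 * B) mod 8 = 2 * C mod 8" for A B C :: int
    using that by (auto split: if_splits)
  from this[OF mod8 mod8 mod8 *] show ?thesis .
qed

lemma even_of_sum_three_squares:
  fixes x y z :: int
  assumes "(x\<^sup>2 + y\<^sup>2 + z\<^sup>2) mod 8 = 0"
  shows "even x \<and> even y \<and> even z"
proof -
  have "[x\<^sup>2 mod 8 + y\<^sup>2 mod 8 + z\<^sup>2 mod 8 = x\<^sup>2 + y\<^sup>2 + z\<^sup>2] (mod 8)"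
    by (intro cong_add) simp_all
  with assms have *: "(x\<^sup>2 mod 8 + y\<^sup>2 mod 8 + z\<^sup>2 mod 8) mod 8 = 0"
    unfolding cong_def by metis
  have mod8: "w\<^sup>2 mod 8 \<in> (if even w then {0, 4} else {1})" for w :: int
    using even_square_mod_8 odd_square_mod_8 by auto
  have "even x \<and> even y \<and> even z"
    if "A \<in> (if even x then {0, 4} else {1})" "B \<in> (if even y then {0, 4} else {1})"
      "C \<in> (if even z then {0, 4} else {1})" "(A + B + C) mod 8 = 0" for A B C :: int
    using that by (auto split: if_splits)
  from this[OF mod8 mod8 mod8 *] show ?thesis .
qed

context
  fixes t :: "'p :: prime_card itself"
  assumes card: "CARD('p) = 2"
begin

lemma dyadic_square_of_mod_8:
  fixes w :: "'p padic_int"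
  assumes "padic_residue (of_int g * w) 3 = 1" "g \<noteq> 0"
  shows "\<exists>s. s \<noteq> 0 \<and> of_padic_int w = of_int g * s\<^sup>2"
proof -
  obtain t where t: "of_int g * w = t\<^sup>2" using padic_int_square_of_mod_8[OF card assms(1)] .
  have "w \<noteq> 0" using assms(1) by auto
  with t assms(2) have "t \<noteq> 0" by auto
  have "of_padic_int w = of_int g * (of_padic_int t / of_int g)\<^sup>2"
    using assms(2) arg_cong[OF t, of of_padic_int] by (simp add: field_simps power2_eq_square)
  then show ?thesis using assms(2) \<open>t \<noteq> 0\<close>
    by (intro exI[of _ "of_padic_int t / of_int g"]) auto
qed

lemma dyadic_unit_square_class:
  fixes w :: "'p padic_int"
  assumes "padic_residue w 1 \<noteq> 0"
  shows "\<exists>g\<in>{1, - 1, 5, - 5}. \<exists>s. s \<noteq> 0 \<and> of_padic_int w = g * s\<^sup>2"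
proof -
  define r where "r = padic_residue w 3"
  have r: "0 \<le> r" "r < 8" using padic_residue_range[of w 3] card by (simp_all add: r_def)
  have "r mod 2 \<noteq> 0" using assms padic_residue_mod[of 1 3 w] card by (simp add: r_def)
  with r have "r \<in> {1, 3, 5, 7}" by auto presburger
  moreover have "padic_residue (of_int g * w) 3 = g * r mod 8" for g
    using card by (simp add: padic_residue_mult padic_residue_of_int mod_simps r_def)
  \<comment> \<open>Each odd residue modulo 8 is its own inverse, and 3 and 7 are the residues of -5
    and -1.\<close>
  ultimately have "\<exists>g\<in>{1, - 1, 5, - 5 :: int}. padic_residue (of_int g * w) 3 = 1" by auto
  then obtain g :: int where "g \<in> {1, - 1, 5, - 5}" "padic_residue (of_int g * w) 3 = 1" by blast
  moreover from this(1) have "g \<noteq> 0" "(of_int g :: 'p padic) \<in> {1, - 1, 5, - 5}" by auto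
  ultimately show ?thesis using dyadic_square_of_mod_8 by blast
qed

lemma dyadic_square_class_reps:
  "square_class_reps {1, - 1, 5, - 5, 2, - 2, 10, - 10 :: 'p padic}"
  unfolding square_class_reps_def
proof (intro conjI allI impI)
  fix a :: "'p padic" assume "a \<noteq> 0"
  then obtain e w s where ews: "e < 2" "s \<noteq> 0" "padic_residue w 1 \<noteq> 0"
    "a = of_nat CARD('p) ^ e * of_padic_int w * s\<^sup>2"
    using padic_square_class_decompose by metis
  obtain g r where g: "g \<in> {1, - 1, 5, - 5}" "r \<noteq> 0" "of_padic_int w = g * r\<^sup>2"
    using dyadic_unit_square_class[OF ews(3)] by blast
  have "a = (2 ^ e * g) * (r * s)\<^sup>2"
    using ews(4) g(3) card by (simp add: power_mult_distrib)
  moreover have "2 ^ e * g \<in> {1, - 1, 5, - 5, 2, - 2, 10, - 10}"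
    using ews(1) g(1) by (cases e) auto
  ultimately show "\<exists>t\<in>{1, - 1, 5, - 5, 2, - 2, 10, - 10}. \<exists>s. s \<noteq> 0 \<and> a = t * s\<^sup>2"
    using g(2) ews(2) by (metis no_zero_divisors)
qed simp

lemma dyadic_residue_even:
  fixes w :: "'p padic_int"
  assumes "even (padic_residue w n)" "n > 0"
  obtains b where "w = of_nat CARD('p) * b"
proof -
  have "padic_residue w 1 = 0"
    using padic_residue_mod[of 1 n w] assms card by (simp add: even_iff_mod_2_eq_zero)
  then show ?thesis using padic_dvd_of_residue_eq_0 that by blast
qed

text \<open>Modulo 8 the equation forces x, y and z to be even, and halving all three reproduces
  it.\<close>

lemma dyadic_not_norm_rep_2_5: "\<not> norm_rep (2 :: 'p padic) 5"
proof -
  have "z = 0" if "x\<^sup>2 - of_int 5 * y\<^sup>2 = of_int 2 * z\<^sup>2" for x y z :: "'p padic_int"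
  proof (rule padic_int_descent[of "\<lambda>x y z. x\<^sup>2 - of_int 5 * y\<^sup>2 = of_int 2 * z\<^sup>2"])
    fix x y z :: "'p padic_int"
    assume eq: "x\<^sup>2 - of_int 5 * y\<^sup>2 = of_int 2 * z\<^sup>2"
    let ?X = "padic_residue x 3" and ?Y = "padic_residue y 3" and ?Z = "padic_residue z 3"
    have "(?X\<^sup>2 - 5 * ?Y\<^sup>2) mod 8 = 2 * ?Z\<^sup>2 mod 8"
      using arg_cong[OF eq, of "\<lambda>x. padic_residue x 3"] card
      by (simp only: padic_residue_diff padic_residue_mult padic_residue_of_int power2_eq_square)
        (simp add: mod_simps)
    from even_of_square_minus_5_square[OF this] have "even ?X" "even ?Y" "even ?Z"
      by simp_all
    then obtain a b c where abc: "x = of_nat CARD('p) * a" "y = of_nat CARD('p) * b"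
      "z = of_nat CARD('p) * c" using dyadic_residue_even[of _ 3] by (metis zero_less_numeral)
    have "4 * (a\<^sup>2 - of_int 5 * b\<^sup>2) = 4 * (of_int 2 * c\<^sup>2)"
      using eq card unfolding abc by (simp add: power2_eq_square algebra_simps)
    then have "a\<^sup>2 - of_int 5 * b\<^sup>2 = of_int 2 * c\<^sup>2"
      using mult_left_cancel[of "4 :: 'p padic_int"] zero_neq_numeral by metis
    then show "\<exists>a b c. z = of_nat CARD('p) * c \<and> a\<^sup>2 - of_int 5 * b\<^sup>2 = of_int 2 * c\<^sup>2"
      using abc by blast
  qed (rule that)
  then have "\<not> norm_rep (of_int 2 :: 'p padic) (of_int 5)" by (rule not_norm_rep_padic)
  then show ?thesis by simp
qed

text \<open>The equation becomes x^2 + y^2 + z^2 = 0. Modulo 8 its solutions are even, and halving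
  them gives solutions again.\<close>

lemma dyadic_not_norm_rep_m1_m1: "\<not> norm_rep (- 1 :: 'p padic) (- 1)"
proof -
  have "z = 0" if "x\<^sup>2 - of_int (- 1) * y\<^sup>2 = of_int (- 1) * z\<^sup>2" for x y z :: "'p padic_int"
  proof (rule padic_int_descent[of "\<lambda>x y z. x\<^sup>2 - of_int (- 1) * y\<^sup>2 = of_int (- 1) * z\<^sup>2"])
    fix x y z :: "'p padic_int"
    assume eq: "x\<^sup>2 - of_int (- 1) * y\<^sup>2 = of_int (- 1) * z\<^sup>2"
    let ?X = "padic_residue x 3" and ?Y = "padic_residue y 3" and ?Z = "padic_residue z 3"
    have sum0: "x\<^sup>2 + y\<^sup>2 + z\<^sup>2 = 0" using eq by simp
    from arg_cong[OF this, of "\<lambda>x. padic_residue x 3"]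
    have "(?X\<^sup>2 + ?Y\<^sup>2 + ?Z\<^sup>2) mod 8 = 0"
      using card by (simp only: padic_residue_add padic_residue_mult padic_residue_0 power2_eq_square)
        (simp add: mod_simps)
    from even_of_sum_three_squares[OF this] have "even ?X" "even ?Y" "even ?Z"
      by simp_all
    then obtain a b c where abc: "x = of_nat CARD('p) * a" "y = of_nat CARD('p) * b"
      "z = of_nat CARD('p) * c" using dyadic_residue_even[of _ 3] by (metis zero_less_numeral)
    have "4 * (a\<^sup>2 + b\<^sup>2 + c\<^sup>2) = (2 * a)\<^sup>2 + (2 * b)\<^sup>2 + (2 * c)\<^sup>2"
      by (simp add: power_mult_distrib)
    also have "\<dots> = 0" using sum0 unfolding abc card by (simp only: of_nat_numeral)
    finally have "a\<^sup>2 + b\<^sup>2 + c\<^sup>2 = 0" by (metis mult_eq_0_iff zero_neq_numeral)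
    then have "a\<^sup>2 + b\<^sup>2 = - c\<^sup>2" by (rule eq_neg_iff_add_eq_0[THEN iffD2])
    then have "a\<^sup>2 - of_int (- 1) * b\<^sup>2 = of_int (- 1) * c\<^sup>2"
      by (simp only: of_int_minus of_int_1 mult_minus1 diff_minus_eq_add)
    then show "\<exists>a b c. z = of_nat CARD('p) * c \<and> a\<^sup>2 - of_int (- 1) * b\<^sup>2 = of_int (- 1) * c\<^sup>2"
      using abc by blast
  qed (rule that)
  then have "\<not> norm_rep (of_int (- 1) :: 'p padic) (of_int (- 1))" by (rule not_norm_rep_padic)
  then show ?thesis by simp
qed

text \<open>One row for each representative c other than 1. Together with 1, the three norms in a
  row form a group modulo squares, made up of four of the eight representatives.\<close>

lemma dyadic_norm_rep_table:
  "norm_rep (2 :: 'p padic) (- 1)" "norm_rep (5 :: 'p padic) (- 1)" "norm_rep (10 :: 'p padic) (- 1)"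
  "norm_rep (- 1 :: 'p padic) 2" "norm_rep (2 :: 'p padic) 2" "norm_rep (- 2 :: 'p padic) 2"
  "norm_rep (2 :: 'p padic) (- 2)" "norm_rep (- 5 :: 'p padic) (- 2)" "norm_rep (- 10 :: 'p padic) (- 2)"
  "norm_rep (- 1 :: 'p padic) 5" "norm_rep (5 :: 'p padic) 5" "norm_rep (- 5 :: 'p padic) 5"
  "norm_rep (5 :: 'p padic) (- 5)" "norm_rep (- 2 :: 'p padic) (- 5)" "norm_rep (- 10 :: 'p padic) (- 5)"
  "norm_rep (- 1 :: 'p padic) 10" "norm_rep (10 :: 'p padic) 10" "norm_rep (- 10 :: 'p padic) 10"
  "norm_rep (10 :: 'p padic) (- 10)" "norm_rep (- 5 :: 'p padic) (- 10)" "norm_rep (- 2 :: 'p padic) (- 10)"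
proof -
  have "padic_residue (of_int (- 15) :: 'p padic_int) 3 = 1"
    using card by (simp only: padic_residue_of_int) simp
  then obtain t where "(of_int (- 15) :: 'p padic_int) = t\<^sup>2"
    using padic_int_square_of_mod_8[OF card] by blast
  from arg_cong[OF this, of of_padic_int]
  have t: "of_padic_int t ^ 2 = (- 15 :: 'p padic)"
    unfolding of_padic_int_of_int by simp
  \<comment> \<open>Since \<open>- 5 = 3 s\<^sup>2\<close> with \<open>3 = 1 + 2\<close>, and \<open>- 10 = 6 s\<^sup>2\<close> with \<open>6 = 1 + 5\<close>.\<close>
  define s where "s = of_padic_int t / 3"
  have s: "s\<^sup>2 = - 5 / 3" using t by (simp add: s_def power_divide)
  show 1: "norm_rep (2 :: 'p padic) (- 1)" by (rule norm_repI[of _ 1 _ 1]) simp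
  show 2: "norm_rep (5 :: 'p padic) (- 1)" by (rule norm_repI[of _ 2 _ 1]) simp
  show 3: "norm_rep (10 :: 'p padic) (- 1)" using norm_rep_mult[OF 1 2] by simp
  show 4: "norm_rep (- 1 :: 'p padic) 2" by (rule norm_repI[of _ 1 _ 1]) simp
  show 5: "norm_rep (2 :: 'p padic) 2" by (rule norm_repI[of _ 2 _ 1]) simp
  show "norm_rep (- 2 :: 'p padic) 2" by (rule norm_rep_uminus_self)
  show 7: "norm_rep (2 :: 'p padic) (- 2)" using norm_rep_uminus_self[of "- 2 :: 'p padic"] by simp
  show 8: "norm_rep (- 5 :: 'p padic) (- 2)" by (rule norm_repI[of _ s _ s]) (simp add: s)
  show 9: "norm_rep (- 10 :: 'p padic) (- 2)" using norm_rep_mult[OF 7 8] by simp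
  show 10: "norm_rep (- 1 :: 'p padic) 5" by (rule norm_repI[of _ 2 _ 1]) simp
  show 11: "norm_rep (- 5 :: 'p padic) 5" by (rule norm_rep_uminus_self)
  show "norm_rep (5 :: 'p padic) 5" using norm_rep_mult[OF 10 11] by simp
  show 13: "norm_rep (5 :: 'p padic) (- 5)" using norm_rep_uminus_self[of "- 5 :: 'p padic"] by simp
  show 14: "norm_rep (- 10 :: 'p padic) (- 5)" by (rule norm_repI[of _ s _ s]) (simp add: s)
  show "norm_rep (- 2 :: 'p padic) (- 5)" using norm_rep_commute[of "- 2" "- 5 :: 'p padic"] 8 by simp
  show 16: "norm_rep (- 1 :: 'p padic) 10" by (rule norm_repI[of _ 3 _ 1]) simp
  show 17: "norm_rep (- 10 :: 'p padic) 10" by (rule norm_rep_uminus_self)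
  show "norm_rep (10 :: 'p padic) 10" using norm_rep_mult[OF 16 17] by simp
  show "norm_rep (10 :: 'p padic) (- 10)" using norm_rep_uminus_self[of "- 10 :: 'p padic"] by simp
  show "norm_rep (- 5 :: 'p padic) (- 10)" using norm_rep_commute[of "- 5" "- 10 :: 'p padic"] 14 by simp
  show "norm_rep (- 2 :: 'p padic) (- 10)" using norm_rep_commute[of "- 2" "- 10 :: 'p padic"] 9 by simp
qed

text \<open>For c other than 1, \<open>d\<close> is a representative outside the four norms that the
  table gives for c, so that multiplication by it moves the other four into the norm group.\<close>

lemma dyadic_hilbert_index:
  assumes "c \<noteq> (0 :: 'p padic)"
  shows "hilbert_index c"
proof (rule hilbert_index_of_reps[OF dyadic_square_class_reps, where c = c and d =
      "\<lambda>c. if c \<in> {2, 10} then 5 else if c = 5 then 2 else - 1"])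
  have sq: "norm_rep (n * m\<^sup>2) c \<longleftrightarrow> norm_rep n c" if "m \<noteq> 0" for n m c :: "'p padic"
    using norm_rep_mult_square_left[OF that] .
  have sq_eq: "norm_rep m c \<longleftrightarrow> norm_rep n c" if "m = n * k\<^sup>2" "k \<noteq> 0" for m n k c :: "'p padic"
    unfolding that(1) using sq[OF that(2)] .
  have sq1: "norm_rep 4 c" "norm_rep 25 c" "norm_rep 1 c" for c :: "'p padic"
    using norm_rep_square_left[of 2 c] norm_rep_square_left[of 1 c] norm_rep_square_left[of 5 c]
    by simp_all
  \<comment> \<open>The products of representatives with \<open>d\<close> leave the list of
    representatives only by a square factor 4 or 25.\<close>
  have sq50: "norm_rep 50 c \<longleftrightarrow> norm_rep 2 c" "norm_rep (- 50) c \<longleftrightarrow> norm_rep (- 2) c"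
    "norm_rep (- 25) c \<longleftrightarrow> norm_rep (- 1) c" for c :: "'p padic"
    by (rule sq_eq[where k = 5]; simp)+
  have sq20: "norm_rep 20 c \<longleftrightarrow> norm_rep 5 c" "norm_rep (- 20) c \<longleftrightarrow> norm_rep (- 5) c"
    "norm_rep (- 4) c \<longleftrightarrow> norm_rep (- 1) c" for c :: "'p padic"
    by (rule sq_eq[where k = 2]; simp)+
  have one: "norm_rep a 1" for a :: "'p padic" using norm_rep_square_right[of "1 :: 'p padic"] by simp
  show "norm_rep a c \<or> norm_rep (a * (if c \<in> {2, 10} then 5 else if c = 5 then 2 else - 1)) c"
    if "c \<in> {1, - 1, 5, - 5, 2, - 2, 10, - 10}" "a \<in> {1, - 1, 5, - 5, 2, - 2, 10, - 10}"
    for a c :: "'p padic"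
    using that by (elim insertE emptyE; simp add: sq1 sq20 sq50 one dyadic_norm_rep_table)
  show "(if c \<in> {2, 10} then 5 else if c = 5 then 2 else - 1) \<noteq> (0 :: 'p padic)" for c :: "'p padic"
    by auto
qed (rule assms)

end

lemma perfect_norm_pairing_dyadic:
  assumes card: "CARD('p :: prime_card) = 2"
  shows "perfect_norm_pairing TYPE('p padic)"
proof -
  note index = dyadic_hilbert_index[OF card]
  let ?nr = "norm_rep :: 'p padic \<Rightarrow> 'p padic \<Rightarrow> bool"
  have n: "?nr (a * b) c \<longleftrightarrow> (?nr a c \<longleftrightarrow> ?nr b c)" if "c \<noteq> 0" "a \<noteq> 0" "b \<noteq> 0" for a b c
    by (rule sign_character_mult[OF sign_character_norm_rep[OF index[OF that(1)]] that(2,3)])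
  have base: "\<not> ?nr (- 1) (- 1)" "?nr (- 1) 2" "?nr (- 1) 5" "?nr 2 (- 1)" "?nr 2 2" "\<not> ?nr 2 5"
    "?nr 5 (- 1)" "\<not> ?nr 5 2" "?nr 5 5" "?nr 10 (- 1)"
    using norm_rep_commute[of 2 "5 :: 'p padic", OF zero_neq_numeral[symmetric] zero_neq_numeral[symmetric]]
    by (simp_all only: dyadic_norm_rep_table[OF card] dyadic_not_norm_rep_2_5[OF card]
        dyadic_not_norm_rep_m1_m1[OF card] not_False_eq_True)
  have m: "?nr (- 2) c \<longleftrightarrow> (?nr (- 1) c \<longleftrightarrow> ?nr 2 c)" "?nr (- 5) c \<longleftrightarrow> (?nr (- 1) c \<longleftrightarrow> ?nr 5 c)"
    "?nr (- 10) c \<longleftrightarrow> (?nr (- 1) c \<longleftrightarrow> ?nr 10 c)" if "c \<noteq> 0" for c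
    using n[OF that, of "- 1" 2] n[OF that, of "- 1" 5] n[OF that, of "- 1" 10] by simp_all
  have ten: "?nr 10 c \<longleftrightarrow> (?nr 2 c \<longleftrightarrow> ?nr 5 c)" if "c \<noteq> 0" for c
    using n[of c 2 5] that by simp
  have one: "?nr 1 c" for c using norm_rep_square_left[of "1 :: 'p padic"] by simp
  show ?thesis
  proof (rule perfect_norm_pairingI[OF _ dyadic_square_class_reps[OF card] index])
    fix t :: "'p padic" assume "t \<in> {1, - 1, 5, - 5, 2, - 2, 10, - 10}"
    moreover have "\<not> ?nr (- 5) (- 1)" "\<not> ?nr (- 2) (- 1)" "\<not> ?nr 10 2" "\<not> ?nr (- 10) (- 1)"
      using base m[of "- 1"] ten[of 2] by simp_all
    moreover have "(2 :: 'p padic) \<noteq> 0" "(- 1 :: 'p padic) \<noteq> 0" "(5 :: 'p padic) \<noteq> 0" by simp_all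
    ultimately show "t = 1 \<or> (\<exists>c. c \<noteq> 0 \<and> \<not> norm_rep t c)"
      using base by blast
  next
    fix \<chi> :: "'p padic \<Rightarrow> bool" assume X: "sign_character \<chi>"
    \<comment> \<open>Among the generators -1, 2, 5 only the pairs (-1, -1), (2, 5) and (5, 2) have
      symbol -1. Hence the basis dual to -1, 2, 5 is -1, 5, 2.\<close>
    define a :: "'p padic" where
      "a = (if \<chi> (- 1) then 1 else - 1) * ((if \<chi> 2 then 1 else 5) * (if \<chi> 5 then 1 else 2))"
    have a: "a \<noteq> 0" by (simp add: a_def)
    have gen: "norm_rep a (- 1) \<longleftrightarrow> \<chi> (- 1)" "norm_rep a 2 \<longleftrightarrow> \<chi> 2" "norm_rep a 5 \<longleftrightarrow> \<chi> 5"
      unfolding a_def by (auto simp: base m ten one)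
    note Y = sign_character_norm_rep_right[OF index[OF a] a]
    have ext: "\<psi> (- c) \<longleftrightarrow> (\<psi> (- 1) \<longleftrightarrow> \<psi> c)" "\<psi> 10 \<longleftrightarrow> (\<psi> 2 \<longleftrightarrow> \<psi> 5)" "\<psi> 1"
      if "sign_character \<psi>" "c \<noteq> 0" for \<psi> and c :: "'p padic"
      using sign_character_mult[OF that(1), of "- 1" c] sign_character_mult[OF that(1), of 2 5]
        sign_character_1[OF that(1)] that(2) by simp_all
    have "norm_rep a t \<longleftrightarrow> \<chi> t" if "t \<in> {1, - 1, 5, - 5, 2, - 2, 10, - 10}" for t
      using that ext[OF X, of 2] ext[OF X, of 5] ext[OF X, of 10]
        ext[OF Y, of 2] ext[OF Y, of 5] ext[OF Y, of 10] gen by auto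
    with a show "\<exists>a. a \<noteq> 0 \<and> (\<forall>t\<in>{1, - 1, 5, - 5, 2, - 2, 10, - 10}. norm_rep a t \<longleftrightarrow> \<chi> t)"
      by blast
  qed simp_all
qed

theorem perfect_norm_pairing_padic: "perfect_norm_pairing TYPE('p :: prime_card padic)"
proof (cases "CARD('p) = 2")
  case False
  then have "2 < CARD('p)" using prime_ge_2_nat[OF prime_card[where 'a = 'p]] by linarith
  then show ?thesis by (rule perfect_norm_pairing_padic_odd)
qed (rule perfect_norm_pairing_dyadic)

section \<open>Kummer theory of exponent 2\<close>

text \<open>Stated with the operations of the type instead of a ring record;
  \<open>padic_extension_iff\<close> links the two. At 0 the last condition holds because
  \<open>inverse 0 = 0\<close>.\<close>

definition ac_subfield :: "'a :: field alg_closure set \<Rightarrow> bool" where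
  "ac_subfield F \<longleftrightarrow> range to_ac \<subseteq> F \<and> (\<forall>x\<in>F. \<forall>y\<in>F. x + y \<in> F \<and> x * y \<in> F) \<and> (\<forall>x\<in>F. inverse x \<in> F)"

text \<open>Endomorphisms of \<open>F\<close> over the base; those of the Kummer field turn out to
  be involutions, hence automorphisms.\<close>

definition ac_hom :: "'a :: field alg_closure set \<Rightarrow> ('a alg_closure \<Rightarrow> 'a alg_closure) \<Rightarrow> bool" where
  "ac_hom F \<sigma> \<longleftrightarrow> (\<forall>x\<in>F. \<sigma> x \<in> F) \<and> (\<forall>x\<in>F. \<forall>y\<in>F. \<sigma> (x + y) = \<sigma> x + \<sigma> y \<and> \<sigma> (x * y) = \<sigma> x * \<sigma> y) \<and>
     (\<forall>k. \<sigma> (to_ac k) = to_ac k)"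

definition ac_square_roots :: "'a :: field alg_closure set" where
  "ac_square_roots = {s. s\<^sup>2 \<in> range to_ac}"

text \<open>Products of square roots, also with base elements, are square roots, so the additive
  span is closed under multiplication. Lists provide the number of summands for an
  induction.\<close>

definition kummer_field :: "'a :: field alg_closure set" where
  "kummer_field = {sum_list xs | xs. set xs \<subseteq> ac_square_roots}"

text \<open>The factor by which the automorphism belonging to \<chi> multiplies \<open>s\<close>.
  The value of \<open>of_ac\<close> is meaningful for \<open>s\<close> in
  \<open>ac_square_roots\<close>.\<close>

definition root_sign :: "('a :: field \<Rightarrow> bool) \<Rightarrow> 'a alg_closure \<Rightarrow> 'a alg_closure" where
  "root_sign \<chi> s = (if \<chi> (of_ac (s\<^sup>2)) then 1 else - 1)"

lemma ac_subfieldD: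
  assumes "ac_subfield F"
  shows "to_ac k \<in> F" "0 \<in> F" "1 \<in> F" "x \<in> F \<Longrightarrow> y \<in> F \<Longrightarrow> x + y \<in> F"
    "x \<in> F \<Longrightarrow> y \<in> F \<Longrightarrow> x * y \<in> F" "x \<in> F \<Longrightarrow> inverse x \<in> F" "x \<in> F \<Longrightarrow> - x \<in> F"
    "x \<in> F \<Longrightarrow> y \<in> F \<Longrightarrow> x - y \<in> F" "x \<in> F \<Longrightarrow> y \<in> F \<Longrightarrow> x / y \<in> F" "x \<in> F \<Longrightarrow> x ^ n \<in> F"
proof -
  show K: "to_ac k \<in> F" for k using assms unfolding ac_subfield_def by blast
  show "0 \<in> F" and one: "1 \<in> F" using K[of 0] K[of 1] by simp_all
  show add: "x \<in> F \<Longrightarrow> y \<in> F \<Longrightarrow> x + y \<in> F" for x y using assms unfolding ac_subfield_def by blast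
  show mult: "x \<in> F \<Longrightarrow> y \<in> F \<Longrightarrow> x * y \<in> F" for x y using assms unfolding ac_subfield_def by blast
  show inv: "x \<in> F \<Longrightarrow> inverse x \<in> F" for x using assms unfolding ac_subfield_def by blast
  show neg: "x \<in> F \<Longrightarrow> - x \<in> F" for x using mult[OF K[of "- 1"], of x] by simp
  show "x \<in> F \<Longrightarrow> y \<in> F \<Longrightarrow> x - y \<in> F" using add[OF _ neg, of x y] by simp
  show "x \<in> F \<Longrightarrow> y \<in> F \<Longrightarrow> x / y \<in> F" using mult[OF _ inv, of x y] by (simp add: divide_inverse)
  show "x \<in> F \<Longrightarrow> x ^ n \<in> F" by (induction n) (simp_all add: one mult)
qed

lemma ac_homD:
  assumes "ac_hom F \<sigma>"
  shows "x \<in> F \<Longrightarrow> \<sigma> x \<in> F" "x \<in> F \<Longrightarrow> y \<in> F \<Longrightarrow> \<sigma> (x + y) = \<sigma> x + \<sigma> y"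
    "x \<in> F \<Longrightarrow> y \<in> F \<Longrightarrow> \<sigma> (x * y) = \<sigma> x * \<sigma> y" "\<sigma> (to_ac k) = to_ac k" "\<sigma> 0 = 0" "\<sigma> 1 = 1"
proof -
  show "x \<in> F \<Longrightarrow> \<sigma> x \<in> F" "x \<in> F \<Longrightarrow> y \<in> F \<Longrightarrow> \<sigma> (x + y) = \<sigma> x + \<sigma> y"
    "x \<in> F \<Longrightarrow> y \<in> F \<Longrightarrow> \<sigma> (x * y) = \<sigma> x * \<sigma> y"
    using assms unfolding ac_hom_def by simp_all
  show K: "\<sigma> (to_ac k) = to_ac k" for k using assms unfolding ac_hom_def by simp
  show "\<sigma> 0 = 0" "\<sigma> 1 = 1" using K[of 0] K[of 1] by simp_all
qed

lemma ac_hom_uminus: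
  assumes "ac_subfield F" "ac_hom F \<sigma>" "x \<in> F"
  shows "\<sigma> (- x) = - \<sigma> x"
proof -
  have "\<sigma> (to_ac (- 1) * x) = to_ac (- 1) * \<sigma> x"
    using ac_homD(3)[OF assms(2) ac_subfieldD(1)[OF assms(1)] assms(3), of "- 1"]
      ac_homD(4)[OF assms(2), of "- 1"] by simp
  then show ?thesis by simp
qed

lemma ac_square_rootsI: "s\<^sup>2 = to_ac c \<Longrightarrow> s \<in> ac_square_roots"
  unfolding ac_square_roots_def by simp

lemma ac_square_roots_to_ac: "to_ac k \<in> ac_square_roots"
  by (rule ac_square_rootsI[of _ "k\<^sup>2"]) simp

lemma ac_square_roots_mult:
  assumes "s \<in> ac_square_roots" "t \<in> ac_square_roots"
  shows "s * t \<in> ac_square_roots"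
proof -
  from assms obtain c d where "s\<^sup>2 = to_ac c" "t\<^sup>2 = to_ac d"
    unfolding ac_square_roots_def by blast
  then show ?thesis by (intro ac_square_rootsI[of _ "c * d"]) (simp add: power_mult_distrib)
qed

lemma ac_square_roots_divide:
  assumes "s \<in> ac_square_roots" "t \<in> ac_square_roots"
  shows "s / t \<in> ac_square_roots"
proof -
  from assms obtain c d where "s\<^sup>2 = to_ac c" "t\<^sup>2 = to_ac d"
    unfolding ac_square_roots_def by blast
  then show ?thesis by (intro ac_square_rootsI[of _ "c / d"]) (simp add: power_divide)
qed

lemma ac_square_rootsE:
  assumes "s \<in> ac_square_roots" "s \<noteq> 0"
  obtains c where "s\<^sup>2 = to_ac c" "c \<noteq> 0"
proof -
  obtain c where c: "s\<^sup>2 = to_ac c" using assms unfolding ac_square_roots_def by blast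
  have "c \<noteq> 0"
  proof
    assume "c = 0"
    then show False using c assms(2) by simp
  qed
  with c show ?thesis by (rule that)
qed

lemma root_sign_cases: "root_sign \<chi> s = 1 \<or> root_sign \<chi> s = - 1"
  unfolding root_sign_def by (rule if_split[THEN iffD2]) blast

lemma root_sign_eq: "s\<^sup>2 = to_ac c \<Longrightarrow> root_sign \<chi> s = (if \<chi> c then 1 else - 1)"
  unfolding root_sign_def by (simp only: of_ac_to_ac)

lemma root_sign_mult:
  assumes "sign_character \<chi>" "s \<in> ac_square_roots" "t \<in> ac_square_roots" "s \<noteq> 0" "t \<noteq> 0"
  shows "root_sign \<chi> (s * t) = root_sign \<chi> s * root_sign \<chi> t"
proof -
  obtain c where c: "s\<^sup>2 = to_ac c" "c \<noteq> 0" using ac_square_rootsE[OF assms(2,4)] .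
  obtain d where d: "t\<^sup>2 = to_ac d" "d \<noteq> 0" using ac_square_rootsE[OF assms(3,5)] .
  have "(s * t)\<^sup>2 = to_ac (c * d)" using c d by (simp add: power_mult_distrib)
  from root_sign_eq[OF this, of \<chi>] root_sign_eq[OF c(1), of \<chi>] root_sign_eq[OF d(1), of \<chi>]
  show ?thesis
    unfolding sign_character_mult[OF assms(1) c(2) d(2)] by (cases "\<chi> c"; cases "\<chi> d") simp_all
qed

lemma root_sign_to_ac:
  assumes "sign_character \<chi>" "k \<noteq> 0"
  shows "root_sign \<chi> (to_ac k) = 1"
proof -
  have "(to_ac k)\<^sup>2 = to_ac (k\<^sup>2)" by (rule to_ac_power[symmetric])
  from root_sign_eq[OF this, of \<chi>] show ?thesis
    by (simp only: sign_character_square[OF assms] if_True)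
qed

lemma kummer_field_root: "s \<in> ac_square_roots \<Longrightarrow> s \<in> kummer_field"
  unfolding kummer_field_def by (auto intro!: exI[of _ "[s]"])

lemma kummer_field_add: "x \<in> kummer_field \<Longrightarrow> y \<in> kummer_field \<Longrightarrow> x + y \<in> kummer_field"
proof -
  assume "x \<in> kummer_field" "y \<in> kummer_field"
  then obtain xs ys where "x = sum_list xs" "set xs \<subseteq> ac_square_roots"
    "y = sum_list ys" "set ys \<subseteq> ac_square_roots" unfolding kummer_field_def by blast
  then have "x + y = sum_list (xs @ ys)" "set (xs @ ys) \<subseteq> ac_square_roots" by simp_all
  then show ?thesis unfolding kummer_field_def by blast
qed

lemma kummer_field_induct [consumes 1, case_names zero add]:
  assumes "x \<in> kummer_field" "P 0"
    "\<And>s x. s \<in> ac_square_roots \<Longrightarrow> x \<in> kummer_field \<Longrightarrow> P x \<Longrightarrow> P (s + x)"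
  shows "P x"
proof -
  obtain xs where xs: "x = sum_list xs" "set xs \<subseteq> ac_square_roots"
    using assms(1) unfolding kummer_field_def by blast
  from xs(2) have "P (sum_list xs)"
  proof (induction xs)
    case Nil
    show ?case using assms(2) by simp
  next
    case (Cons a xs)
    have "sum_list xs \<in> kummer_field" unfolding kummer_field_def using Cons.prems by auto
    then show ?case using assms(3)[of a "sum_list xs"] Cons by simp
  qed
  then show ?thesis by (simp add: xs(1))
qed

lemma kummer_field_root_mult:
  "y \<in> kummer_field \<Longrightarrow> s \<in> ac_square_roots \<Longrightarrow> s * y \<in> kummer_field"
proof (induction rule: kummer_field_induct)
  case zero
  then show ?case using kummer_field_root[OF ac_square_roots_to_ac[of 0]] by simp
next
  case (add t x)
  then show ?case
    by (simp add: distrib_left kummer_field_add kummer_field_root ac_square_roots_mult)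
qed

lemma kummer_field_mult: "x \<in> kummer_field \<Longrightarrow> y \<in> kummer_field \<Longrightarrow> x * y \<in> kummer_field"
proof (induction rule: kummer_field_induct)
  case zero
  then show ?case using kummer_field_root[OF ac_square_roots_to_ac[of 0]] by simp
next
  case (add t x)
  then show ?case by (simp add: distrib_right kummer_field_add kummer_field_root_mult)
qed

section \<open>Towers of square roots\<close>

definition realizes_characters :: "'a :: field alg_closure set \<Rightarrow> bool" where
  "realizes_characters F \<longleftrightarrow> (\<forall>\<chi>. sign_character \<chi> \<longrightarrow>
     (\<exists>\<sigma>. ac_hom F \<sigma> \<and> (\<forall>s\<in>ac_square_roots \<inter> F. \<sigma> s = root_sign \<chi> s * s)))"

definition adjoin_root :: "'a :: field alg_closure set \<Rightarrow> 'a alg_closure \<Rightarrow> 'a alg_closure set" where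
  "adjoin_root F t = {a + b * t | a b. a \<in> F \<and> b \<in> F}"

lemma adjoin_rootI: "a \<in> F \<Longrightarrow> b \<in> F \<Longrightarrow> x = a + b * t \<Longrightarrow> x \<in> adjoin_root F t"
  unfolding adjoin_root_def by blast

context
  fixes F :: "'a :: field_char_0 alg_closure set" and t :: "'a alg_closure"
  assumes F: "ac_subfield F" and t: "t \<in> ac_square_roots" "t \<notin> F"
begin

lemma adjoin_root_unique:
  assumes "a + b * t = a' + b' * t" "a \<in> F" "b \<in> F" "a' \<in> F" "b' \<in> F"
  shows "a = a' \<and> b = b'"
proof -
  have "b = b'"
  proof (rule ccontr)
    assume "b \<noteq> b'"
    then have "t = (a - a') / (b' - b)" using assms(1) by (simp add: field_simps)
    also have "\<dots> \<in> F" using assms(2-5) by (simp only: ac_subfieldD(8,9)[OF F])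
    finally show False using t(2) by contradiction
  qed
  with assms(1) show ?thesis by simp
qed

lemma adjoin_root_square: "t\<^sup>2 \<in> F"
  using t(1) ac_subfieldD(1)[OF F] unfolding ac_square_roots_def by auto

lemma ac_subfield_adjoin_root: "ac_subfield (adjoin_root F t)"
  unfolding ac_subfield_def
proof (intro conjI ballI subsetI)
  note D = ac_subfieldD[OF F]
  fix x :: "'a alg_closure" assume "x \<in> range to_ac"
  then show "x \<in> adjoin_root F t"
    using D(1,2) by (intro adjoin_rootI[of x F 0]) auto
next
  note D = ac_subfieldD[OF F]
  fix x y :: "'a alg_closure" assume "x \<in> adjoin_root F t" "y \<in> adjoin_root F t"
  then obtain a b c d where x: "x = a + b * t" "a \<in> F" "b \<in> F" and y: "y = c + d * t" "c \<in> F" "d \<in> F"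
    unfolding adjoin_root_def by blast
  have "x + y = (a + c) + (b + d) * t" using x y by (simp add: algebra_simps)
  then show "x + y \<in> adjoin_root F t" by (rule adjoin_rootI[rotated 2]) (simp_all only: x y D(4))
  have "x * y = (a * c + b * d * t\<^sup>2) + (a * d + b * c) * t"
    using x y by (simp add: algebra_simps power2_eq_square)
  then show "x * y \<in> adjoin_root F t"
    by (rule adjoin_rootI[rotated 2]) (simp_all only: x y D(4,5) adjoin_root_square)
next
  note D = ac_subfieldD[OF F]
  fix x :: "'a alg_closure" assume "x \<in> adjoin_root F t"
  then obtain a b where x: "x = a + b * t" "a \<in> F" "b \<in> F"
    unfolding adjoin_root_def by blast
  show "inverse x \<in> adjoin_root F t"
  proof (cases "x = 0")
    case True
    then show ?thesis using D(2) by (auto intro: adjoin_rootI[where a = 0 and b = 0])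
  next
    case False
    have "a - b * t \<noteq> 0"
    proof
      assume "a - b * t = 0"
      then have "a + (- b) * t = 0 + 0 * t" by simp
      then have "a = 0" "b = 0" using adjoin_root_unique[of a "- b" 0 0] x D by auto
      with False x show False by simp
    qed
    \<comment> \<open>The norm of \<open>x\<close> down to \<open>F\<close>; the inverse is the
      conjugate divided by it.\<close>
    define n where "n = a\<^sup>2 - b\<^sup>2 * t\<^sup>2"
    have n: "n = x * (a - b * t)" by (simp add: n_def x(1) algebra_simps power2_eq_square)
    have "n \<in> F" unfolding n_def using x adjoin_root_square D(5,8,10) by simp
    have "inverse x = (a - b * t) / n"
      using False \<open>a - b * t \<noteq> 0\<close> unfolding n by (simp add: divide_simps)
    then have "inverse x = a / n + (- b / n) * t"
      by (simp add: diff_divide_distrib)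
    then show ?thesis by (rule adjoin_rootI[rotated 2]) (simp_all only: x D(7,9) \<open>n \<in> F\<close>)
  qed
qed

text \<open>The square lies in \<open>F\<close>, so its coefficient 2 a b at \<open>t\<close>
  vanishes: the square roots in F(t) lie in F or in F t.\<close>

lemma adjoin_root_square_roots:
  assumes "s \<in> ac_square_roots" "s = a + b * t" "a \<in> F" "b \<in> F"
  shows "a = 0 \<or> b = 0"
proof -
  note D = ac_subfieldD[OF F]
  have "s\<^sup>2 \<in> F" using assms(1) D(1) unfolding ac_square_roots_def by auto
  have "(a\<^sup>2 + b\<^sup>2 * t\<^sup>2) + (2 * a * b) * t = s\<^sup>2 + 0 * t"
    unfolding assms(2) by (simp add: power2_eq_square algebra_simps)
  moreover have "2 \<in> F" using D(1)[of 2] by simp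
  ultimately have "2 * a * b = 0"
    using adjoin_root_unique[of "a\<^sup>2 + b\<^sup>2 * t\<^sup>2" "2 * a * b" "s\<^sup>2" 0] \<open>s\<^sup>2 \<in> F\<close> assms(3,4)
      adjoin_root_square D(2,4,5,10) by simp
  then show ?thesis by simp
qed

text \<open>Extend \<sigma> by multiplying \<open>t\<close> with its prescribed sign \<epsilon>. A
  square root outside \<open>F\<close> is b t with a square root b in \<open>F\<close>, and its sign
  is correct because \<open>root_sign\<close> is multiplicative.\<close>

lemma realizes_characters_adjoin_root:
  assumes "realizes_characters F"
  shows "realizes_characters (adjoin_root F t)"
  unfolding realizes_characters_def
proof (intro allI impI)
  note D = ac_subfieldD[OF F]
  fix \<chi> :: "'a \<Rightarrow> bool" assume chi: "sign_character \<chi>"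
  then obtain \<sigma> where hom: "ac_hom F \<sigma>" and s: "\<And>s. s \<in> ac_square_roots \<Longrightarrow> s \<in> F \<Longrightarrow> \<sigma> s = root_sign \<chi> s * s"
    using assms unfolding realizes_characters_def by blast
  define \<epsilon> where "\<epsilon> = root_sign \<chi> t"
  have eps: "\<epsilon> * \<epsilon> = 1" "\<epsilon> = 1 \<or> \<epsilon> = - 1" using root_sign_cases[of \<chi> t] by (auto simp: \<epsilon>_def)
  have epsF: "\<epsilon> \<in> F" using eps(2) D(3,7) by auto
  \<comment> \<open>Defined through the coordinates of x in the basis 1, t, which
    \<open>adjoin_root_unique\<close> makes unique.\<close>
  define \<tau> where "\<tau> = (\<lambda>x. THE y. \<exists>a\<in>F. \<exists>b\<in>F. x = a + b * t \<and> y = \<sigma> a + \<epsilon> * \<sigma> b * t)"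
  have tau: "\<tau> (a + b * t) = \<sigma> a + \<epsilon> * \<sigma> b * t" if "a \<in> F" "b \<in> F" for a b
    unfolding \<tau>_def
  proof (rule the_equality)
    fix y assume "\<exists>a'\<in>F. \<exists>b'\<in>F. a + b * t = a' + b' * t \<and> y = \<sigma> a' + \<epsilon> * \<sigma> b' * t"
    then obtain a' b' where y: "a' \<in> F" "b' \<in> F" "a + b * t = a' + b' * t"
      "y = \<sigma> a' + \<epsilon> * \<sigma> b' * t" by blast
    from adjoin_root_unique[OF y(3) that y(1,2)] y(4) show "y = \<sigma> a + \<epsilon> * \<sigma> b * t" by simp
  qed (use that in blast)
  have t2: "\<sigma> (t\<^sup>2) = t\<^sup>2"
    using t(1) ac_homD(4)[OF hom] unfolding ac_square_roots_def by auto
  note H = ac_homD[OF hom]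
  have "ac_hom (adjoin_root F t) \<tau>"
    unfolding ac_hom_def
  proof (intro conjI ballI allI)
    fix x :: "'a alg_closure" assume "x \<in> adjoin_root F t"
    then obtain a b where x: "x = a + b * t" "a \<in> F" "b \<in> F" unfolding adjoin_root_def by blast
    show "\<tau> x \<in> adjoin_root F t"
      unfolding x(1) using tau[OF x(2,3)]
      by (rule adjoin_rootI[rotated 2]) (simp_all only: x H(1) D(5) epsF)
  next
    fix x y :: "'a alg_closure" assume "x \<in> adjoin_root F t" "y \<in> adjoin_root F t"
    then obtain a b c d where x: "x = a + b * t" "a \<in> F" "b \<in> F" and y: "y = c + d * t" "c \<in> F" "d \<in> F"
      unfolding adjoin_root_def by blast
    have sum: "x + y = (a + c) + (b + d) * t" using x y by (simp add: algebra_simps)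
    have "\<tau> (x + y) = \<sigma> (a + c) + \<epsilon> * \<sigma> (b + d) * t"
      unfolding sum using x y D(4) by (intro tau) auto
    then show "\<tau> (x + y) = \<tau> x + \<tau> y"
      using tau x y H(2) by (simp add: algebra_simps)
    have prod: "x * y = (a * c + b * d * t\<^sup>2) + (a * d + b * c) * t"
      using x y by (simp add: algebra_simps power2_eq_square)
    have F': "a * c \<in> F" "b * d \<in> F" "b * d * t\<^sup>2 \<in> F" "a * d \<in> F" "b * c \<in> F"
      using x y adjoin_root_square D(5) by auto
    have "\<tau> (x * y) = \<sigma> (a * c + b * d * t\<^sup>2) + \<epsilon> * \<sigma> (a * d + b * c) * t"
      unfolding prod using F' D(4) by (intro tau) auto
    also have "\<dots> = (\<sigma> a * \<sigma> c + \<sigma> b * \<sigma> d * t\<^sup>2) + \<epsilon> * (\<sigma> a * \<sigma> d + \<sigma> b * \<sigma> c) * t"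
      using F' x y adjoin_root_square by (simp add: H(2,3) t2)
    also have "\<dots> = (\<sigma> a + \<epsilon> * \<sigma> b * t) * (\<sigma> c + \<epsilon> * \<sigma> d * t)"
      using eps(2) by (auto simp: algebra_simps power2_eq_square)
    finally show "\<tau> (x * y) = \<tau> x * \<tau> y" using tau x y by simp
  next
    fix k
    show "\<tau> (to_ac k) = to_ac k" using tau[OF D(1,2), of k] H(4,5) by simp
  qed
  moreover have "\<tau> s = root_sign \<chi> s * s" if sF: "s \<in> ac_square_roots" "s \<in> adjoin_root F t" for s
  proof -
    obtain a b where ab: "s = a + b * t" "a \<in> F" "b \<in> F"
      using sF(2) unfolding adjoin_root_def by blast
    have t0: "t \<noteq> 0" using t(2) D(2) by blast
    from adjoin_root_square_roots[OF sF(1) ab] show ?thesis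
    proof
      assume "b = 0"
      then show ?thesis using tau[OF ab(2) D(2)] s[of s] sF(1) ab H(5) by simp
    next
      assume a: "a = 0"
      show ?thesis
      proof (cases "b = 0")
        case True
        then show ?thesis using a ab tau[OF D(2) D(2)] H(5) by simp
      next
        case False
        have "b = s / t" using a ab(1) t0 by simp
        then have b: "b \<in> ac_square_roots" using ac_square_roots_divide sF(1) t(1) by blast
        have "\<tau> s = \<epsilon> * (root_sign \<chi> b * b) * t" using tau[OF D(2) ab(3)] a ab(1) H(5) s[OF b ab(3)] by simp
        also have "\<dots> = root_sign \<chi> (b * t) * (b * t)"
          using root_sign_mult[OF chi b t(1) False t0] by (simp add: \<epsilon>_def)
        finally show ?thesis using a ab(1) by simp
      qed
    qed
  qed
  ultimately show "\<exists>\<sigma>. ac_hom (adjoin_root F t) \<sigma> \<and>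
      (\<forall>s\<in>ac_square_roots \<inter> adjoin_root F t. \<sigma> s = root_sign \<chi> s * s)" by blast
qed

end

text \<open>Roots are adjoined one at a time, skipping those already present. The inclusion in
  \<open>kummer_field\<close> serves to identify the top of the tower afterwards.\<close>

lemma square_root_tower:
  fixes T :: "'a :: field_char_0 alg_closure set"
  assumes "finite T" "T \<subseteq> ac_square_roots"
  shows "\<exists>F. ac_subfield F \<and> F \<subseteq> kummer_field \<and> T \<subseteq> F \<and> realizes_characters F"
  using assms
proof (induction T rule: finite_induct)
  case empty
  have "ac_subfield (range to_ac :: 'a alg_closure set)"
    unfolding ac_subfield_def by (auto simp flip: to_ac_add to_ac_mult to_ac_inverse)
  moreover have "range to_ac \<subseteq> (kummer_field :: 'a alg_closure set)"
    using kummer_field_root ac_square_roots_to_ac by blast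
  moreover have "realizes_characters (range to_ac :: 'a alg_closure set)"
    unfolding realizes_characters_def
  proof (intro allI impI exI[of _ "\<lambda>x. x"] conjI ballI)
    fix \<chi> :: "'a \<Rightarrow> bool" and s :: "'a alg_closure"
    assume "sign_character \<chi>" "s \<in> ac_square_roots \<inter> range to_ac"
    then obtain k where "s = to_ac k" "sign_character \<chi>" by auto
    then show "s = root_sign \<chi> s * s" using root_sign_to_ac[of \<chi> k] by (cases "k = 0") simp_all
  qed (auto simp: ac_hom_def)
  ultimately show ?case by blast
next
  case (insert t T)
  then have t: "t \<in> ac_square_roots" by simp
  from insert obtain F where F: "ac_subfield F" "F \<subseteq> kummer_field" "T \<subseteq> F" "realizes_characters F" by auto
  show ?case
  proof (cases "t \<in> F")
    case False
    note D = ac_subfieldD[OF F(1)]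
    have "adjoin_root F t \<subseteq> kummer_field"
      unfolding adjoin_root_def using F(2) kummer_field_add kummer_field_mult kummer_field_root t by blast
    moreover have "t \<in> adjoin_root F t"
      by (rule adjoin_rootI[of 0 _ 1]) (use D(2,3) in auto)
    moreover have "F \<subseteq> adjoin_root F t"
      using D(2) by (auto intro: adjoin_rootI[where b = 0])
    ultimately show ?thesis
      using ac_subfield_adjoin_root[OF F(1) t False] realizes_characters_adjoin_root[OF F(1) t False F(4)] F(3)
      by blast
  qed (use F in auto)
qed

text \<open>A square root of u v^2 is, up to sign, v times the chosen root of u. So one root for
  each of the finitely many representatives yields all square roots.\<close>

lemma kummer_field_tower:
  assumes "finite T" "square_class_reps (T :: 'a :: field_char_0 set)"
  shows "ac_subfield (kummer_field :: 'a alg_closure set)"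
    "realizes_characters (kummer_field :: 'a alg_closure set)"
proof -
  have "\<exists>s. s\<^sup>2 = to_ac t" for t :: 'a
    using nth_root_exists[of 2 "to_ac t"] by auto
  then obtain r :: "'a \<Rightarrow> 'a alg_closure" where r: "\<And>t. (r t)\<^sup>2 = to_ac t" by metis
  have rS: "r t \<in> ac_square_roots" for t unfolding ac_square_roots_def using r by auto
  obtain F where F: "ac_subfield F" "F \<subseteq> kummer_field" "r ` T \<subseteq> F" "realizes_characters F"
    using square_root_tower[of "r ` T"] assms(1) rS by blast
  have SF: "s \<in> F" if "s \<in> ac_square_roots" for s
  proof (cases "s = 0")
    case False
    obtain c where c: "s\<^sup>2 = to_ac c" "c \<noteq> 0"
      using ac_square_rootsE[OF \<open>s \<in> ac_square_roots\<close> False] .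
    obtain u v where uv: "u \<in> T" "v \<noteq> 0" "c = u * v\<^sup>2" using square_class_repsE[OF assms(2) c(2)] by blast
    have "s\<^sup>2 = (r u * to_ac v)\<^sup>2" using c(1) uv(3) r by (simp add: power_mult_distrib)
    then have "s = r u * to_ac v \<or> s = - (r u * to_ac v)" by (simp add: power2_eq_iff)
    moreover have "r u * to_ac v \<in> F" using uv(1) F(3) ac_subfieldD(1,5)[OF F(1)] by auto
    ultimately show ?thesis using ac_subfieldD(7)[OF F(1)] by auto
  qed (use ac_subfieldD[OF F(1)] in auto)
  have "x \<in> F" if "x \<in> kummer_field" for x
    using that by (induction rule: kummer_field_induct) (use SF ac_subfieldD[OF F(1)] in auto)
  then have "F = kummer_field" using F(2) by blast
  then show "ac_subfield (kummer_field :: 'a alg_closure set)"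
    "realizes_characters (kummer_field :: 'a alg_closure set)" using F by auto
qed

section \<open>Galois groups and the maximal abelian extension of exponent 2\<close>

lemma Gal_carrier_iff:
  fixes F :: "'p :: prime_card padic alg_closure set"
  assumes "range to_ac \<subseteq> F"
  shows "\<sigma> \<in> carrier (Gal F) \<longleftrightarrow> \<sigma> \<in> extensional F \<and> bij_betw \<sigma> F F \<and> ac_hom F \<sigma>"
proof -
  have "(1 :: 'p padic alg_closure) = to_ac 1" by simp
  then have one: "\<sigma> 1 = 1" if "\<forall>k. \<sigma> (to_ac k) = to_ac k" using that by metis
  have "\<sigma> \<in> F \<rightarrow> F" if "bij_betw \<sigma> F F" using that by (rule bij_betw_imp_funcset)
  then show ?thesis
    using one unfolding Gal_def Bij_def Ring.ring_hom_def ring_of_type_algebra_def padic_base_def ac_hom_def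
    by (auto simp: Pi_iff)
qed

lemma Gal_mult:
  assumes "\<sigma> \<in> carrier (Gal F)" "\<tau> \<in> carrier (Gal F)"
  shows "\<sigma> \<otimes>\<^bsub>Gal F\<^esub> \<tau> = compose F \<sigma> \<tau>"
  using assms by (simp add: Gal_def BijGroup_def)

lemma Gal_one: "\<one>\<^bsub>Gal F\<^esub> = (\<lambda>x\<in>F. x)"
  by (simp add: Gal_def BijGroup_def)

lemma padic_extension_iff: "padic_extension F \<longleftrightarrow> ac_subfield F"
proof -
  interpret R: field "ring_of_type_algebra :: 'a padic alg_closure ring" by (rule field_from_type_algebra)
  have inv: "inv\<^bsub>ring_of_type_algebra\<^esub> x = inverse x" if "x \<noteq> 0" for x :: "'a padic alg_closure"
    by (rule R.comm_inv_char) (use that in \<open>simp_all add: ring_of_type_algebra_def\<close>)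
  have neg: "\<ominus>\<^bsub>ring_of_type_algebra\<^esub> x = - x" for x :: "'a padic alg_closure"
    by (rule R.minus_equality[symmetric, THEN sym]) (simp_all add: ring_of_type_algebra_def)
  show ?thesis
  proof
    assume "padic_extension F"
    then have F: "subfield F ring_of_type_algebra" "range to_ac \<subseteq> F"
      by (auto simp: padic_extension_def padic_base_def)
    note S = subringE[OF subfieldE(1)[OF F(1)]]
    have "inverse x \<in> F" if "x \<in> F" for x
    proof (cases "x = 0")
      case False
      then have "inv\<^bsub>ring_of_type_algebra\<^esub> x \<in> F"
        using R.subfield_m_inv(1)[OF F(1), of x] that by (simp add: ring_of_type_algebra_def)
      then show ?thesis using inv[OF False] by simp
    qed (use that in simp)
    then show "ac_subfield F"
      using F(2) S(6,7) unfolding ac_subfield_def ring_of_type_algebra_def by simp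
  next
    assume F: "ac_subfield F"
    note D = ac_subfieldD[OF F]
    have "subring F ring_of_type_algebra"
      by (rule R.subringI) (use D in \<open>simp_all add: neg\<close>, simp_all add: D ring_of_type_algebra_def)
    moreover have "inv\<^bsub>ring_of_type_algebra\<^esub> k \<in> F" if "k \<in> F - {\<zero>\<^bsub>ring_of_type_algebra\<^esub>}" for k
    proof -
      have "k \<in> F" "k \<noteq> 0" using that by (simp_all add: ring_of_type_algebra_def)
      then show ?thesis using D(6) inv by simp
    qed
    ultimately have "subfield F ring_of_type_algebra" by (rule R.subfieldI')
    then show "padic_extension F"
      using D(1) by (auto simp: padic_extension_def padic_base_def)
  qed
qed

lemma ac_hom_kummer_eqI:
  assumes "ac_subfield F" "kummer_field \<subseteq> F" "ac_hom F \<sigma>" "ac_hom F \<tau>"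
    "\<And>s. s \<in> ac_square_roots \<Longrightarrow> \<sigma> s = \<tau> s" "x \<in> kummer_field"
  shows "\<sigma> x = \<tau> x"
  using assms(6)
proof (induction rule: kummer_field_induct)
  case zero
  then show ?case using ac_homD(5)[OF assms(3)] ac_homD(5)[OF assms(4)] by simp
next
  case (add s x)
  have "s \<in> F" "x \<in> F" using kummer_field_root[OF add(1)] add(2) assms(2) by auto
  then show ?case
    using ac_homD(2)[OF assms(3)] ac_homD(2)[OF assms(4)] assms(5)[OF add(1)] add(3) by simp
qed

text \<open>The square of \<open>s\<close> is fixed, so \<open>s\<close> and its image have equal
  squares.\<close>

lemma ac_hom_root:
  assumes "ac_subfield F" "ac_hom F \<sigma>" "s \<in> ac_square_roots" "s \<in> F"
  shows "\<sigma> s = s \<or> \<sigma> s = - s"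
proof -
  obtain c where c: "s\<^sup>2 = to_ac c" using assms(3) unfolding ac_square_roots_def by blast
  have "\<sigma> s * \<sigma> s = \<sigma> (s * s)" using ac_homD(3)[OF assms(2,4,4)] by simp
  also have "\<dots> = s * s" using ac_homD(4)[OF assms(2), of c] c by (simp add: power2_eq_square)
  finally show ?thesis by (simp add: square_eq_iff)
qed

section \<open>The Galois group of the Kummer field\<close>

context
  fixes P :: "'p :: prime_card itself"
begin

text \<open>The name anticipates \<open>max_abelian_exp2_eq\<close>.\<close>

abbreviation M :: "'p padic alg_closure set" where "M \<equiv> kummer_field"

lemma padic_norm_pairing:
  "\<exists>T :: 'p padic set. finite T \<and> square_class_reps T"
  "c \<noteq> 0 \<Longrightarrow> hilbert_index (c :: 'p padic)"
  "a \<noteq> 0 \<Longrightarrow> (\<And>c. c \<noteq> 0 \<Longrightarrow> norm_rep a c) \<Longrightarrow> \<exists>s. (a :: 'p padic) = s\<^sup>2"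
  "sign_character \<chi> \<Longrightarrow> \<exists>a :: 'p padic. a \<noteq> 0 \<and> (\<forall>c. c \<noteq> 0 \<longrightarrow> (norm_rep a c \<longleftrightarrow> \<chi> c))"
  using perfect_norm_pairing_padic[where 'p = 'p] unfolding perfect_norm_pairing_def by simp_all

lemma M_subfield: "ac_subfield M"
  using padic_norm_pairing(1) kummer_field_tower(1) by blast

lemma M_base: "range to_ac \<subseteq> M"
  using ac_subfieldD(1)[OF M_subfield] by blast

lemma M_Gal_iff: "\<sigma> \<in> carrier (Gal M) \<longleftrightarrow> \<sigma> \<in> extensional M \<and> bij_betw \<sigma> M M \<and> ac_hom M \<sigma>"
  by (rule Gal_carrier_iff[OF M_base])

text \<open>\<sigma> multiplies each square root by a sign, and these roots span \<open>M\<close>.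
  Bijectivity of \<sigma> and exponent 2 of the Galois group both come from here.\<close>

lemma M_hom_involution:
  assumes "ac_hom M \<sigma>" "x \<in> M"
  shows "\<sigma> (\<sigma> x) = x"
  using assms(2)
proof (induction rule: kummer_field_induct)
  case zero
  show ?case using ac_homD(5)[OF assms(1)] by simp
next
  case (add s x)
  have s: "s \<in> M" by (rule kummer_field_root[OF add(1)])
  have "\<sigma> (\<sigma> s) = s"
    using ac_hom_root[OF M_subfield assms(1) add(1) s] ac_hom_uminus[OF M_subfield assms(1) s] by auto
  then show ?case
    using ac_homD(1,2)[OF assms(1)] s add(2,3) by simp
qed

lemma restrict_M_Gal:
  assumes "ac_hom M \<sigma>"
  shows "restrict \<sigma> M \<in> carrier (Gal M)"
  unfolding M_Gal_iff
proof (intro conjI)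
  have "bij_betw \<sigma> M M"
    by (rule bij_betw_byWitness[where f' = \<sigma>]) (use M_hom_involution[OF assms] ac_homD(1)[OF assms] in auto)
  then show "bij_betw (restrict \<sigma> M) M M" by (simp cong: bij_betw_cong)
  note D = ac_subfieldD[OF M_subfield]
  show "ac_hom M (restrict \<sigma> M)"
    using assms D(1,4,5) unfolding ac_hom_def by simp
qed simp

lemma exists_Gal_root_sign:
  fixes \<chi> :: "'p padic \<Rightarrow> bool"
  assumes "sign_character \<chi>"
  shows "\<exists>\<sigma>\<in>carrier (Gal M). \<forall>s\<in>ac_square_roots. \<sigma> s = root_sign \<chi> s * s"
proof -
  have "realizes_characters M"
    using padic_norm_pairing(1) kummer_field_tower(2) by blast
  then obtain \<sigma> where \<sigma>: "ac_hom M \<sigma>" "\<And>s. s \<in> ac_square_roots \<inter> M \<Longrightarrow> \<sigma> s = root_sign \<chi> s * s"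
    using assms unfolding realizes_characters_def by blast
  have "restrict \<sigma> M s = root_sign \<chi> s * s" if "s \<in> ac_square_roots" for s
    using \<sigma>(2) that kummer_field_root[OF that] by simp
  then show ?thesis using restrict_M_Gal[OF \<sigma>(1)] by blast
qed

lemma Gal_M_eqI:
  assumes "\<sigma> \<in> carrier (Gal M)" "\<tau> \<in> carrier (Gal M)"
    "\<And>s. s \<in> ac_square_roots \<Longrightarrow> \<sigma> s = \<tau> s"
  shows "\<sigma> = \<tau>"
proof (rule extensionalityI[of _ M])
  have hom: "ac_hom M \<sigma>" "ac_hom M \<tau>" using assms(1,2) by (simp_all add: M_Gal_iff)
  show "\<sigma> x = \<tau> x" if "x \<in> M" for x
    by (rule ac_hom_kummer_eqI[OF M_subfield order.refl hom _ that]) (rule assms(3))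
qed (use assms(1,2) in \<open>simp_all add: M_Gal_iff\<close>)

text \<open>The square c of \<open>s\<close> is not a square in the base, so by non-degeneracy c is
  not a norm for some d; the character "is a norm for d" then takes the value -1 at c.\<close>

lemma exists_Gal_moving_root:
  assumes "s \<in> ac_square_roots" "s \<notin> range (to_ac :: 'p padic \<Rightarrow> _)"
  shows "\<exists>\<sigma>\<in>carrier (Gal M). \<exists>\<chi>. sign_character \<chi> \<and> root_sign \<chi> s = - 1 \<and>
     (\<forall>s\<in>ac_square_roots. \<sigma> s = root_sign \<chi> s * s)"
proof -
  have "s \<noteq> 0" using assms(2) by (metis rangeI to_ac_0)
  obtain c where c: "s\<^sup>2 = to_ac c" "c \<noteq> 0" by (rule ac_square_rootsE[OF assms(1) \<open>s \<noteq> 0\<close>])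
  have "\<nexists>r. c = r\<^sup>2"
  proof
    assume "\<exists>r. c = r\<^sup>2"
    then obtain r where "s\<^sup>2 = (to_ac r)\<^sup>2" using c(1) by auto
    then have "s = to_ac r \<or> s = to_ac (- r)" by (simp add: power2_eq_iff)
    with assms(2) show False by blast
  qed
  then obtain d where d: "d \<noteq> 0" "\<not> norm_rep c d" using padic_norm_pairing(3)[OF c(2)] by blast
  have chi: "sign_character (\<lambda>a. norm_rep a d)" by (rule sign_character_norm_rep[OF padic_norm_pairing(2)[OF d(1)]])
  have "root_sign (\<lambda>a. norm_rep a d) s = - 1" using root_sign_eq[OF c(1)] d(2) by simp
  then show ?thesis using exists_Gal_root_sign[OF chi] chi by blast
qed

text \<open>If \<sigma> fixes x, then 2 x = x + \<sigma> x, and in this sum the roots of sign -1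
  cancel. As long as a summand lies outside the base, a \<sigma> that moves it shortens the
  list.\<close>

lemma M_fixed_field:
  assumes "x \<in> M" "\<And>\<sigma>. \<sigma> \<in> carrier (Gal M) \<Longrightarrow> \<sigma> x = x"
  shows "x \<in> range to_ac"
proof -
  have "sum_list xs \<in> range (to_ac :: 'p padic \<Rightarrow> _)"
    if "set xs \<subseteq> ac_square_roots" "\<And>\<sigma>. \<sigma> \<in> carrier (Gal M) \<Longrightarrow> \<sigma> (sum_list xs) = sum_list xs" for xs
    using that
  proof (induction "length xs" arbitrary: xs rule: less_induct)
    case less
    show ?case
    proof (cases "set xs \<subseteq> range (to_ac :: 'p padic \<Rightarrow> _)")
      case True
      then show ?thesis
      proof (induction xs)
        case Nil
        show ?case by (simp add: image_iff exI[of _ 0])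
      next
        case (Cons a xs)
        then obtain u v where "a = to_ac u" "sum_list xs = to_ac v" by auto
        then have "sum_list (a # xs) = to_ac (u + v)" by simp
        then show ?case by blast
      qed
    next
      case False
      then obtain s where s: "s \<in> set xs" "s \<notin> range (to_ac :: 'p padic \<Rightarrow> _)" by blast
      then have sS: "s \<in> ac_square_roots" using less.prems(1) by blast
      obtain \<sigma> \<chi> where \<sigma>: "\<sigma> \<in> carrier (Gal M)" "root_sign \<chi> s = - 1"
        "\<And>s. s \<in> ac_square_roots \<Longrightarrow> \<sigma> s = root_sign \<chi> s * s"
        using exists_Gal_moving_root[OF sS s(2)] by blast
      have hom: "ac_hom M \<sigma>" using \<sigma>(1) by (simp add: M_Gal_iff)
      define ys where "ys = filter (\<lambda>s. root_sign \<chi> s = 1) xs"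
      have fin: "sum_list zs \<in> M \<and> sum_list zs + \<sigma> (sum_list zs) = 2 * sum_list (filter (\<lambda>s. root_sign \<chi> s = 1) zs)"
        if "set zs \<subseteq> ac_square_roots" for zs
        using that
      proof (induction zs)
        case Nil
        then show ?case using ac_homD(5)[OF hom] ac_subfieldD(2)[OF M_subfield] by simp
      next
        case (Cons z zs)
        have z: "z \<in> ac_square_roots" "z \<in> M" using Cons.prems kummer_field_root by auto
        have IH: "sum_list zs \<in> M" "\<sigma> (sum_list zs) = 2 * sum_list (filter (\<lambda>s. root_sign \<chi> s = 1) zs) - sum_list zs"
          using Cons by (auto simp: algebra_simps)
        have "\<sigma> (z + sum_list zs) = root_sign \<chi> z * z + \<sigma> (sum_list zs)"
          using ac_homD(2)[OF hom z(2) IH(1)] \<sigma>(3)[OF z(1)] by simp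
        then show ?case
          using root_sign_cases[of \<chi> z] IH kummer_field_add[OF z(2) IH(1)] by auto
      qed
      have "2 * sum_list xs = 2 * sum_list ys"
        using fin[OF less.prems(1)] less.prems(2)[OF \<sigma>(1)] by (simp add: ys_def)
      then have eq: "sum_list xs = sum_list ys" by simp
      have "length ys < length xs"
        unfolding ys_def by (rule length_filter_less[OF s(1)]) (simp add: \<sigma>(2))
      moreover have "set ys \<subseteq> ac_square_roots" using less.prems(1) by (auto simp: ys_def)
      ultimately have "sum_list ys \<in> range (to_ac :: 'p padic \<Rightarrow> _)"
        using less.hyps[of ys] less.prems(2) eq by simp
      then show ?thesis by (simp only: eq)
    qed
  qed
  then show ?thesis using assms unfolding kummer_field_def by blast
qed

lemma compose_M_Gal:
  assumes "\<sigma> \<in> carrier (Gal M)" "\<tau> \<in> carrier (Gal M)"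
  shows "compose M \<sigma> \<tau> \<in> carrier (Gal M)"
proof -
  have \<sigma>: "ac_hom M \<sigma>" and \<tau>: "ac_hom M \<tau>" using assms by (simp_all add: M_Gal_iff)
  have "ac_hom M (\<lambda>x. \<sigma> (\<tau> x))"
    using ac_homD[OF \<sigma>] ac_homD[OF \<tau>] unfolding ac_hom_def by simp
  from restrict_M_Gal[OF this] show ?thesis by (simp add: compose_def)
qed

lemma id_M_Gal: "(\<lambda>x\<in>M. x) \<in> carrier (Gal M)"
  by (rule restrict_M_Gal) (simp add: ac_hom_def ac_subfieldD(4,5)[OF M_subfield])

lemma M_Gal_root:
  assumes "\<sigma> \<in> carrier (Gal M)" "s \<in> ac_square_roots"
  shows "\<sigma> s = s \<or> \<sigma> s = - s"
  using ac_hom_root[OF M_subfield _ assms(2) kummer_field_root[OF assms(2)]] assms(1) by (simp add: M_Gal_iff)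

lemma M_Gal_uminus_root:
  assumes "\<sigma> \<in> carrier (Gal M)" "s \<in> ac_square_roots"
  shows "\<sigma> (- s) = - \<sigma> s"
  using ac_hom_uminus[OF M_subfield _ kummer_field_root[OF assms(2)]] assms(1) by (simp add: M_Gal_iff)

lemma compose_M_Gal_self:
  assumes "\<sigma> \<in> carrier (Gal M)"
  shows "compose M \<sigma> \<sigma> = (\<lambda>x\<in>M. x)"
  using M_hom_involution assms by (auto simp: M_Gal_iff compose_def fun_eq_iff)

text \<open>On every square root both automorphisms act by a sign, and signs commute.\<close>

lemma M_Gal_commute:
  assumes "\<sigma> \<in> carrier (Gal M)" "\<tau> \<in> carrier (Gal M)"
  shows "compose M \<sigma> \<tau> = compose M \<tau> \<sigma>"
proof (rule Gal_M_eqI[OF compose_M_Gal[OF assms] compose_M_Gal[OF assms(2,1)]])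
  fix s :: "'p padic alg_closure" assume s: "s \<in> ac_square_roots"
  show "compose M \<sigma> \<tau> s = compose M \<tau> \<sigma> s"
    using M_Gal_root[OF assms(1) s] M_Gal_root[OF assms(2) s] M_Gal_uminus_root[OF assms(1) s]
      M_Gal_uminus_root[OF assms(2) s] kummer_field_root[OF s]
    by (auto simp: compose_eq)
qed

lemma comm_group_Gal_M: "comm_group (Gal M)"
proof (rule comm_groupI)
  fix x y z assume xyz: "x \<in> carrier (Gal M)" "y \<in> carrier (Gal M)" "z \<in> carrier (Gal M)"
  have "compose M (compose M x y) z = compose M x (compose M y z)"
    by (rule compose_assoc[symmetric]) (use xyz(3) in \<open>auto simp: M_Gal_iff dest: bij_betw_imp_funcset\<close>)
  then show "x \<otimes>\<^bsub>Gal M\<^esub> y \<otimes>\<^bsub>Gal M\<^esub> z = x \<otimes>\<^bsub>Gal M\<^esub> (y \<otimes>\<^bsub>Gal M\<^esub> z)"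
    by (simp add: Gal_mult compose_M_Gal xyz)
next
  fix x assume x: "x \<in> carrier (Gal M)"
  show "\<one>\<^bsub>Gal M\<^esub> \<otimes>\<^bsub>Gal M\<^esub> x = x"
    unfolding Gal_one Gal_mult[OF id_M_Gal x]
    by (rule Id_compose) (use x in \<open>auto simp: M_Gal_iff dest: bij_betw_imp_funcset\<close>)
  show "\<exists>y\<in>carrier (Gal M). y \<otimes>\<^bsub>Gal M\<^esub> x = \<one>\<^bsub>Gal M\<^esub>"
    using x compose_M_Gal_self[OF x] by (auto simp: Gal_mult Gal_one)
qed (simp_all add: Gal_mult Gal_one compose_M_Gal id_M_Gal M_Gal_commute)

lemma abelian_extension_M: "abelian_extension_exp2 M"
proof -
  have "{x \<in> M. \<forall>\<sigma>\<in>carrier (Gal M). \<sigma> x = x} = padic_base"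
  proof
    show "{x \<in> M. \<forall>\<sigma>\<in>carrier (Gal M). \<sigma> x = x} \<subseteq> padic_base"
      unfolding padic_base_def using M_fixed_field by blast
    show "padic_base \<subseteq> {x \<in> M. \<forall>\<sigma>\<in>carrier (Gal M). \<sigma> x = x}"
      unfolding padic_base_def using M_base by (auto simp: M_Gal_iff ac_homD(4))
  qed
  then have "galois_extension M"
    unfolding galois_extension_def padic_extension_iff using M_subfield by simp
  moreover have "\<sigma> [^]\<^bsub>Gal M\<^esub> (2 :: nat) = \<one>\<^bsub>Gal M\<^esub>" if \<sigma>: "\<sigma> \<in> carrier (Gal M)" for \<sigma>
  proof -
    interpret comm_group "Gal M" by (rule comm_group_Gal_M)
    have "\<sigma> [^]\<^bsub>Gal M\<^esub> (2 :: nat) = \<sigma> \<otimes>\<^bsub>Gal M\<^esub> \<sigma>"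
      using \<sigma> by (simp add: numeral_2_eq_2)
    then show ?thesis using compose_M_Gal_self[OF \<sigma>] \<sigma> by (simp add: Gal_mult Gal_one)
  qed
  ultimately show ?thesis unfolding abelian_extension_exp2_def using comm_group_Gal_M by blast
qed

end

section \<open>Maximality of the Kummer field\<close>

lemma ac_hom_poly:
  assumes "ac_subfield F" "ac_hom F \<sigma>" "x \<in> F"
  shows "poly (map_poly to_ac p) x \<in> F \<and> poly (map_poly to_ac p) (\<sigma> x) = \<sigma> (poly (map_poly to_ac p) x)"
proof (induction p)
  case 0
  show ?case using ac_subfieldD(2)[OF assms(1)] ac_homD(5)[OF assms(2)] by simp
next
  case (pCons a p)
  note D = ac_subfieldD[OF assms(1)] and H = ac_homD[OF assms(2)]
  have "map_poly to_ac (pCons a p) = pCons (to_ac a) (map_poly to_ac p)"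
    using pCons(1) by (simp add: map_poly_pCons)
  moreover have "to_ac a \<in> F" "x * poly (map_poly to_ac p) x \<in> F"
    using D(1,5) assms(3) pCons by blast+
  ultimately show ?case
    using pCons assms(3) D(4) by (simp add: H)
qed

text \<open>With \<open>e = 1\<close> and \<open>e = - 1\<close>, the elements \<open>x + e \<sigma> x\<close> have half sum \<open>x\<close>, and their squares
  have fewer conjugates than \<open>x\<^sup>2\<close>, because \<open>x\<^sup>2\<close> and \<open>\<sigma> x\<^sup>2\<close> are sent to the same square.\<close>

lemma card_conjugates_square_less:
  fixes F :: "'a :: field alg_closure set" and G :: "('a alg_closure \<Rightarrow> 'a alg_closure) set"
  assumes F: "ac_subfield F" and G: "\<And>\<tau>. \<tau> \<in> G \<Longrightarrow> ac_hom F \<tau>"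
    and comm: "\<And>\<tau> x. \<tau> \<in> G \<Longrightarrow> x \<in> F \<Longrightarrow> \<sigma> (\<tau> x) = \<tau> (\<sigma> x)"
    and \<sigma>: "\<sigma> \<in> G" "\<And>x. x \<in> F \<Longrightarrow> \<sigma> (\<sigma> x) = x" and id: "\<iota> \<in> G" "\<And>x. x \<in> F \<Longrightarrow> \<iota> x = x"
    and x: "x \<in> F" "\<sigma> (x\<^sup>2) \<noteq> x\<^sup>2" and e: "e = 1 \<or> e = - 1"
    and fin: "finite ((\<lambda>\<tau>. \<tau> (x\<^sup>2)) ` G)"
  shows "card ((\<lambda>\<tau>. \<tau> ((x + e * \<sigma> x)\<^sup>2)) ` G) < card ((\<lambda>\<tau>. \<tau> (x\<^sup>2)) ` G)"
proof -
  note D = ac_subfieldD[OF F]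
  have sq: "\<tau> (y\<^sup>2) = (\<tau> y)\<^sup>2" if "\<tau> \<in> G" "y \<in> F" for \<tau> y
    using ac_homD(3)[OF G[OF that(1)] that(2,2)] by (simp add: power2_eq_square)
  have eh: "\<tau> (e * y) = e * \<tau> y" "e * y \<in> F" if "\<tau> \<in> G" "y \<in> F" for \<tau> y
    using e ac_hom_uminus[OF F G[OF that(1)] that(2)] that(2) D(7) by auto
  define A where "A = (\<lambda>\<tau>. \<tau> (x\<^sup>2)) ` G"
  \<comment> \<open>A map from the conjugates of x^2 onto those of (x + e \<sigma> x)^2. The chosen
    root \<open>v\<close> of \<open>w\<close> is determined up to sign, and the value does not
    depend on that sign.\<close>
  define g where "g = (\<lambda>w. (let v = SOME v. v \<in> F \<and> v\<^sup>2 = w in (v + e * \<sigma> v)\<^sup>2))"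
  have g: "g (v\<^sup>2) = (v + e * \<sigma> v)\<^sup>2" if "v \<in> F" for v
  proof -
    define u where "u = (SOME u. u \<in> F \<and> u\<^sup>2 = v\<^sup>2)"
    have "u \<in> F \<and> u\<^sup>2 = v\<^sup>2" unfolding u_def by (rule someI[of _ v]) (simp add: that)
    then have "u = v \<or> u = - v" by (simp add: power2_eq_iff)
    moreover have "\<sigma> (- v) = - \<sigma> v" by (rule ac_hom_uminus[OF F G[OF \<sigma>(1)] that])
    moreover have "(- v + e * - \<sigma> v)\<^sup>2 = (v + e * \<sigma> v)\<^sup>2" by (simp add: power2_eq_square algebra_simps)
    ultimately have "(u + e * \<sigma> u)\<^sup>2 = (v + e * \<sigma> v)\<^sup>2" by auto
    then show ?thesis unfolding g_def Let_def u_def .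
  qed
  define y where "y = x + e * \<sigma> x"
  have \<sigma>x: "\<sigma> x \<in> F" using ac_homD(1)[OF G[OF \<sigma>(1)] x(1)] .
  have yF: "y \<in> F" unfolding y_def using D(4)[OF x(1) eh(2)[OF \<sigma>(1) \<sigma>x]] .
  have gt: "g (\<tau> (x\<^sup>2)) = \<tau> (y\<^sup>2)" if "\<tau> \<in> G" for \<tau>
  proof -
    have "g (\<tau> (x\<^sup>2)) = (\<tau> x + e * \<sigma> (\<tau> x))\<^sup>2"
      unfolding sq[OF that x(1)] using ac_homD(1)[OF G[OF that] x(1)] by (rule g)
    also have "\<tau> x + e * \<sigma> (\<tau> x) = \<tau> y"
      unfolding y_def ac_homD(2)[OF G[OF that] x(1) eh(2)[OF \<sigma>(1) \<sigma>x]] eh(1)[OF that \<sigma>x]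
        comm[OF that x(1)] ..
    finally show ?thesis unfolding sq[OF that yF] .
  qed
  have "(\<lambda>\<tau>. \<tau> (y\<^sup>2)) ` G = g ` A"
    unfolding A_def image_image using gt by (intro image_cong) auto
  \<comment> \<open>\<open>g\<close> takes the same value at x^2 and at \<sigma> (x^2), so dropping
    x^2 from its domain loses nothing.\<close>
  moreover have "g ` A \<subseteq> g ` (A - {x\<^sup>2})"
  proof
    fix w assume "w \<in> g ` A"
    then obtain v where v: "v \<in> A" "w = g v" by blast
    show "w \<in> g ` (A - {x\<^sup>2})"
    proof (cases "v = x\<^sup>2")
      case True
      have "g (\<sigma> (x\<^sup>2)) = (\<sigma> x + e * x)\<^sup>2"
        unfolding sq[OF \<sigma>(1) x(1)] g[OF \<sigma>x] \<sigma>(2)[OF x(1)] ..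
      also have "\<dots> = (x + e * \<sigma> x)\<^sup>2" using e by (auto simp: power2_eq_square algebra_simps)
      also have "\<dots> = w" unfolding v(2) True using g[OF x(1)] by simp
      finally have "g (\<sigma> (x\<^sup>2)) = w" .
      moreover have "\<sigma> (x\<^sup>2) \<in> A - {x\<^sup>2}" unfolding A_def using \<sigma>(1) x(2) by blast
      ultimately show ?thesis by blast
    qed (use v in blast)
  qed
  moreover have finA: "finite A" using fin by (simp add: A_def)
  moreover have "x\<^sup>2 \<in> A" unfolding A_def using id D(10)[OF x(1)] by (intro image_eqI[of _ _ \<iota>]) simp_all
  ultimately have "card ((\<lambda>\<tau>. \<tau> (y\<^sup>2)) ` G) \<le> card (A - {x\<^sup>2})"
    by (metis card_image_le card_mono finite_Diff finite_imageI le_trans)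
  also have "\<dots> < card A" using finA \<open>x\<^sup>2 \<in> A\<close> by (rule card_Diff1_less)
  finally show ?thesis by (simp add: A_def y_def)
qed

text \<open>The induction counts conjugates of x^2 and not of x, because it ends when x^2 is fixed:
  then x^2 lies in the base and x is itself a square root.\<close>

lemma abelian_extension_exp2_subset:
  fixes F :: "'p :: prime_card padic alg_closure set"
  assumes "abelian_extension_exp2 F"
  shows "F \<subseteq> kummer_field"
proof
  define G where "G = carrier (Gal F)"
  have F: "ac_subfield F" and fixed: "{x \<in> F. \<forall>\<sigma>\<in>G. \<sigma> x = x} = range to_ac"
    and cg: "comm_group (Gal F)" and sq: "\<And>\<sigma>. \<sigma> \<in> G \<Longrightarrow> \<sigma> [^]\<^bsub>Gal F\<^esub> (2 :: nat) = \<one>\<^bsub>Gal F\<^esub>"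
    using assms unfolding abelian_extension_exp2_def galois_extension_def padic_extension_iff
      padic_base_def G_def by auto
  interpret comm_group "Gal F" by (rule cg)
  have base: "range to_ac \<subseteq> F" using ac_subfieldD(1)[OF F] by blast
  have G: "ac_hom F \<tau>" if "\<tau> \<in> G" for \<tau> using that Gal_carrier_iff[OF base] by (simp add: G_def)
  have id: "(\<lambda>x\<in>F. x) \<in> G" unfolding G_def Gal_one[symmetric] by (rule one_closed)
  have comm: "\<sigma> (\<tau> x) = \<tau> (\<sigma> x)" if "\<sigma> \<in> G" "\<tau> \<in> G" "x \<in> F" for \<sigma> \<tau> x
  proof -
    have "compose F \<sigma> \<tau> = compose F \<tau> \<sigma>"
      using m_comm[of \<sigma> \<tau>] that(1,2) by (simp add: G_def Gal_mult)
    from fun_cong[OF this, of x] show ?thesis using that(3) by (simp add: compose_eq)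
  qed
  have inv: "\<sigma> (\<sigma> x) = x" if "\<sigma> \<in> G" "x \<in> F" for \<sigma> x
  proof -
    have "\<sigma> \<otimes>\<^bsub>Gal F\<^esub> \<sigma> = \<one>\<^bsub>Gal F\<^esub>" using sq[OF that(1)] that(1) by (simp add: numeral_2_eq_2 G_def)
    then have "compose F \<sigma> \<sigma> = (\<lambda>x\<in>F. x)" using that(1) by (simp add: G_def Gal_mult Gal_one)
    from fun_cong[OF this, of x] show ?thesis using that(2) by (simp add: compose_eq)
  qed
  \<comment> \<open>All conjugates of x are roots of one non-zero polynomial over the base.\<close>
  have fin: "finite ((\<lambda>\<tau>. \<tau> x) ` G)" if "x \<in> F" for x
  proof -
    obtain p where p: "p \<noteq> 0" "poly (map_poly to_ac p) x = 0" by (rule alg_closure_algebraic)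
    have "map_poly to_ac p \<noteq> 0" using p(1) by (simp add: map_poly_eq_0_iff)
    then have "finite {y. poly (map_poly to_ac p) y = 0}" by (rule poly_roots_finite)
    moreover have "(\<lambda>\<tau>. \<tau> x) ` G \<subseteq> {y. poly (map_poly to_ac p) y = 0}"
      using ac_hom_poly[OF F G that, of _ p] p(2) ac_homD(5)[OF G] by auto
    ultimately show ?thesis by (rule rev_finite_subset)
  qed
  fix x assume "x \<in> F"
  then show "x \<in> kummer_field"
  proof (induction "card ((\<lambda>\<tau>. \<tau> (x\<^sup>2)) ` G)" arbitrary: x rule: less_induct)
    case less
    note D = ac_subfieldD[OF F]
    have x2: "x\<^sup>2 \<in> F" using D(10)[OF less.prems] .
    show ?case
    proof (cases "\<forall>\<sigma>\<in>G. \<sigma> (x\<^sup>2) = x\<^sup>2")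
      case True
      then have "x\<^sup>2 \<in> range to_ac" using x2 fixed by blast
      then show ?thesis by (intro kummer_field_root) (simp add: ac_square_roots_def)
    next
      case False
      then obtain \<sigma> where \<sigma>: "\<sigma> \<in> G" "\<sigma> (x\<^sup>2) \<noteq> x\<^sup>2" by blast
      have \<sigma>x: "\<sigma> x \<in> F" using ac_homD(1)[OF G[OF \<sigma>(1)] less.prems] .
      have step: "x + e * \<sigma> x \<in> kummer_field" if e: "e = 1 \<or> e = - 1" for e
      proof (rule less.hyps)
        show "card ((\<lambda>\<tau>. \<tau> ((x + e * \<sigma> x)\<^sup>2)) ` G) < card ((\<lambda>\<tau>. \<tau> (x\<^sup>2)) ` G)"
          by (rule card_conjugates_square_less[OF F G comm[OF \<sigma>(1)] \<sigma>(1) inv[OF \<sigma>(1)] id _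
                less.prems \<sigma>(2) e fin[OF x2]]) simp_all
        show "x + e * \<sigma> x \<in> F" using e D(4)[OF less.prems \<sigma>x] D(8)[OF less.prems \<sigma>x] by auto
      qed
      have "x = to_ac (1 / 2) * ((x + 1 * \<sigma> x) + (x + (- 1) * \<sigma> x))" by simp
      moreover have "\<dots> \<in> kummer_field"
        by (intro kummer_field_root_mult kummer_field_add step ac_square_roots_to_ac) simp_all
      ultimately show ?thesis by simp
    qed
  qed
qed

lemma max_abelian_exp2_eq: "max_abelian_exp2 = kummer_field"
  unfolding max_abelian_exp2_def
  by (rule Greatest_equality, rule abelian_extension_M, rule abelian_extension_exp2_subset)

section \<open>Quadratic extensions and their norms\<close>

lemma range_to_ac_subfield: "ac_subfield (range to_ac :: 'a :: field_char_0 alg_closure set)"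
  using square_root_tower[of "{}"] unfolding ac_subfield_def
  by (auto simp flip: to_ac_add to_ac_mult to_ac_inverse)

lemma line_extension_adjoin_root:
  fixes F :: "'a :: field alg_closure set"
  shows "ring.line_extension ring_of_type_algebra K t F = {v + k * t | v k. v \<in> F \<and> k \<in> K}"
proof -
  interpret R: field "ring_of_type_algebra :: 'a alg_closure ring" by (rule field_from_type_algebra)
  show ?thesis
  proof (rule Set.set_eqI)
    fix x :: "'a alg_closure"
    show "x \<in> ring.line_extension ring_of_type_algebra K t F \<longleftrightarrow> x \<in> {v + k * t | v k. v \<in> F \<and> k \<in> K}"
      unfolding R.line_extension_mem_iff by (auto simp: ring_of_type_algebra_def add.commute)
  qed
qed

text \<open>Dimension is built up by line extensions from {0}: first by 1, then by \<open>t\<close>,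
  each lying outside the space reached so far.\<close>

lemma quadratic_extension_adjoin_root:
  assumes "t \<in> ac_square_roots" "t \<notin> range (to_ac :: 'p :: prime_card padic \<Rightarrow> _)"
  shows "quadratic_extension (adjoin_root (range to_ac) t)"
proof -
  interpret R: field "ring_of_type_algebra :: 'p padic alg_closure ring" by (rule field_from_type_algebra)
  let ?K = "range (to_ac :: 'p padic \<Rightarrow> _)"
  have c: "carrier (ring_of_type_algebra :: 'p padic alg_closure ring) = UNIV"
    "\<zero>\<^bsub>ring_of_type_algebra\<^esub> = (0 :: 'p padic alg_closure)"
    by (simp_all add: ring_of_type_algebra_def)
  have 0: "R.dimension 0 ?K {0}" using R.zero_dim[of ?K] by (simp only: c)
  have 1: "R.line_extension ?K 1 {0} = ?K"
    unfolding line_extension_adjoin_root by auto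
  have "R.dimension (Suc 0) ?K (R.line_extension ?K 1 {0})"
    by (rule R.Suc_dim) (simp_all add: c 0)
  then have "R.dimension (Suc 0) ?K ?K" by (simp only: 1)
  then have "R.dimension (Suc (Suc 0)) ?K (R.line_extension ?K t ?K)"
    by (intro R.Suc_dim) (simp_all add: c assms(2))
  moreover have "R.line_extension ?K t ?K = adjoin_root ?K t"
    unfolding line_extension_adjoin_root adjoin_root_def by blast
  ultimately show ?thesis
    using ac_subfield_adjoin_root[OF range_to_ac_subfield assms]
    by (simp add: quadratic_extension_def padic_extension_iff padic_base_def numeral_2_eq_2)
qed

text \<open>Dimension 2 supplies some basis w, v, but one containing 1 is wanted. Write 1 = l w + k
  v. If k = 0, then w lies in the base and v is kept; otherwise v is exchanged for 1 and w is
  kept.\<close>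

lemma quadratic_extension_basis:
  assumes "quadratic_extension (E :: 'p :: prime_card padic alg_closure set)"
  obtains u where "u \<notin> range to_ac" "E = adjoin_root (range to_ac) u"
proof -
  interpret R: field "ring_of_type_algebra :: 'p padic alg_closure ring" by (rule field_from_type_algebra)
  let ?K = "range (to_ac :: 'p padic \<Rightarrow> _)"
  note K = ac_subfieldD[OF range_to_ac_subfield[where 'a = "'p padic"]]
  have c: "\<zero>\<^bsub>ring_of_type_algebra\<^esub> = (0 :: 'p padic alg_closure)"
    by (simp add: ring_of_type_algebra_def)
  have dim: "R.dimension (Suc (Suc 0)) ?K E" and E: "ac_subfield E"
    using assms by (simp_all add: quadratic_extension_def padic_extension_iff padic_base_def numeral_2_eq_2)
  from dim obtain v E1 where v: "E = R.line_extension ?K v E1" "v \<notin> E1" "R.dimension (Suc 0) ?K E1"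
    by (cases rule: R.dimension.cases) auto
  from v(3) obtain w E0 where w: "E1 = R.line_extension ?K w E0" "w \<notin> E0" "R.dimension 0 ?K E0"
    by (cases rule: R.dimension.cases) auto
  from w(3) have E0: "E0 = {0}" by (cases rule: R.dimension.cases) (auto simp: c)
  have E1: "E1 = {k * w | k. k \<in> ?K}"
    unfolding w(1) line_extension_adjoin_root E0 by auto
  have w0: "w \<noteq> 0" using w(2) E0 by simp
  have Eeq: "E = {l * w + k * v | k l. k \<in> ?K \<and> l \<in> ?K}"
    unfolding v(1) line_extension_adjoin_root E1 by blast
  have "1 \<in> E" using ac_subfieldD(3)[OF E] .
  then obtain k l where kl: "1 = l * w + k * v" "k \<in> ?K" "l \<in> ?K" unfolding Eeq by blast
  show ?thesis
  proof (cases "k = 0")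
    case True
    then have lw: "l * w = 1" using kl(1) by simp
    then have "w = 1 / l" by (metis divide_eq_0_iff mult_zero_left nonzero_eq_divide_eq mult.commute zero_neq_one)
    then have wK: "w \<in> ?K" using K(9)[OF K(3) kl(3)] by simp
    have vK: "v \<notin> ?K"
    proof
      assume "v \<in> ?K"
      then have "v / w \<in> ?K" using K(9)[OF _ wK] by blast
      moreover have "v = v / w * w" using w0 by simp
      ultimately show False using v(2) unfolding E1 by blast
    qed
    have "E = adjoin_root ?K v"
      unfolding adjoin_root_def Eeq
    proof (intro Set.set_eqI iffI)
      fix x assume "x \<in> {l * w + k * v |k l. k \<in> ?K \<and> l \<in> ?K}"
      then show "x \<in> {a + b * v |a b. a \<in> ?K \<and> b \<in> ?K}" using wK K(5) by blast
    next
      fix x assume "x \<in> {a + b * v |a b. a \<in> ?K \<and> b \<in> ?K}"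
      then obtain a b where ab: "x = a + b * v" "a \<in> ?K" "b \<in> ?K" by blast
      then have "x = (a / w) * w + b * v" using w0 by simp
      moreover have "a / w \<in> ?K" using ab(2) wK by (rule K(9))
      ultimately show "x \<in> {l * w + k * v |k l. k \<in> ?K \<and> l \<in> ?K}" using ab(3) by blast
    qed
    with vK show ?thesis by (rule that)
  next
    case False
    then have veq: "v = (1 - l * w) / k" using kl(1) by (simp add: field_simps)
    have wK: "w \<notin> ?K"
    proof
      assume wK: "w \<in> ?K"
      have "v \<in> ?K" unfolding veq by (rule K(9)[OF K(8)[OF K(3) K(5)[OF kl(3) wK]] kl(2)])
      then have "v / w \<in> ?K" using K(9)[OF _ wK] by blast
      moreover have "v = v / w * w" using w0 by simp
      ultimately show False using v(2) unfolding E1 by blast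
    qed
    have "E = adjoin_root ?K w"
      unfolding adjoin_root_def Eeq
    proof (intro Set.set_eqI iffI)
      fix x assume "x \<in> {l * w + k * v |k l. k \<in> ?K \<and> l \<in> ?K}"
      then obtain b a where ab: "x = b * w + a * v" "a \<in> ?K" "b \<in> ?K" by blast
      have "x = a / k + (b - a / k * l) * w" unfolding ab(1) veq by (simp add: field_simps False)
      moreover have "a / k \<in> ?K" using ab(2) kl(2) by (rule K(9))
      moreover have "b - a / k * l \<in> ?K" by (rule K(8)[OF ab(3) K(5)[OF K(9)[OF ab(2) kl(2)] kl(3)]])
      ultimately show "x \<in> {a + b * w |a b. a \<in> ?K \<and> b \<in> ?K}" by blast
    next
      fix x assume "x \<in> {a + b * w |a b. a \<in> ?K \<and> b \<in> ?K}"
      then obtain a b where ab: "x = a + b * w" "a \<in> ?K" "b \<in> ?K" by blast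
      have "x = (b + a * l) * w + (a * k) * v" unfolding ab(1) veq by (simp add: field_simps False)
      moreover have "b + a * l \<in> ?K" by (rule K(4)[OF ab(3) K(5)[OF ab(2) kl(3)]])
      moreover have "a * k \<in> ?K" by (rule K(5)[OF ab(2) kl(2)])
      ultimately show "x \<in> {l * w + k * v |k l. k \<in> ?K \<and> l \<in> ?K}" by blast
    qed
    with wK show ?thesis by (rule that)
  qed
qed

text \<open>Completing the square in the quadratic equation satisfied by the basis element.\<close>

lemma quadratic_extensionE:
  assumes "quadratic_extension (E :: 'p :: prime_card padic alg_closure set)"
  obtains t where "t \<in> ac_square_roots" "t \<notin> range to_ac" "E = adjoin_root (range to_ac) t"
proof -
  let ?K = "range (to_ac :: 'p padic \<Rightarrow> _)"
  note K = ac_subfieldD[OF range_to_ac_subfield[where 'a = "'p padic"]]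
  obtain u where u: "u \<notin> ?K" "E = adjoin_root ?K u" using quadratic_extension_basis[OF assms] .
  have E: "ac_subfield E" using assms by (simp add: quadratic_extension_def padic_extension_iff)
  have "u \<in> E" unfolding u(2) by (rule adjoin_rootI[of 0 _ 1]) (use K in simp_all)
  then have "u\<^sup>2 \<in> E" by (rule ac_subfieldD(10)[OF E])
  then obtain a b where ab: "u\<^sup>2 = a + b * u" "a \<in> ?K" "b \<in> ?K" unfolding u(2) adjoin_root_def by blast
  define t where "t = u - b / 2"
  have "2 \<in> ?K" using K(1)[of 2] by simp
  then have b2: "b / 2 \<in> ?K" using K(9)[OF ab(3)] by blast
  have "t\<^sup>2 = u\<^sup>2 - b * u + (b / 2)\<^sup>2" by (simp add: t_def power2_eq_square field_simps)
  also have "\<dots> = a + (b / 2)\<^sup>2" by (simp add: ab(1))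
  finally have t2: "t\<^sup>2 \<in> ?K" using K(4)[OF ab(2) K(10)[OF b2]] by metis
  have tK: "t \<notin> ?K"
  proof
    assume "t \<in> ?K"
    then have "t + b / 2 \<in> ?K" using K(4) b2 by blast
    then show False using u(1) by (simp add: t_def)
  qed
  have "E = adjoin_root ?K t"
    unfolding u(2)
  proof (intro Set.set_eqI iffI)
    fix x assume "x \<in> adjoin_root ?K u"
    then obtain c d where cd: "x = c + d * u" "c \<in> ?K" "d \<in> ?K" unfolding adjoin_root_def by blast
    have "x = (c + d * (b / 2)) + d * t" unfolding cd(1) t_def by (simp add: algebra_simps)
    then show "x \<in> adjoin_root ?K t" by (rule adjoin_rootI[OF K(4)[OF cd(2) K(5)[OF cd(3) b2]] cd(3)])
  next
    fix x assume "x \<in> adjoin_root ?K t"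
    then obtain c d where cd: "x = c + d * t" "c \<in> ?K" "d \<in> ?K" unfolding adjoin_root_def by blast
    have "x = (c - d * (b / 2)) + d * u" unfolding cd(1) t_def by (simp add: algebra_simps)
    then show "x \<in> adjoin_root ?K u" by (rule adjoin_rootI[OF K(8)[OF cd(2) K(5)[OF cd(3) b2]] cd(3)])
  qed
  moreover have "t \<in> ac_square_roots" using t2 by (simp add: ac_square_roots_def)
  ultimately show ?thesis using that tK by blast
qed

lemma padic_embeddings_iff:
  fixes E :: "'p :: prime_card padic alg_closure set"
  assumes "ac_subfield E"
  shows "\<sigma> \<in> padic_embeddings E \<longleftrightarrow> \<sigma> \<in> extensional E \<and>
    (\<forall>x\<in>E. \<forall>y\<in>E. \<sigma> (x + y) = \<sigma> x + \<sigma> y \<and> \<sigma> (x * y) = \<sigma> x * \<sigma> y) \<and> (\<forall>k. \<sigma> (to_ac k) = to_ac k)"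
proof -
  have "(1 :: 'p padic alg_closure) = to_ac 1" by simp
  then have one: "\<sigma> 1 = 1" if "\<forall>k. \<sigma> (to_ac k) = to_ac k" using that by metis
  then show ?thesis
    unfolding padic_embeddings_def Ring.ring_hom_def ring_of_type_algebra_def padic_base_def by auto
qed

section \<open>Embeddings and norms of K(t), K the base field\<close>

context
  fixes t :: "'p :: prime_card padic alg_closure"
  assumes t: "t \<in> ac_square_roots" "t \<notin> range to_ac"
begin

lemma quadratic_subset_kummer_field: "adjoin_root (range to_ac) t \<subseteq> kummer_field"
proof
  fix x assume "x \<in> adjoin_root (range to_ac) t"
  then obtain a b where "x = to_ac a + to_ac b * t" unfolding adjoin_root_def by blast
  then show "x \<in> kummer_field"
    by (simp add: kummer_field_add kummer_field_root ac_square_roots_to_ac ac_square_roots_mult t(1))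
qed

lemma quadratic_subfield: "ac_subfield (adjoin_root (range to_ac) t)"
  by (rule ac_subfield_adjoin_root[OF range_to_ac_subfield t])

lemma quadratic_mem: "to_ac a + to_ac b * t \<in> adjoin_root (range to_ac) t"
  by (rule adjoin_rootI[of "to_ac a" _ "to_ac b"]) simp_all

lemma padic_embedding_apply:
  assumes "\<sigma> \<in> padic_embeddings (adjoin_root (range to_ac) t)"
  shows "\<sigma> (to_ac a + to_ac b * t) = to_ac a + to_ac b * \<sigma> t"
proof -
  let ?E = "adjoin_root (range to_ac) t"
  note D = ac_subfieldD[OF quadratic_subfield]
  have tE: "t \<in> ?E" using quadratic_mem[of 0 1] by simp
  have \<sigma>: "\<And>x y. x \<in> ?E \<Longrightarrow> y \<in> ?E \<Longrightarrow> \<sigma> (x + y) = \<sigma> x + \<sigma> y \<and> \<sigma> (x * y) = \<sigma> x * \<sigma> y"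
    "\<And>k. \<sigma> (to_ac k) = to_ac k"
    using assms unfolding padic_embeddings_iff[OF quadratic_subfield] by blast+
  have "\<sigma> (to_ac a + to_ac b * t) = \<sigma> (to_ac a) + \<sigma> (to_ac b * t)"
    using \<sigma>(1)[OF D(1) D(5)[OF D(1) tE]] by blast
  also have "\<sigma> (to_ac b * t) = \<sigma> (to_ac b) * \<sigma> t" using \<sigma>(1)[OF D(1) tE] by blast
  finally show ?thesis by (simp only: \<sigma>(2))
qed

lemma padic_embedding_root:
  assumes "\<sigma> \<in> padic_embeddings (adjoin_root (range to_ac) t)"
  shows "\<sigma> t = t \<or> \<sigma> t = - t"
proof -
  let ?E = "adjoin_root (range to_ac) t"
  have tE: "t \<in> ?E" using quadratic_mem[of 0 1] by simp
  obtain c where c: "t\<^sup>2 = to_ac c" using t(1) unfolding ac_square_roots_def by blast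
  have "\<sigma> t * \<sigma> t = \<sigma> (t * t)"
    using assms tE unfolding padic_embeddings_iff[OF quadratic_subfield] by simp
  also have "\<dots> = t * t"
    using assms c unfolding padic_embeddings_iff[OF quadratic_subfield] by (simp add: power2_eq_square)
  finally show ?thesis by (simp add: square_eq_iff)
qed

lemma padic_embedding_eqI:
  assumes "\<sigma> \<in> padic_embeddings (adjoin_root (range to_ac) t)"
    "\<tau> \<in> padic_embeddings (adjoin_root (range to_ac) t)" "\<sigma> t = \<tau> t"
  shows "\<sigma> = \<tau>"
proof (rule extensionalityI[of _ "adjoin_root (range to_ac) t"])
  show "\<sigma> \<in> extensional (adjoin_root (range to_ac) t)" "\<tau> \<in> extensional (adjoin_root (range to_ac) t)"
    using assms(1,2) by (simp_all add: padic_embeddings_def)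
  fix x assume "x \<in> adjoin_root (range to_ac) t"
  then obtain a b where x: "x = to_ac a + to_ac b * t" unfolding adjoin_root_def by blast
  show "\<sigma> x = \<tau> x"
    unfolding x padic_embedding_apply[OF assms(1)] padic_embedding_apply[OF assms(2)] assms(3) ..
qed

lemma restrict_padic_embedding:
  assumes "ac_hom kummer_field \<sigma>"
  shows "restrict \<sigma> (adjoin_root (range to_ac) t) \<in> padic_embeddings (adjoin_root (range to_ac) t)"
proof -
  note D = ac_subfieldD[OF quadratic_subfield]
  have "x \<in> kummer_field" if "x \<in> adjoin_root (range to_ac) t" for x
    using that quadratic_subset_kummer_field by blast
  then show ?thesis
    unfolding padic_embeddings_iff[OF quadratic_subfield] using D(1,4,5) ac_homD[OF assms] by simp
qed

text \<open>An embedding sends \<open>t\<close> to \<open>t\<close> or \<open>- t\<close>. Both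
  occur, the second as the restriction of an automorphism of \<open>kummer_field\<close> that moves
  \<open>t\<close>, so the norm is the product of two conjugates.\<close>

lemma padic_norm_quadratic:
  assumes c: "t\<^sup>2 = to_ac c"
  shows "padic_norm (adjoin_root (range to_ac) t) (to_ac a + to_ac b * t) = a\<^sup>2 - c * b\<^sup>2"
proof -
  let ?E = "adjoin_root (range to_ac) t"
  obtain \<sigma> \<chi> where \<sigma>: "\<sigma> \<in> carrier (Gal kummer_field)" "root_sign \<chi> t = - 1"
    "\<forall>s\<in>ac_square_roots. \<sigma> s = root_sign \<chi> s * s"
    using exists_Gal_moving_root[OF t] by blast
  have hom: "ac_hom kummer_field \<sigma>" using \<sigma>(1) by (simp add: M_Gal_iff)
  have st: "\<sigma> t = - t" using \<sigma>(2,3) t(1) by simp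
  have hid: "ac_hom (kummer_field :: 'p padic alg_closure set) (\<lambda>x. x)" by (simp add: ac_hom_def)
  have tE: "t \<in> ?E" using quadratic_mem[of 0 1] by simp
  define f g where "f = restrict (\<lambda>x. x) ?E" and "g = restrict \<sigma> ?E"
  have f: "f \<in> padic_embeddings ?E" "f t = t" and g: "g \<in> padic_embeddings ?E" "g t = - t"
    using restrict_padic_embedding[OF hid] restrict_padic_embedding[OF hom] tE st by (simp_all add: f_def g_def)
  have "t \<noteq> 0" using t(2) by (metis rangeI to_ac_0)
  then have fg: "f \<noteq> g" using f(2) g(2) by auto
  have "padic_embeddings ?E = {f, g}"
  proof (intro Set.set_eqI iffI)
    fix h assume h: "h \<in> padic_embeddings ?E"
    from padic_embedding_root[OF h] show "h \<in> {f, g}"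
    proof
      assume "h t = t"
      then have "h = f" by (intro padic_embedding_eqI[OF h f(1)]) (simp add: f(2))
      then show ?thesis by simp
    next
      assume "h t = - t"
      then have "h = g" by (intro padic_embedding_eqI[OF h g(1)]) (simp add: g(2))
      then show ?thesis by simp
    qed
  qed (use f g in auto)
  then have "padic_norm ?E (to_ac a + to_ac b * t) = of_ac (f (to_ac a + to_ac b * t) * g (to_ac a + to_ac b * t))"
    unfolding padic_norm_def using fg by simp
  also have "f (to_ac a + to_ac b * t) * g (to_ac a + to_ac b * t) = (to_ac a + to_ac b * t) * (to_ac a - to_ac b * t)"
    unfolding padic_embedding_apply[OF f(1)] padic_embedding_apply[OF g(1)] f(2) g(2) by simp
  also have "\<dots> = to_ac a ^ 2 - to_ac b ^ 2 * t ^ 2" by (simp add: power2_eq_square algebra_simps)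
  also have "\<dots> = to_ac (a\<^sup>2 - c * b\<^sup>2)" unfolding c by simp
  finally show ?thesis by (simp only: of_ac_to_ac)
qed

text \<open>Non-zero elements have non-zero norm: a zero of a^2 - c b^2 with b non-zero would make c
  a square and put \<open>t\<close> into the base.\<close>

lemma padic_norm_image:
  assumes c: "t\<^sup>2 = to_ac c"
  shows "padic_norm (adjoin_root (range to_ac) t) ` (adjoin_root (range to_ac) t - {0}) = {a. a \<noteq> 0 \<and> norm_rep a c}"
proof (intro Set.set_eqI iffI)
  let ?E = "adjoin_root (range to_ac) t"
  fix y assume "y \<in> padic_norm ?E ` (?E - {0})"
  then obtain x where x: "x \<in> ?E" "x \<noteq> 0" "y = padic_norm ?E x" by blast
  obtain a b where ab: "x = to_ac a + to_ac b * t" using x(1) unfolding adjoin_root_def by blast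
  have y: "y = a\<^sup>2 - c * b\<^sup>2" unfolding x(3) ab by (rule padic_norm_quadratic[OF c])
  have "y \<noteq> 0"
  proof
    assume "y = 0"
    then have eq: "a\<^sup>2 = c * b\<^sup>2" using y by simp
    show False
    proof (cases "b = 0")
      case True
      then have "a = 0" using eq by simp
      then show False using x(2) ab True by simp
    next
      case False
      then have "c = (a / b)\<^sup>2" using eq by (simp add: power_divide field_simps)
      then have "t\<^sup>2 = (to_ac (a / b))\<^sup>2" using c by (simp only: to_ac_power)
      then have "t = to_ac (a / b) \<or> t = to_ac (- (a / b))" unfolding to_ac_minus power2_eq_iff .
      then show False using t(2) by blast
    qed
  qed
  moreover have "norm_rep y c" using y by (rule norm_repI)
  ultimately show "y \<in> {a. a \<noteq> 0 \<and> norm_rep a c}" by simp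
next
  let ?E = "adjoin_root (range to_ac) t"
  fix y assume "y \<in> {a. a \<noteq> 0 \<and> norm_rep a c}"
  then obtain a b where ab: "y \<noteq> 0" "y = a\<^sup>2 - c * b\<^sup>2" unfolding norm_rep_def by blast
  let ?x = "to_ac a + to_ac b * t"
  have N: "padic_norm ?E ?x = y" unfolding ab(2) by (rule padic_norm_quadratic[OF c])
  have "?x \<noteq> 0"
  proof
    assume "?x = 0"
    moreover have "padic_norm ?E (to_ac 0 + to_ac 0 * t) = 0\<^sup>2 - c * 0\<^sup>2" by (rule padic_norm_quadratic[OF c])
    ultimately show False using N ab(1) by simp
  qed
  then show "y \<in> padic_norm ?E ` (?E - {0})" using N quadratic_mem[of a b] by (intro image_eqI[of _ _ ?x]) simp_all
qed

end

section \<open>The reciprocity isomorphism\<close>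

lemma padic_mult_group_simps [simp]:
  "carrier padic_mult_group = UNIV - {0}"
  "x \<otimes>\<^bsub>padic_mult_group\<^esub> y = x * y"
  "\<one>\<^bsub>padic_mult_group\<^esub> = 1"
  by (simp_all add: padic_mult_group_def ring_of_type_algebra_def)

lemma comm_group_padic_mult_group: "comm_group (padic_mult_group :: 'p :: prime_card padic monoid)"
proof (rule comm_groupI)
  fix x :: "'p padic" assume "x \<in> carrier padic_mult_group"
  then show "\<exists>y\<in>carrier padic_mult_group. y \<otimes>\<^bsub>padic_mult_group\<^esub> x = \<one>\<^bsub>padic_mult_group\<^esub>"
    by (intro bexI[of _ "inverse x"]) simp_all
qed (simp_all add: mult_ac)

lemma padic_squares_eq: "padic_squares = {s\<^sup>2 | s :: 'p :: prime_card padic. s \<noteq> 0}"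
proof -
  interpret G: comm_group "padic_mult_group :: 'p padic monoid" by (rule comm_group_padic_mult_group)
  have pow: "x [^]\<^bsub>padic_mult_group\<^esub> (2 :: nat) = x\<^sup>2" for x :: "'p padic"
    unfolding numeral_2_eq_2 G.nat_pow_Suc G.nat_pow_0 by (simp add: power_Suc)
  show ?thesis unfolding padic_squares_def pow by simp
qed

lemma padic_squaresI: "x = s\<^sup>2 \<Longrightarrow> s \<noteq> 0 \<Longrightarrow> x \<in> padic_squares"
  unfolding padic_squares_eq mem_Collect_eq by (rule exI[of _ s], rule conjI)

lemma padic_squaresE:
  assumes "x \<in> padic_squares"
  obtains s where "x = s\<^sup>2" "s \<noteq> 0"
  using assms unfolding padic_squares_eq mem_Collect_eq by (elim exE conjE)

lemma normal_padic_squares: "padic_squares \<lhd> (padic_mult_group :: 'p :: prime_card padic monoid)"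
proof -
  interpret G: comm_group "padic_mult_group :: 'p padic monoid" by (rule comm_group_padic_mult_group)
  have "subgroup padic_squares (padic_mult_group :: 'p padic monoid)"
  proof (rule G.subgroupI)
    show "padic_squares \<subseteq> carrier (padic_mult_group :: 'p padic monoid)"
      by (rule subsetI, erule padic_squaresE) simp
    have "(1 :: 'p padic) \<in> padic_squares" by (rule padic_squaresI[of _ 1]) simp_all
    then show "padic_squares \<noteq> ({} :: 'p padic set)" by auto
  next
    fix a :: "'p padic" assume "a \<in> padic_squares"
    then obtain s where s: "a = s\<^sup>2" "s \<noteq> 0" by (rule padic_squaresE)
    have "inv\<^bsub>padic_mult_group\<^esub> a = (inverse s)\<^sup>2"
    proof (rule G.inv_equality)
      have "(inverse s)\<^sup>2 * s\<^sup>2 = (inverse s * s)\<^sup>2" by (rule power_mult_distrib[symmetric])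
      then show "(inverse s)\<^sup>2 \<otimes>\<^bsub>padic_mult_group\<^esub> a = \<one>\<^bsub>padic_mult_group\<^esub>" using s by simp
    qed (use s(2) in \<open>simp_all add: s(1)\<close>)
    then show "inv\<^bsub>padic_mult_group\<^esub> a \<in> padic_squares" by (rule padic_squaresI) (simp add: s(2))
  next
    fix a b :: "'p padic" assume a: "a \<in> padic_squares" and b: "b \<in> padic_squares"
    obtain s where s: "a = s\<^sup>2" "s \<noteq> 0" using a by (rule padic_squaresE)
    obtain r where r: "b = r\<^sup>2" "r \<noteq> 0" using b by (rule padic_squaresE)
    have "a \<otimes>\<^bsub>padic_mult_group\<^esub> b = (s * r)\<^sup>2" unfolding s(1) r(1) by (simp add: power_mult_distrib)
    then show "a \<otimes>\<^bsub>padic_mult_group\<^esub> b \<in> padic_squares" by (rule padic_squaresI) (simp add: s r)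
  qed
  then show ?thesis by (rule G.subgroup_imp_normal)
qed

definition square_class :: "'p :: prime_card padic \<Rightarrow> 'p padic set" where
  "square_class a = padic_squares #>\<^bsub>padic_mult_group\<^esub> a"

lemma square_class_eq: "square_class a = {a * s\<^sup>2 | s. s \<noteq> 0}"
  unfolding square_class_def r_coset_def padic_squares_eq padic_mult_group_simps mult.commute[of _ a]
  by blast

lemma square_classI: "x = a * s\<^sup>2 \<Longrightarrow> s \<noteq> 0 \<Longrightarrow> x \<in> square_class a"
  unfolding square_class_eq mem_Collect_eq by (rule exI[of _ s], rule conjI)

lemma square_classE:
  assumes "x \<in> square_class a"
  obtains s where "x = a * s\<^sup>2" "s \<noteq> 0"
  using assms unfolding square_class_eq mem_Collect_eq by (elim exE conjE)

lemma square_class_eqD: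
  assumes "square_class a = square_class b"
  shows "\<exists>s. s \<noteq> 0 \<and> b = a * s\<^sup>2"
proof -
  have "b \<in> square_class b" by (rule square_classI[of _ _ 1]) simp_all
  then have "b \<in> square_class a" by (simp only: assms)
  then show ?thesis unfolding square_class_eq by blast
qed

lemma square_class_mult_square:
  assumes "s \<noteq> 0"
  shows "square_class (a * s\<^sup>2) = square_class a"
proof (intro Set.set_eqI iffI)
  fix x assume "x \<in> square_class (a * s\<^sup>2)"
  then obtain r where r: "x = a * s\<^sup>2 * r\<^sup>2" "r \<noteq> 0" by (rule square_classE)
  have "x = a * (s * r)\<^sup>2" unfolding r(1) power_mult_distrib by (simp only: mult.assoc)
  then show "x \<in> square_class a" by (rule square_classI) (simp add: r(2) assms)
next
  fix x assume "x \<in> square_class a"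
  then obtain r where r: "x = a * r\<^sup>2" "r \<noteq> 0" by (rule square_classE)
  have "x = a * s\<^sup>2 * (r / s)\<^sup>2" unfolding r(1) power_divide using assms by simp
  then show "x \<in> square_class (a * s\<^sup>2)" by (rule square_classI) (simp add: r(2) assms)
qed

lemma carrier_padic_square_classes: "carrier padic_square_classes = {square_class a | a. a \<noteq> 0}"
  unfolding padic_square_classes_def carrier_FactGroup square_class_def padic_mult_group_simps by blast

lemma square_class_mult:
  fixes a b :: "'p :: prime_card padic"
  assumes "a \<noteq> 0" "b \<noteq> 0"
  shows "square_class a \<otimes>\<^bsub>padic_square_classes\<^esub> square_class b = square_class (a * b)"
proof -
  have "a \<in> carrier padic_mult_group" "b \<in> carrier padic_mult_group" using assms by simp_all
  from normal.rcos_sum[OF normal_padic_squares this] show ?thesis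
    by (simp add: padic_square_classes_def square_class_def)
qed

section \<open>The isomorphism and its uniqueness\<close>

context
  fixes P :: "'p :: prime_card itself"
begin

lemma exists_ac_square_root: "\<exists>s. s\<^sup>2 = to_ac (c :: 'p padic)"
  using nth_root_exists[of 2 "to_ac c"] by auto

text \<open>With a root \<open>r c\<close> chosen for every c, let \<chi> say whether \<sigma> fixes
  it; the other root is its negative and has the same sign. Multiplicativity holds because
  \<open>r a * r b\<close> is a square root of a b.\<close>

lemma Gal_character:
  assumes \<sigma>: "\<sigma> \<in> carrier (Gal (M :: 'p padic alg_closure set))"
  shows "\<exists>\<chi> :: 'p padic \<Rightarrow> bool. sign_character \<chi> \<and> (\<forall>s\<in>ac_square_roots. \<sigma> s = root_sign \<chi> s * s)"
proof -
  have hom: "ac_hom M \<sigma>" using \<sigma> by (simp add: M_Gal_iff)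
  have ex: "\<exists>r. \<forall>c :: 'p padic. (r c)\<^sup>2 = to_ac c"
    by (rule choice) (use exists_ac_square_root in blast)
  then obtain r where r: "\<And>c :: 'p padic. (r c)\<^sup>2 = to_ac c" by blast
  define \<chi> where "\<chi> = (\<lambda>c. \<sigma> (r c) = r c)"
  have sgn: "\<sigma> s = root_sign \<chi> s * s" if s: "s \<in> ac_square_roots" for s
  proof -
    obtain c where c: "s\<^sup>2 = to_ac c" using s unfolding ac_square_roots_def by blast
    then have "s\<^sup>2 = (r c)\<^sup>2" using r by simp
    then have "s = r c \<or> s = - r c" by (simp add: power2_eq_iff)
    moreover have rc: "r c \<in> ac_square_roots" using r by (rule ac_square_rootsI)
    moreover have "\<sigma> (- r c) = - \<sigma> (r c)" by (rule M_Gal_uminus_root[OF \<sigma> rc])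
    moreover have "\<sigma> (r c) = r c \<or> \<sigma> (r c) = - r c" by (rule M_Gal_root[OF \<sigma> rc])
    moreover have "root_sign \<chi> s = (if \<sigma> (r c) = r c then 1 else - 1)"
      unfolding root_sign_eq[OF c] \<chi>_def ..
    ultimately show ?thesis by (elim disjE) simp_all
  qed
  have "sign_character \<chi>"
    unfolding sign_character_def
  proof (intro allI impI)
    fix a b :: "'p padic" assume ab: "a \<noteq> 0" "b \<noteq> 0"
    have S: "r c \<in> ac_square_roots" for c using r by (rule ac_square_rootsI)
    have nz: "r c \<noteq> 0" if "c \<noteq> 0" for c using r[of c] that by auto
    have "(r a * r b)\<^sup>2 = to_ac (a * b)" using r by (simp add: power_mult_distrib)
    from root_sign_eq[OF this, of \<chi>] have 1: "\<sigma> (r a * r b) = (if \<chi> (a * b) then 1 else - 1) * (r a * r b)"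
      using sgn[OF ac_square_roots_mult[OF S S], of a b] by simp
    have 2: "\<sigma> (r c) = (if \<chi> c then 1 else - 1) * r c" for c
      using sgn[OF S, of c] root_sign_eq[OF r, of \<chi> c] by simp
    have "\<sigma> (r a * r b) = \<sigma> (r a) * \<sigma> (r b)"
      using ac_homD(3)[OF hom] kummer_field_root[OF S] by blast
    then show "\<chi> (a * b) \<longleftrightarrow> (\<chi> a \<longleftrightarrow> \<chi> b)"
      unfolding 1 2 using nz[OF ab(1)] nz[OF ab(2)] by (simp split: if_splits)
  qed
  with sgn show ?thesis by blast
qed

text \<open>The signs on square roots determine \<sigma>. The condition runs over all
  representatives \<open>a\<close> of \<open>A\<close>, which share the predicate
  \<open>norm_rep a\<close>, so none has to be selected. Restriction to the carrier fixes the values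
  elsewhere, as uniqueness of a function demands.\<close>

definition reciprocity :: "'p padic set \<Rightarrow> 'p padic alg_closure \<Rightarrow> 'p padic alg_closure" where
  "reciprocity = (\<lambda>A\<in>carrier padic_square_classes. SOME \<sigma>. \<sigma> \<in> carrier (Gal M) \<and>
     (\<forall>a. a \<noteq> 0 \<longrightarrow> A = square_class a \<longrightarrow> (\<forall>s\<in>ac_square_roots. \<sigma> s = root_sign (norm_rep a) s * s)))"

lemma reciprocity_extensional: "reciprocity \<in> extensional (carrier padic_square_classes)"
  unfolding reciprocity_def by (rule restrict_extensional)

lemma reciprocity_square_class:
  assumes a: "(a :: 'p padic) \<noteq> 0"
  shows "reciprocity (square_class a) \<in> carrier (Gal M)"
    "s \<in> ac_square_roots \<Longrightarrow> reciprocity (square_class a) s = root_sign (norm_rep a) s * s"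
proof -
  have chi: "sign_character (norm_rep a)"
    by (rule sign_character_norm_rep_right[OF padic_norm_pairing(2)[OF a] a])
  obtain \<sigma> where \<sigma>: "\<sigma> \<in> carrier (Gal M)" "\<forall>s\<in>ac_square_roots. \<sigma> s = root_sign (norm_rep a) s * s"
    using exists_Gal_root_sign[OF chi] by (elim bexE)
  have eq: "norm_rep b = norm_rep a" if sq: "square_class a = square_class b" for b
  proof -
    obtain r where "r \<noteq> 0" "b = a * r\<^sup>2" using square_class_eqD[OF sq] by blast
    then show ?thesis by (simp add: fun_eq_iff norm_rep_mult_square_left)
  qed
  let ?Q = "\<lambda>\<sigma>. \<sigma> \<in> carrier (Gal M) \<and> (\<forall>b. b \<noteq> 0 \<longrightarrow> square_class a = square_class b \<longrightarrow>
      (\<forall>s\<in>ac_square_roots. \<sigma> s = root_sign (norm_rep b) s * s))"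
  have "?Q \<sigma>"
  proof (intro conjI allI impI)
    fix b assume "square_class a = square_class b"
    from eq[OF this] show "\<forall>s\<in>ac_square_roots. \<sigma> s = root_sign (norm_rep b) s * s"
      using \<sigma>(2) by (simp only:)
  qed (rule \<sigma>(1))
  then have Q: "?Q (SOME \<sigma>. ?Q \<sigma>)" by (rule someI[where P = ?Q])
  have "square_class a \<in> carrier padic_square_classes"
    unfolding carrier_padic_square_classes using a by blast
  then have eq: "reciprocity (square_class a) = (SOME \<sigma>. ?Q \<sigma>)"
    unfolding reciprocity_def by (rule restrict_apply')
  show "reciprocity (square_class a) \<in> carrier (Gal M)"
    unfolding eq using Q by (rule conjunct1)
  assume s: "s \<in> ac_square_roots"
  show "reciprocity (square_class a) s = root_sign (norm_rep a) s * s"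
    unfolding eq by (rule Q[THEN conjunct2, THEN spec, THEN mp, OF a, THEN mp, OF refl, THEN bspec, OF s])
qed

lemma root_sign_eq_iff:
  fixes s :: "'p padic alg_closure"
  assumes "s\<^sup>2 = to_ac c" "s \<noteq> 0"
  shows "root_sign \<chi> s * s = s \<longleftrightarrow> \<chi> c"
  unfolding root_sign_eq[OF assms(1)] using assms(2) by simp

text \<open>E is spanned by 1 and \<open>t\<close> over the base, so \<sigma> is trivial on E as
  soon as it fixes \<open>t\<close>.\<close>

lemma Gal_M_restrict_eq_id_iff:
  fixes t :: "'p padic alg_closure"
  assumes \<sigma>: "\<sigma> \<in> carrier (Gal M)" and t: "t \<in> ac_square_roots" "t \<notin> range to_ac"
    and E: "E = adjoin_root (range to_ac) t"
  shows "restrict \<sigma> E = \<one>\<^bsub>Gal E\<^esub> \<longleftrightarrow> \<sigma> t = t"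
proof
  assume "restrict \<sigma> E = \<one>\<^bsub>Gal E\<^esub>"
  from fun_cong[OF this[unfolded Gal_one], of t] show "\<sigma> t = t"
    using quadratic_mem[OF t, of 0 1] by (simp add: E)
next
  assume st: "\<sigma> t = t"
  have hom: "ac_hom M \<sigma>" using \<sigma> by (simp add: M_Gal_iff)
  note D = ac_subfieldD[OF M_subfield] and H = ac_homD[OF hom]
  have tM: "t \<in> M" by (rule kummer_field_root[OF t(1)])
  show "restrict \<sigma> E = \<one>\<^bsub>Gal E\<^esub>"
    unfolding Gal_one
  proof (rule restrict_ext)
    fix x assume "x \<in> E"
    then obtain a b where x: "x = to_ac a + to_ac b * t" unfolding E adjoin_root_def by blast
    show "\<sigma> x = x"
      unfolding x H(2)[OF D(1) D(5)[OF D(1) tM]] H(3)[OF D(1) tM] H(4) st ..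
  qed
qed

text \<open>Formulated for an arbitrary \<rho> because uniqueness applies it to a competitor of
  \<open>reciprocity\<close>.\<close>

lemma restricted_map_kernel:
  fixes t :: "'p padic alg_closure"
  assumes \<rho>: "\<And>a. a \<noteq> 0 \<Longrightarrow> \<rho> (square_class a) \<in> carrier (Gal M)"
    and t: "t \<in> ac_square_roots" "t \<notin> range to_ac" and E: "E = adjoin_root (range to_ac) t"
  shows "kernel padic_mult_group (Gal E) (restricted_map \<rho> E) = {a. a \<noteq> 0 \<and> \<rho> (square_class a) t = t}"
  unfolding kernel_def
proof (intro Collect_cong conj_cong)
  fix a :: "'p padic"
  show "a \<in> carrier padic_mult_group \<longleftrightarrow> a \<noteq> 0" by simp
  assume "a \<noteq> 0"
  from Gal_M_restrict_eq_id_iff[OF \<rho>[OF this] t E]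
  show "restricted_map \<rho> E a = \<one>\<^bsub>Gal E\<^esub> \<longleftrightarrow> \<rho> (square_class a) t = t"
    unfolding restricted_map_def square_class_def .
qed

lemma reciprocity_kernel:
  fixes E :: "'p padic alg_closure set"
  assumes "quadratic_extension E"
  shows "kernel padic_mult_group (Gal E) (restricted_map reciprocity E) = padic_norm E ` (E - {0})"
proof -
  obtain t where t: "t \<in> ac_square_roots" "t \<notin> range to_ac" and E: "E = adjoin_root (range to_ac) t"
    using quadratic_extensionE[OF assms] .
  have "t \<noteq> 0" using t(2) by (metis rangeI to_ac_0)
  obtain c where c: "t\<^sup>2 = to_ac c" "c \<noteq> 0" using ac_square_rootsE[OF t(1) \<open>t \<noteq> 0\<close>] .
  have "reciprocity (square_class a) t = t \<longleftrightarrow> norm_rep a c" if "a \<noteq> 0" for a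
    unfolding reciprocity_square_class(2)[OF that t(1)] by (rule root_sign_eq_iff[OF c(1) \<open>t \<noteq> 0\<close>])
  then have "{a. a \<noteq> 0 \<and> reciprocity (square_class a) t = t} = {a. a \<noteq> 0 \<and> norm_rep a c}"
    by (intro Collect_cong conj_cong refl)
  with restricted_map_kernel[where \<rho> = reciprocity, OF reciprocity_square_class(1) t E] show ?thesis
    unfolding E padic_norm_image[OF t c(1)] by simp
qed

text \<open>On a square root of c the claim is linearity of the Hilbert symbol in its left
  argument.\<close>

lemma reciprocity_hom: "reciprocity \<in> hom padic_square_classes (Gal M)"
proof (rule homI)
  fix A :: "'p padic set" assume "A \<in> carrier padic_square_classes"
  then show "reciprocity A \<in> carrier (Gal M)"
    unfolding carrier_padic_square_classes using reciprocity_square_class(1) by blast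
next
  fix A B :: "'p padic set"
  assume "A \<in> carrier padic_square_classes" "B \<in> carrier padic_square_classes"
  then obtain a b where ab: "A = square_class a" "a \<noteq> 0" "B = square_class b" "b \<noteq> 0"
    unfolding carrier_padic_square_classes by blast
  note R = reciprocity_square_class
  have abn: "a * b \<noteq> 0" using ab by simp
  have "reciprocity (square_class (a * b)) = compose M (reciprocity (square_class a)) (reciprocity (square_class b))"
  proof (rule Gal_M_eqI[OF R(1)[OF abn] compose_M_Gal[OF R(1)[OF ab(2)] R(1)[OF ab(4)]]])
    fix s :: "'p padic alg_closure" assume s: "s \<in> ac_square_roots"
    show "reciprocity (square_class (a * b)) s =
        compose M (reciprocity (square_class a)) (reciprocity (square_class b)) s"
    \<comment> \<open>Characters are multiplicative only on non-zero elements, so the root 0 is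
      treated separately.\<close>
    proof (cases "s = 0")
      case True
      have 0: "reciprocity (square_class x) 0 = 0" if "x \<noteq> 0" for x :: "'p padic"
        using R(2)[OF that, of 0] s True by simp
      show ?thesis using 0[OF abn] 0[OF ab(2)] 0[OF ab(4)] kummer_field_root[OF s] True by (simp add: compose_eq)
    next
      case False
      obtain c where c: "s\<^sup>2 = to_ac c" "c \<noteq> 0" using ac_square_rootsE[OF s False] .
      have "norm_rep (a * b) c \<longleftrightarrow> (norm_rep a c \<longleftrightarrow> norm_rep b c)"
        by (rule sign_character_mult[OF sign_character_norm_rep[OF padic_norm_pairing(2)[OF c(2)]] ab(2,4)])
      note n = this
      show ?thesis
        unfolding compose_eq[OF kummer_field_root[OF s]] R(2)[OF abn s] R(2)[OF ab(4) s]
          root_sign_eq[OF c(1)] n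
        using R(2)[OF ab(2) s] M_Gal_uminus_root[OF R(1)[OF ab(2)] s]
        unfolding root_sign_eq[OF c(1)]
        by (cases "norm_rep a c"; cases "norm_rep b c") simp_all
    qed
  qed
  then show "reciprocity (A \<otimes>\<^bsub>padic_square_classes\<^esub> B) = reciprocity A \<otimes>\<^bsub>Gal M\<^esub> reciprocity B"
    unfolding ab(1,3) square_class_mult[OF ab(2,4)] Gal_mult[OF R(1)[OF ab(2)] R(1)[OF ab(4)]] .
qed

text \<open>Equal signs on all roots make a b a norm for every c. By non-degeneracy a b = s^2, and b
  = a (s / a)^2 lies in the class of a.\<close>

lemma reciprocity_inj: "inj_on reciprocity (carrier padic_square_classes)"
proof (rule inj_onI)
  fix A B :: "'p padic set"
  assume "A \<in> carrier padic_square_classes" "B \<in> carrier padic_square_classes"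
    and eq: "reciprocity A = reciprocity B"
  then obtain a b where ab: "A = square_class a" "a \<noteq> 0" "B = square_class b" "b \<noteq> 0"
    unfolding carrier_padic_square_classes by blast
  have ab0: "a * b \<noteq> 0" using ab by simp
  have "norm_rep (a * b) c" if c: "c \<noteq> 0" for c
  proof -
    obtain s where s: "s\<^sup>2 = to_ac c" using exists_ac_square_root by blast
    have sS: "s \<in> ac_square_roots" by (rule ac_square_rootsI[OF s])
    have s0: "s \<noteq> 0" using s c by auto
    have rs: "root_sign (norm_rep a) s * s = root_sign (norm_rep b) s * s"
      using eq reciprocity_square_class(2)[OF ab(2) sS] reciprocity_square_class(2)[OF ab(4) sS]
      by (simp only: ab(1,3))
    have "norm_rep a c \<longleftrightarrow> norm_rep b c"
      using root_sign_eq_iff[OF s s0, of "norm_rep a"] root_sign_eq_iff[OF s s0, of "norm_rep b"]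
      unfolding rs by blast
    then show ?thesis
      using sign_character_mult[OF sign_character_norm_rep[OF padic_norm_pairing(2)[OF c]] ab(2,4)] by blast
  qed
  then obtain s where s: "a * b = s\<^sup>2" using padic_norm_pairing(3)[OF ab0] by blast
  have "s \<noteq> 0" using s ab0 by auto
  then have sa: "s / a \<noteq> 0" using ab(2) by simp
  have "b = a * (s / a)\<^sup>2"
    unfolding power_divide s[symmetric] using ab(2) by (simp add: power2_eq_square)
  then show "A = B" unfolding ab(1,3) using square_class_mult_square[OF sa, of a] by simp
qed

text \<open>The signs of \<sigma> form a character, and the perfect pairing represents it by some
  \<open>a\<close>.\<close>

lemma reciprocity_surj: "carrier (Gal M) \<subseteq> reciprocity ` carrier padic_square_classes"
proof
  fix \<sigma> assume \<sigma>: "\<sigma> \<in> carrier (Gal (M :: 'p padic alg_closure set))"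
  obtain \<chi> :: "'p padic \<Rightarrow> bool" where chi: "sign_character \<chi>" "\<And>s. s \<in> ac_square_roots \<Longrightarrow> \<sigma> s = root_sign \<chi> s * s"
    using Gal_character[OF \<sigma>] by blast
  obtain a :: "'p padic" where a: "a \<noteq> 0" "\<And>c. c \<noteq> 0 \<Longrightarrow> norm_rep a c \<longleftrightarrow> \<chi> c"
    using padic_norm_pairing(4)[OF chi(1)] by blast
  have "\<sigma> = reciprocity (square_class a)"
  proof (rule Gal_M_eqI[OF \<sigma> reciprocity_square_class(1)[OF a(1)]])
    fix s :: "'p padic alg_closure" assume s: "s \<in> ac_square_roots"
    show "\<sigma> s = reciprocity (square_class a) s"
    proof (cases "s = 0")
      case True
      then show ?thesis using chi(2)[OF s] reciprocity_square_class(2)[OF a(1) s] by simp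
    next
      case False
      obtain c where c: "s\<^sup>2 = to_ac c" "c \<noteq> 0" using ac_square_rootsE[OF s False] .
      show ?thesis
        unfolding chi(2)[OF s] reciprocity_square_class(2)[OF a(1) s] root_sign_eq[OF c(1)] a(2)[OF c(2)] ..
    qed
  qed
  then show "\<sigma> \<in> reciprocity ` carrier padic_square_classes"
    unfolding carrier_padic_square_classes using a(1) by blast
qed

lemma reciprocity_iso: "reciprocity \<in> iso padic_square_classes (Gal M)"
proof (rule isoI[OF reciprocity_hom])
  have "reciprocity ` carrier padic_square_classes \<subseteq> carrier (Gal M)"
    by (rule image_subsetI) (rule hom_in_carrier[OF reciprocity_hom])
  then show "bij_betw reciprocity (carrier padic_square_classes) (carrier (Gal M))"
    by (intro bij_betw_imageI reciprocity_inj equalityI reciprocity_surj)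
qed

text \<open>The kernel for E = K(t), K the base field, tells for which classes the automorphism
  fixes \<open>t\<close>. This suffices, since a root that is not fixed goes to its negative. Roots
  in the base generate no quadratic extension, but every automorphism fixes them.\<close>

lemma reciprocity_unique:
  assumes ext: "\<rho> \<in> extensional (carrier padic_square_classes)"
    and iso: "\<rho> \<in> iso padic_square_classes (Gal M)"
    and ker: "\<And>E. quadratic_extension E \<Longrightarrow>
      kernel padic_mult_group (Gal E) (restricted_map \<rho> E) = padic_norm E ` (E - {0})"
  shows "\<rho> = reciprocity"
proof (rule extensionalityI[OF ext])
  show "reciprocity \<in> extensional (carrier padic_square_classes)" by (rule reciprocity_extensional)
  fix A :: "'p padic set" assume "A \<in> carrier padic_square_classes"
  then obtain a where A: "A = square_class a" "a \<noteq> 0" unfolding carrier_padic_square_classes by blast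
  have \<rho>: "\<rho> (square_class b) \<in> carrier (Gal M)" if "b \<noteq> 0" for b
  proof -
    have "square_class b \<in> carrier padic_square_classes"
      unfolding carrier_padic_square_classes using that by blast
    then show ?thesis by (rule hom_in_carrier[OF iso[unfolded iso_def mem_Collect_eq, THEN conjunct1]])
  qed
  show "\<rho> A = reciprocity A"
    unfolding A(1)
  proof (rule Gal_M_eqI[OF \<rho>[OF A(2)] reciprocity_square_class(1)[OF A(2)]])
    fix t :: "'p padic alg_closure" assume t: "t \<in> ac_square_roots"
    show "\<rho> (square_class a) t = reciprocity (square_class a) t"
    proof (cases "t \<in> range to_ac")
      case True
      then obtain k where k: "t = to_ac k" by blast
      have "ac_hom M (\<rho> (square_class a))" "ac_hom M (reciprocity (square_class a))"
        using \<rho>[OF A(2)] reciprocity_square_class(1)[OF A(2)] by (simp_all add: M_Gal_iff)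
      from this[THEN ac_homD(4)] show ?thesis unfolding k by simp
    next
      case False
      let ?E = "adjoin_root (range to_ac) t"
      have E: "quadratic_extension ?E" by (rule quadratic_extension_adjoin_root[OF t False])
      have "kernel padic_mult_group (Gal ?E) (restricted_map \<rho> ?E) =
          {a. a \<noteq> 0 \<and> \<rho> (square_class a) t = t}"
        using \<rho> by (rule restricted_map_kernel[where \<rho> = \<rho>, OF _ t False refl])
      then have 1: "padic_norm ?E ` (?E - {0}) = {a. a \<noteq> 0 \<and> \<rho> (square_class a) t = t}"
        unfolding ker[OF E] .
      have "kernel padic_mult_group (Gal ?E) (restricted_map reciprocity ?E) =
          {a. a \<noteq> 0 \<and> reciprocity (square_class a) t = t}"
        using reciprocity_square_class(1)
        by (rule restricted_map_kernel[where \<rho> = reciprocity, OF _ t False refl])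
      then have 2: "padic_norm ?E ` (?E - {0}) = {a. a \<noteq> 0 \<and> reciprocity (square_class a) t = t}"
        unfolding reciprocity_kernel[OF E] .
      have iff: "\<rho> (square_class a) t = t \<longleftrightarrow> reciprocity (square_class a) t = t"
      proof
        assume "\<rho> (square_class a) t = t"
        then have "a \<in> padic_norm ?E ` (?E - {0})" unfolding 1 using A(2) by (intro CollectI conjI)
        then show "reciprocity (square_class a) t = t" unfolding 2 by (elim CollectE conjE)
      next
        assume "reciprocity (square_class a) t = t"
        then have "a \<in> padic_norm ?E ` (?E - {0})" unfolding 2 using A(2) by (intro CollectI conjI)
        then show "\<rho> (square_class a) t = t" unfolding 1 by (elim CollectE conjE)
      qed
      show ?thesis
      proof (cases "reciprocity (square_class a) t = t")
        case True
        then show ?thesis using iff by (simp only:)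
      next
        case False
        then have "reciprocity (square_class a) t = - t"
          using M_Gal_root[OF reciprocity_square_class(1)[OF A(2)] t] by blast
        moreover have "\<rho> (square_class a) t = - t"
          using M_Gal_root[OF \<rho>[OF A(2)] t] False iff by blast
        ultimately show ?thesis by (simp only:)
      qed
    qed
  qed
qed

end

theorem mainTheorem6:
  shows "\<exists>!\<rho> :: 'p :: prime_card padic set \<Rightarrow> 'p padic alg_closure \<Rightarrow> 'p padic alg_closure.
    \<rho> \<in> extensional (carrier padic_square_classes) \<and>
    \<rho> \<in> iso padic_square_classes (Gal max_abelian_exp2) \<and>
    (\<forall>E. quadratic_extension E \<longrightarrow>
      kernel padic_mult_group (Gal E) (restricted_map \<rho> E) = padic_norm E ` (E - {0}))"
  unfolding max_abelian_exp2_eq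
proof (intro ex1I conjI allI impI)
  show "reciprocity \<in> extensional (carrier padic_square_classes)" by (rule reciprocity_extensional)
  show "reciprocity \<in> iso padic_square_classes (Gal kummer_field)" by (rule reciprocity_iso)
  show "kernel padic_mult_group (Gal E) (restricted_map reciprocity E) = padic_norm E ` (E - {0})"
    if "quadratic_extension E" for E :: "'p padic alg_closure set"
    using that by (rule reciprocity_kernel)
next
  fix \<rho> :: "'p padic set \<Rightarrow> 'p padic alg_closure \<Rightarrow> 'p padic alg_closure"
  assume \<rho>: "\<rho> \<in> extensional (carrier padic_square_classes) \<and>
    \<rho> \<in> iso padic_square_classes (Gal kummer_field) \<and>
    (\<forall>E. quadratic_extension E \<longrightarrow>
      kernel padic_mult_group (Gal E) (restricted_map \<rho> E) = padic_norm E ` (E - {0}))"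
  show "\<rho> = reciprocity"
  proof (rule reciprocity_unique)
    show "\<rho> \<in> extensional (carrier padic_square_classes)" using \<rho> by (rule conjunct1)
    show "\<rho> \<in> iso padic_square_classes (Gal kummer_field)"
      using \<rho>[THEN conjunct2] by (rule conjunct1)
    show "kernel padic_mult_group (Gal E) (restricted_map \<rho> E) = padic_norm E ` (E - {0})"
      if "quadratic_extension E" for E
      by (rule \<rho>[THEN conjunct2, THEN conjunct2, THEN spec, THEN mp, OF that])
  qed
qed

end
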